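(* Let $M,N,T,R>0$ and $0<\delta<1/2$ be constants, let $Q_{R,T}=(\mathbb R^n\setminus B_R)\times[0,T]$, and let $u:Q_{R,T}\to\mathbb R$ (of class $C^2$ in $x$ and $C^1$ in $t$) satisfy $$|\Delta u+\partial_t u|\le M|\nabla u|+(N|x|^\delta+M)|u|\quad\text{and}\quad |u(x,t)|\le Me^{M|x|^2}$$ on $Q_{R,T}$. If $u(x,0)\equiv 0$ in $\mathbb R^n\setminus B_R$, then $u$ vanishes identically in $Q_{R,T}$.
   Context: $B_R\subset\mathbb R^n$ is the open Euclidean ball of radius $R$ centered at the origin; $\nabla$ and $\Delta$ are the Euclidean gradient and Laplacian in $x$. *)

theory Defs
  imports "HOL-Analysis.Analysis"
begin

text \<open>
  The domain \<open>(\<real>\<^sup>n - B\<^sub>R) \<times> [0,T]\<close> is closed, so all derivatives are taken relative to it, that is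
  one-sidedly at boundary points. They are unique there: see \<open>frechet_derivative_exterior\<close>
  for the space variable and \<open>vector_derivative_unique_within_closed_interval\<close> for the time variable.
\<close>

definition exterior :: "real \<Rightarrow> 'a::euclidean_space set" where
  "exterior R = UNIV - ball 0 R"

definition partial_within :: "'a::euclidean_space set \<Rightarrow> 'a \<Rightarrow> ('a \<Rightarrow> real) \<Rightarrow> 'a \<Rightarrow> real" where
  "partial_within S b f x = frechet_derivative f (at x within S) b"

definition grad_within :: "'a::euclidean_space set \<Rightarrow> ('a \<Rightarrow> real) \<Rightarrow> 'a \<Rightarrow> 'a" where
  "grad_within S f x = (\<Sum>b\<in>Basis. partial_within S b f x *\<^sub>R b)"

definition laplacian_within :: "'a::euclidean_space set \<Rightarrow> ('a \<Rightarrow> real) \<Rightarrow> 'a \<Rightarrow> real" where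
  "laplacian_within S f x = (\<Sum>b\<in>Basis. partial_within S b (partial_within S b f) x)"

text \<open>
  The class \<open>C\<^sup>2\<^sup>,\<^sup>1(S \<times> I)\<close>: twice differentiable in space and once in time, with \<open>u\<close> and all these
  derivatives jointly continuous on \<open>S \<times> I\<close>, including its boundary.
\<close>

definition C21_on :: "'a::euclidean_space set \<Rightarrow> real set \<Rightarrow> ('a \<Rightarrow> real \<Rightarrow> real) \<Rightarrow> bool" where
  "C21_on S I u \<longleftrightarrow>
     (\<forall>x\<in>S. \<forall>t\<in>I.
        (\<lambda>y. u y t) differentiable (at x within S) \<and>
        (\<forall>b\<in>Basis. partial_within S b (\<lambda>y. u y t) differentiable (at x within S)) \<and>
        u x differentiable (at t within I)) \<and>
     continuous_on (S \<times> I) (\<lambda>(x, t). u x t) \<and>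
     (\<forall>b\<in>Basis. continuous_on (S \<times> I) (\<lambda>(x, t). partial_within S b (\<lambda>y. u y t) x)) \<and>
     (\<forall>b\<in>Basis. \<forall>c\<in>Basis. continuous_on (S \<times> I)
        (\<lambda>(x, t). partial_within S c (partial_within S b (\<lambda>y. u y t)) x)) \<and>
     continuous_on (S \<times> I) (\<lambda>(x, t). vector_derivative (u x) (at t within I))"

lemma frechet_derivative_exterior:
  fixes f :: "'a::euclidean_space \<Rightarrow> real"
  assumes "R > 0" "x \<in> exterior R" and f: "(f has_derivative f') (at x within exterior R)"
  shows "frechet_derivative f (at x within exterior R) = f'"
proof -
  have *: "\<exists>d. 0 < \<bar>d\<bar> \<and> \<bar>d\<bar> < e \<and> x + d *\<^sub>R i \<in> exterior R"
    if i: "i \<in> Basis" and e: "0 < e" for i :: 'a and e :: real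
  proof -
    define d where "d = (if x \<bullet> i \<ge> 0 then e / 2 else - (e / 2))"
    have "0 \<le> d * (x \<bullet> i)"
      using e by (auto simp: d_def mult_nonneg_nonneg mult_nonneg_nonpos)
    moreover have "(norm (x + d *\<^sub>R i))\<^sup>2 = (norm x)\<^sup>2 + 2 * (d * (x \<bullet> i)) + d\<^sup>2"
      unfolding power2_norm_eq_inner using i
      by (simp add: inner_add_left inner_add_right inner_commute power2_eq_square)
    ultimately have "(norm x)\<^sup>2 \<le> (norm (x + d *\<^sub>R i))\<^sup>2"
      by simp
    then have "norm x \<le> norm (x + d *\<^sub>R i)"
      using norm_ge_zero power2_le_imp_le by blast
    then have "x + d *\<^sub>R i \<in> exterior R"
      using assms(2) by (auto simp: exterior_def)
    moreover have "0 < \<bar>d\<bar>" "\<bar>d\<bar> < e"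
      using e by (auto simp: d_def)
    ultimately show ?thesis
      by blast
  qed
  have "(f has_derivative frechet_derivative f (at x within exterior R)) (at x within exterior R)"
    using f differentiableI frechet_derivative_works by blast
  then show ?thesis
    using f * by (rule frechet_derivative_unique_within)
qed

end

theory Submission
  imports Defs "HOL-Probability.Distributions"
begin

text \<open>
  The proof is by Carleman inequalities, on the half-spaces \<open>{x. x \<bullet> e > R}\<close> for unit vectors \<open>e\<close>;
  these half-spaces cover the open exterior of the ball. Working on a half-space makes it possible
  to use weights \<open>exp \<phi>\<close> with a phase
  \<open>\<phi>(x,t) = \<kappa>(t) |x|\<^sup>2 + a(t) (x \<bullet> e - b)\<close>,
  \<open>\<kappa>\<close> affine in \<open>t\<close>, whose derivatives are polynomials in \<open>x\<close>.

  Put \<open>v = exp(\<phi> + l t / 2) w\<close> and conjugate \<open>w\<^sub>t + \<Delta>w\<close> with the weight.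
  The result is \<open>S v + (A v - l v / 2)\<close> with \<open>S = \<Delta> + X\<close> symmetric, \<open>X = |\<nabla>\<phi>|\<^sup>2 - \<phi>\<^sub>t\<close>, and
  \<open>A = \<partial>\<^sub>t - 2 \<nabla>\<phi> \<bullet> \<nabla> - \<Delta>\<phi>\<close> antisymmetric. Since \<open>(x + y)\<^sup>2 \<ge> 2 x y\<close>, the integral of the
  square bounds a quadratic form in \<open>\<nabla>v\<close> and \<open>v\<close> with coefficients \<open>8\<kappa> + l\<close> and \<open>Q\<close>
  (\<open>carleman_conjugated\<close>). If these dominate \<open>3M\<^sup>2\<close> and \<open>3(M|\<nabla>\<phi>| + V|x|)\<^sup>2 + 1\<close>, the right hand side
  of the differential inequality is absorbed and only the error of the cutoffs remains
  (\<open>carleman_absorbed\<close>). The potential enters through the bound \<open>N|x|\<^sup>\<delta> + M \<le> V|x|\<close> for \<open>|x| > R\<close>.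

  Take \<open>a(t) = \<alpha> (T' - t)\<^sub>+\<^sup>3\<close> and let \<open>\<alpha>\<close> tend to infinity. The cutoff errors live
  near the face of the half-space, at times after \<open>T'\<close>, and near spatial infinity; there the weight is
  exponentially smaller in \<open>\<alpha>\<close> than at points well inside the half-space and at early times, so the
  solution vanishes at the latter points (\<open>carleman_vanishing\<close>). This is used twice for a solution that
  vanishes up to some time \<open>s\<close>.

  \<^item> Nothing is known about the solution at infinity except \<open>|u| \<le> M exp(M|x|\<^sup>2)\<close>, so \<open>\<kappa>\<close> has to be
    very negative to begin with, but may increase steeply in time. Such a phase is concave in \<open>x\<close>, which
    is compensated by the factor \<open>exp(l t / 2)\<close> with large \<open>l\<close>. The linear term has to be
    centred at \<open>b = 0\<close>, hence one loses space: the solution vanishes only for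
    \<open>|x| > 4R\<close>, for a short time after \<open>s\<close> (\<open>vanishes_far_out\<close>).
  \<^item> Now the solution has bounded support for a short time, and a convex phase with constant
    \<open>\<kappa> > 0\<close> is admissible. Here \<open>b\<close> may be taken at the face of the half-space, and the solution
    vanishes on all of \<open>|x| > R\<close> for a shorter time that depends neither on the point nor on
    the half-space (\<open>vanishes_a_little_longer\<close>).

  Hence the supremum of the times up to which the solution vanishes cannot be smaller than \<open>T\<close>.

  The control at infinity of the gradient in the first use comes from an energy estimate
  (\<open>caccioppoli\<close>). All integrals are over space-time. Since
  \<open>u(x,0) = 0\<close>, the differential inequality gives \<open>u\<^sub>t(x,0) = 0\<close>, so \<open>u\<close> extended by zero to negative
  times is still of class \<open>C\<^sup>2\<^sup>,\<^sup>1\<close>, and no boundary terms in time occur.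
\<close>


section \<open>Directional derivatives\<close>

text \<open>
  Only directional derivatives along coordinate axes are used. They turn every product and chain
  rule below into a statement about functions of one real variable.
\<close>

definition has_dir_deriv :: "'b::real_normed_vector \<Rightarrow> ('b \<Rightarrow> real) \<Rightarrow> real \<Rightarrow> 'b \<Rightarrow> bool" where
  "has_dir_deriv e f D z \<longleftrightarrow> ((\<lambda>h. f (z + h *\<^sub>R e)) has_real_derivative D) (at 0)"

lemma dir_deriv_const: "has_dir_deriv e (\<lambda>z. c) 0 z"
  by (simp add: has_dir_deriv_def)

lemma dir_deriv_add: "has_dir_deriv e f D z \<Longrightarrow> has_dir_deriv e g E z \<Longrightarrow> has_dir_deriv e (\<lambda>z. f z + g z) (D + E) z"
  unfolding has_dir_deriv_def by (rule DERIV_add)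

lemma dir_deriv_diff: "has_dir_deriv e f D z \<Longrightarrow> has_dir_deriv e g E z \<Longrightarrow> has_dir_deriv e (\<lambda>z. f z - g z) (D - E) z"
  unfolding has_dir_deriv_def by (rule DERIV_diff)

lemma dir_deriv_mult: "has_dir_deriv e f D z \<Longrightarrow> has_dir_deriv e g E z \<Longrightarrow> has_dir_deriv e (\<lambda>z. f z * g z) (f z * E + D * g z) z"
  unfolding has_dir_deriv_def by (drule (1) DERIV_mult') simp

lemma dir_deriv_cmult: "has_dir_deriv e f D z \<Longrightarrow> has_dir_deriv e (\<lambda>z. c * f z) (c * D) z"
  using dir_deriv_mult[OF dir_deriv_const, of e f D z c] by simp

lemma dir_deriv_chain:
  "has_dir_deriv e f D z \<Longrightarrow> (F has_real_derivative F') (at (f z)) \<Longrightarrow> has_dir_deriv e (\<lambda>z. F (f z)) (F' * D) z"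
  unfolding has_dir_deriv_def by (drule DERIV_chain2[where g = "\<lambda>h. f (z + h *\<^sub>R e)" and x = 0, rotated]) simp_all

lemma dir_deriv_unique: "has_dir_deriv e f D z \<Longrightarrow> has_dir_deriv e f E z \<Longrightarrow> D = E"
  unfolding has_dir_deriv_def by (rule DERIV_unique)

lemma dir_deriv_eq: "has_dir_deriv e f D z \<Longrightarrow> D = E \<Longrightarrow> has_dir_deriv e f E z"
  by simp

lemma dir_deriv_line:
  "has_dir_deriv e f D (z + h *\<^sub>R e) \<Longrightarrow> ((\<lambda>h. f (z + h *\<^sub>R e)) has_real_derivative D) (at h)"
  using DERIV_shift[of "\<lambda>h. f (z + h *\<^sub>R e)" D 0 h]
  by (simp add: has_dir_deriv_def scaleR_add_left add.assoc add.commute add.left_commute)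

lemma dir_deriv_shift: "has_dir_deriv e f D (z + c) \<Longrightarrow> has_dir_deriv e (\<lambda>z. f (z + c)) D z"
  unfolding has_dir_deriv_def by (simp add: add.assoc add.commute add.left_commute)

lemma eventually_line:
  fixes z e :: "'b::real_normed_vector"
  assumes "open S" "z \<in> S"
  shows "\<forall>\<^sub>F h in nhds (0::real). z + h *\<^sub>R e \<in> S"
proof -
  have "((\<lambda>h. z + h *\<^sub>R e) \<longlongrightarrow> z + 0 *\<^sub>R e) (nhds (0::real))"
    by (intro tendsto_add tendsto_scaleR tendsto_const) (simp add: filterlim_ident)
  then show ?thesis
    using assms by (auto dest: topological_tendstoD)
qed

lemma dir_deriv_cong:
  assumes "has_dir_deriv e f D z" "open S" "z \<in> S" "\<And>y. y \<in> S \<Longrightarrow> f y = g y"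
  shows "has_dir_deriv e g D z"
proof -
  have "\<forall>\<^sub>F h in nhds 0. f (z + h *\<^sub>R e) = g (z + h *\<^sub>R e)"
    using eventually_line[OF assms(2,3)] by (rule eventually_mono) (use assms in auto)
  then show ?thesis
    using assms(1) unfolding has_dir_deriv_def by (subst (asm) DERIV_cong_ev) auto
qed

section \<open>Continuous functions of compact support and integration by parts\<close>

definition Cc :: "('b::euclidean_space \<Rightarrow> real) \<Rightarrow> bool" where
  "Cc f \<longleftrightarrow> continuous_on UNIV f \<and> (\<exists>r. \<forall>z. r < norm z \<longrightarrow> f z = 0)"

lemma Cc_cont: "Cc f \<Longrightarrow> continuous_on UNIV f"
  by (simp add: Cc_def)

lemma Cc_integrable:
  assumes "Cc f" shows "integrable lborel f"
proof -
  obtain r where r: "\<And>z. r < norm z \<Longrightarrow> f z = 0"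
    using assms by (auto simp: Cc_def)
  have "integrable lborel (\<lambda>x. indicator (cball 0 r) x *\<^sub>R f x)"
    using assms by (intro borel_integrable_compact) (auto simp: Cc_def intro: continuous_on_subset)
  moreover have "(\<lambda>x. indicator (cball 0 r) x *\<^sub>R f x) = f"
    using r by (auto simp: indicator_def fun_eq_iff)
  ultimately show ?thesis
    by metis
qed

lemma Cc_mult_left: "Cc f \<Longrightarrow> continuous_on UNIV g \<Longrightarrow> Cc (\<lambda>z. g z * f z)"
  unfolding Cc_def by (auto intro!: continuous_intros)

lemma Cc_mult_right: "Cc f \<Longrightarrow> continuous_on UNIV g \<Longrightarrow> Cc (\<lambda>z. f z * g z)"
  unfolding Cc_def by (auto intro!: continuous_intros)

lemma Cc_add: "Cc f \<Longrightarrow> Cc g \<Longrightarrow> Cc (\<lambda>z. f z + g z)"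
  unfolding Cc_def
  by (auto intro!: continuous_intros) (metis add.right_neutral max_less_iff_conj)

lemma Cc_cmult: "Cc f \<Longrightarrow> Cc (\<lambda>z. c * f z)"
  by (intro Cc_mult_left continuous_intros)

lemma Cc_minus: "Cc f \<Longrightarrow> Cc (\<lambda>z. - f z)"
  using Cc_cmult[of f "-1"] by simp

lemma Cc_diff: "Cc f \<Longrightarrow> Cc g \<Longrightarrow> Cc (\<lambda>z. f z - g z)"
  using Cc_add[OF _ Cc_minus, of f g] by simp

lemma Cc_zero: "Cc (\<lambda>z. 0)"
  by (auto simp: Cc_def)

lemma Cc_sum: "(\<And>i. i \<in> I \<Longrightarrow> Cc (f i)) \<Longrightarrow> Cc (\<lambda>z. \<Sum>i\<in>I. f i z)"
  by (induction I rule: infinite_finite_induct) (auto intro: Cc_add Cc_zero)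

lemma Cc_power2: "Cc f \<Longrightarrow> Cc (\<lambda>z. (f z)\<^sup>2)"
  unfolding power2_eq_square by (intro Cc_mult_left) (auto simp: Cc_def)

lemma dir_deriv_outside:
  assumes "\<And>z. has_dir_deriv e f (f' z) z" "\<And>z. r < norm z \<Longrightarrow> f z = 0" "r < norm z"
  shows "f' z = 0"
proof -
  have "open {z::'a. r < norm z}"
    by (intro open_Collect_less continuous_intros)
  then have "has_dir_deriv e (\<lambda>z. 0) (f' z) z"
    using assms by (intro dir_deriv_cong[OF assms(1), of "{z. r < norm z}"]) auto
  then show ?thesis
    using dir_deriv_const dir_deriv_unique by blast
qed

lemma Cc_dir_deriv:
  assumes "Cc f" "\<And>z. has_dir_deriv e f (f' z) z" "continuous_on UNIV f'"
  shows "Cc f'"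
proof -
  obtain r where r: "\<And>z. r < norm z \<Longrightarrow> f z = 0"
    using assms by (auto simp: Cc_def)
  show ?thesis
    unfolding Cc_def using assms(3) dir_deriv_outside[OF assms(2) r] by blast
qed

lemma integral_translate:
  fixes f :: "'b::euclidean_space \<Rightarrow> real"
  assumes "continuous_on UNIV f"
  shows "(\<integral>z. f (z + c) \<partial>lborel) = (\<integral>z. f z \<partial>lborel)"
proof -
  have "f \<in> borel_measurable borel"
    using assms by (rule borel_measurable_continuous_onI)
  then have "(\<integral>z. f z \<partial>distr lborel borel ((+) c)) = (\<integral>z. f (c + z) \<partial>lborel)"
    by (intro integral_distr) auto
  then show ?thesis
    by (simp add: lborel_distr_plus add.commute)
qed

lemma Cc_translate:
  assumes "Cc f" shows "Cc (\<lambda>z. f (z + c))"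
proof -
  obtain r where r: "\<And>z. r < norm z \<Longrightarrow> f z = 0"
    using assms by (auto simp: Cc_def)
  have "f (z + c) = 0" if "r + norm c < norm z" for z
    using norm_triangle_ineq4[of "z + c" c] that by (intro r) auto
  moreover have "continuous_on UNIV (\<lambda>z. f (z + c))"
    using assms unfolding Cc_def
    by (auto intro!: continuous_intros continuous_on_compose2[of UNIV f])
  ultimately show ?thesis
    unfolding Cc_def by blast
qed

text \<open>Dominated convergence in the form needed for difference quotients of functions in \<open>C\<^sub>c\<close>.\<close>

lemma integral_limit:
  fixes g :: "nat \<Rightarrow> 'b::euclidean_space \<Rightarrow> real"
  assumes "\<And>n. continuous_on UNIV (g n)" "\<And>z. (\<lambda>n. g n z) \<longlonglongrightarrow> f z"
    and "\<And>n z. r < norm z \<Longrightarrow> g n z = 0" "\<And>n z. norm z \<le> r \<Longrightarrow> \<bar>g n z\<bar> \<le> C"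
  shows "(\<lambda>n. \<integral>z. g n z \<partial>lborel) \<longlonglongrightarrow> (\<integral>z. f z \<partial>lborel)"
proof (rule integral_dominated_convergence[where w = "\<lambda>z. indicator (cball 0 r) z *\<^sub>R C"])
  show meas: "g n \<in> borel_measurable lborel" for n
    using borel_measurable_continuous_onI[OF assms(1)] by simp
  show "f \<in> borel_measurable lborel"
    using assms(2) meas by (rule borel_measurable_LIMSEQ_real)
  show "integrable lborel (\<lambda>z. indicator (cball 0 r :: 'b set) z *\<^sub>R C)"
    by (intro borel_integrable_compact) auto
  show "AE z in lborel. norm (g n z) \<le> indicator (cball 0 r) z *\<^sub>R C" for n
    using assms(3,4) by (intro AE_I2) (auto simp: indicator_def not_le)
qed (use assms in auto)

definition diff_quot :: "'b::real_normed_vector \<Rightarrow> ('b \<Rightarrow> real) \<Rightarrow> nat \<Rightarrow> 'b \<Rightarrow> real" where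
  "diff_quot e f n z = real (Suc n) * (f (z + inverse (real (Suc n)) *\<^sub>R e) - f z)"

lemma diff_quot_tendsto:
  assumes "has_dir_deriv e f D z" shows "(\<lambda>n. diff_quot e f n z) \<longlonglongrightarrow> D"
proof -
  have "((\<lambda>h. (f (z + h *\<^sub>R e) - f z) / h) \<longlongrightarrow> D) (at 0)"
    using assms by (simp add: has_dir_deriv_def DERIV_def)
  moreover have "filterlim (\<lambda>n. inverse (real (Suc n))) (at 0) sequentially"
    unfolding filterlim_at using LIMSEQ_inverse_real_of_nat by auto
  ultimately have "((\<lambda>n. (f (z + inverse (real (Suc n)) *\<^sub>R e) - f z) / inverse (real (Suc n))) \<longlongrightarrow> D) sequentially"
    by (rule filterlim_compose)
  then show ?thesis
    by (simp add: diff_quot_def field_simps)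
qed

lemma inverse_Suc_bounds: "0 < inverse (real (Suc n))" "inverse (real (Suc n)) \<le> 1"
  by (auto simp: field_simps)

lemma diff_quot_bound:
  assumes "\<And>z. has_dir_deriv e f (f' z) z" "norm z \<le> r" "\<And>z. norm z \<le> r + norm e \<Longrightarrow> \<bar>f' z\<bar> \<le> B"
  shows "\<bar>diff_quot e f n z\<bar> \<le> B"
proof -
  define h where "h = inverse (real (Suc n))"
  have h: "0 < h" "h \<le> 1"
    unfolding h_def by (rule inverse_Suc_bounds)+
  obtain y where y: "0 < y" "y < h" and
    eq: "f (z + h *\<^sub>R e) - f (z + 0 *\<^sub>R e) = (h - 0) * f' (z + y *\<^sub>R e)"
    using MVT2[OF h(1), of "\<lambda>h. f (z + h *\<^sub>R e)" "\<lambda>y. f' (z + y *\<^sub>R e)"] dir_deriv_line[OF assms(1)]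
    by blast
  have "norm (y *\<^sub>R e) \<le> 1 * norm e"
    unfolding norm_scaleR using y h by (intro mult_right_mono) auto
  then have "norm (z + y *\<^sub>R e) \<le> r + norm e"
    using assms(2) norm_triangle_ineq[of z "y *\<^sub>R e"] by linarith
  moreover have "diff_quot e f n z = f' (z + y *\<^sub>R e)"
    using eq h unfolding diff_quot_def h_def[symmetric] by (simp add: h_def field_simps)
  ultimately show ?thesis
    using assms(3) by simp
qed

lemma continuous_bounded_cball:
  fixes f :: "'b::euclidean_space \<Rightarrow> real"
  assumes "continuous_on UNIV f"
  obtains B where "B \<ge> 0" "\<And>z. norm z \<le> r \<Longrightarrow> \<bar>f z\<bar> \<le> B"
proof -
  have "bounded (f ` cball 0 r)"
    using assms by (intro compact_imp_bounded compact_continuous_image) (auto intro: continuous_on_subset)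
  then obtain B where "\<forall>z\<in>cball 0 r. \<bar>f z\<bar> \<le> B"
    unfolding bounded_iff by (auto simp del: mem_cball)
  then show thesis
    by (intro that[of "max 0 B"]) (auto simp: le_max_iff_disj)
qed

lemma continuous_shift:
  fixes f :: "'b::real_normed_vector \<Rightarrow> real"
  shows "continuous_on UNIV f \<Longrightarrow> continuous_on UNIV (\<lambda>z. f (z + c))"
  by (auto intro!: continuous_intros continuous_on_compose2[of UNIV f])

lemma continuous_diff_quot: "continuous_on UNIV f \<Longrightarrow> continuous_on UNIV (diff_quot e f n)"
  unfolding diff_quot_def by (intro continuous_intros continuous_shift)

text \<open>
  The integral of a difference quotient is zero by translation invariance of Lebesgue measure;
  no iterated integrals are needed.
\<close>

lemma integral_dir_deriv_zero:
  assumes "Cc f" "\<And>z. has_dir_deriv e f (f' z) z" "continuous_on UNIV f'"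
  shows "(\<integral>z. f' z \<partial>lborel) = 0"
proof -
  obtain r where r: "\<And>z. r < norm z \<Longrightarrow> f z = 0"
    using assms by (auto simp: Cc_def)
  obtain B where B: "\<And>z. norm z \<le> r + norm e + norm e \<Longrightarrow> \<bar>f' z\<bar> \<le> B"
    using continuous_bounded_cball[OF assms(3)] by blast
  have "(\<lambda>n. \<integral>z. diff_quot e f n z \<partial>lborel) \<longlonglongrightarrow> (\<integral>z. f' z \<partial>lborel)"
  proof (rule integral_limit[where r = "r + norm e" and C = B])
    show "continuous_on UNIV (diff_quot e f n)" for n
      using Cc_cont[OF assms(1)] by (rule continuous_diff_quot)
    show "(\<lambda>n. diff_quot e f n z) \<longlonglongrightarrow> f' z" for z
      by (rule diff_quot_tendsto) fact
    show "diff_quot e f n z = 0" if "r + norm e < norm z" for n z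
    proof -
      let ?h = "inverse (real (Suc n)) *\<^sub>R e"
      have "norm ?h \<le> 1 * norm e"
        unfolding norm_scaleR using inverse_Suc_bounds[of n] by (intro mult_right_mono) auto
      moreover have "norm z \<le> norm (z + ?h) + norm ?h"
        using norm_triangle_ineq4[of "z + ?h" ?h] by simp
      ultimately have "r < norm (z + ?h)" "r < norm z"
        using that norm_ge_zero[of e] by linarith+
      then show ?thesis
        by (simp add: diff_quot_def r)
    qed
    show "\<bar>diff_quot e f n z\<bar> \<le> B" if "norm z \<le> r + norm e" for n z
      using assms(2) that B by (rule diff_quot_bound)
  qed
  moreover have "(\<integral>z. diff_quot e f n z \<partial>lborel) = 0" for n
    unfolding diff_quot_def using assms(1)
    by (simp add: Cc_integrable Cc_translate integral_translate Cc_cont)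
  ultimately show ?thesis
    by (simp add: LIMSEQ_const_iff)
qed

lemma integral_by_parts:
  assumes "Cc f" "\<And>z. has_dir_deriv e f (f' z) z" "continuous_on UNIV f'"
    and "continuous_on UNIV g" "\<And>z. has_dir_deriv e g (g' z) z" "continuous_on UNIV g'"
  shows "(\<integral>z. f' z * g z \<partial>lborel) = - (\<integral>z. f z * g' z \<partial>lborel)"
proof -
  have "(\<integral>z. f z * g' z + f' z * g z \<partial>lborel) = 0"
    using assms Cc_cont[OF assms(1)]
    by (intro integral_dir_deriv_zero[of "\<lambda>z. f z * g z"] Cc_mult_right dir_deriv_mult continuous_intros)
  moreover have "Cc f'"
    by (rule Cc_dir_deriv) fact+
  ultimately show ?thesis
    using assms by (simp add: Cc_integrable Cc_mult_right)
qed

text \<open>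
  The formal computation integrates by parts in direction \<open>b\<close> and uses
  \<open>2 v\<^sub>b v\<^sub>b\<^sub>e = (v\<^sub>b\<^sup>2)\<^sub>e\<close>. Here \<open>v\<^sub>b\<^sub>e\<close> need not exist (for \<open>e\<close> the time direction it does
  not), so \<open>v\<^sub>e\<close> is replaced by a difference quotient and
  \<open>2 v\<^sub>b v\<^sub>b\<^sub>e\<close> by a difference of squares.
\<close>

lemma integral_second_derivative_times_derivative:
  fixes v :: "'b::euclidean_space \<Rightarrow> real"
  assumes v: "Cc v" "\<And>z. has_dir_deriv b v (vb z) z" "\<And>z. has_dir_deriv b vb (vbb z) z" "\<And>z. has_dir_deriv e v (ve z) z"
    and mu: "\<And>z. has_dir_deriv b mu (mub z) z" "\<And>z. has_dir_deriv e mu (mue z) z"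
    and cont: "continuous_on UNIV vb" "continuous_on UNIV vbb" "continuous_on UNIV ve"
      "continuous_on UNIV mu" "continuous_on UNIV mub" "continuous_on UNIV mue"
  shows "2 * (\<integral>z. ve z * (mub z * vb z + mu z * vbb z) \<partial>lborel) = (\<integral>z. mue z * (vb z)\<^sup>2 \<partial>lborel)"
proof -
  define s where "s n = inverse (real (Suc n)) *\<^sub>R e" for n
  have s: "norm (s n) \<le> norm e" for n
  proof -
    have "norm (s n) \<le> 1 * norm e"
      unfolding norm_scaleR s_def using inverse_Suc_bounds[of n] by (intro mult_right_mono) auto
    then show ?thesis by simp
  qed
  have s_lim: "(\<lambda>n. f (z + s n)) \<longlonglongrightarrow> f z" if "continuous_on UNIV f" for f :: "'b \<Rightarrow> real" and z
  proof -
    have "(\<lambda>n. z + s n) \<longlonglongrightarrow> z + 0 *\<^sub>R e"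
      unfolding s_def by (intro tendsto_intros LIMSEQ_inverse_real_of_nat)
    then show ?thesis
      using that by (auto simp: continuous_on_eq_continuous_at intro: isCont_tendsto_compose)
  qed
  have Ccb: "Cc vb" and Ccbb: "Cc vbb" and cv: "continuous_on UNIV v"
    using Cc_dir_deriv[OF v(1,2) cont(1)] Cc_dir_deriv[OF _ v(3) cont(2)] Cc_cont[OF v(1)] by auto
  obtain r where r: "\<And>z. r < norm z \<Longrightarrow> v z = 0"
    using v(1) by (auto simp: Cc_def)
  have rb: "r < norm z \<Longrightarrow> vb z = 0" for z
    by (rule dir_deriv_outside[OF v(2) r])
  define r1 where "r1 = r + norm e"
  have far: "r < norm z" "r < norm (z + s n)" if "r1 < norm z" for z n
  proof -
    have "norm z \<le> norm (z + s n) + norm (s n)"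
      using norm_triangle_ineq4[of "z + s n" "s n"] by simp
    then show "r < norm z" "r < norm (z + s n)"
      using that s[of n] norm_ge_zero[of e] unfolding r1_def by linarith+
  qed
  have near: "norm (z + s n) \<le> r1 + norm e" "norm z \<le> r1 + norm e" if "norm z \<le> r1" for z n
    using that s[of n] norm_triangle_ineq[of z "s n"] norm_ge_zero[of e] by linarith+
  obtain Be where Be: "Be \<ge> 0" "\<And>z. norm z \<le> r1 + norm e \<Longrightarrow> \<bar>ve z\<bar> \<le> Be"
    using continuous_bounded_cball[OF cont(3)] by blast
  obtain Bb where Bb: "Bb \<ge> 0" "\<And>z. norm z \<le> r1 + norm e \<Longrightarrow> \<bar>vb z\<bar> \<le> Bb"
    using continuous_bounded_cball[OF cont(1)] by blast
  obtain Bbb where Bbb: "Bbb \<ge> 0" "\<And>z. norm z \<le> r1 + norm e \<Longrightarrow> \<bar>vbb z\<bar> \<le> Bbb"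
    using continuous_bounded_cball[OF cont(2)] by blast
  obtain m where m: "m \<ge> 0" "\<And>z. norm z \<le> r1 + norm e \<Longrightarrow> \<bar>mu z\<bar> \<le> m"
    using continuous_bounded_cball[OF cont(4)] by blast
  obtain mb where mb: "mb \<ge> 0" "\<And>z. norm z \<le> r1 + norm e \<Longrightarrow> \<bar>mub z\<bar> \<le> mb"
    using continuous_bounded_cball[OF cont(5)] by blast
  obtain me where me: "me \<ge> 0" "\<And>z. norm z \<le> r1 + norm e \<Longrightarrow> \<bar>mue z\<bar> \<le> me"
    using continuous_bounded_cball[OF cont(6)] by blast
  let ?F = "\<lambda>n z. mub z * (vb (z + s n) + vb z) + mu z * (vbb (z + s n) + vbb z)"
  have L: "(\<lambda>n. \<integral>z. diff_quot e v n z * ?F n z \<partial>lborel) \<longlonglongrightarrow>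
      (\<integral>z. ve z * (mub z * (vb z + vb z) + mu z * (vbb z + vbb z)) \<partial>lborel)"
  proof (rule integral_limit[where r = r1 and C = "Be * (mb * (Bb + Bb) + m * (Bbb + Bbb))"])
    show "continuous_on UNIV (\<lambda>z. diff_quot e v n z * ?F n z)" for n
      by (intro continuous_intros continuous_diff_quot continuous_shift cont cv)
    show "(\<lambda>n. diff_quot e v n z * ?F n z) \<longlonglongrightarrow>
        ve z * (mub z * (vb z + vb z) + mu z * (vbb z + vbb z))" for z
      by (intro tendsto_intros diff_quot_tendsto v s_lim cont)
    show "diff_quot e v n z * ?F n z = 0" if "r1 < norm z" for n z
      using far[OF that] by (simp add: diff_quot_def r s_def)
    show "\<bar>diff_quot e v n z * ?F n z\<bar> \<le> Be * (mb * (Bb + Bb) + m * (Bbb + Bbb))" if "norm z \<le> r1" for n z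
      unfolding abs_mult
    proof (rule mult_mono)
      show "\<bar>diff_quot e v n z\<bar> \<le> Be"
        using v(4) that Be(2) by (rule diff_quot_bound)
      show "\<bar>?F n z\<bar> \<le> mb * (Bb + Bb) + m * (Bbb + Bbb)"
        by (rule order_trans[OF abs_triangle_ineq], unfold abs_mult,
            intro add_mono mult_mono order_trans[OF abs_triangle_ineq])
          (use near[OF that] Bb Bbb m mb in auto)
    qed (use Be in auto)
  qed
  have Rl: "(\<lambda>n. \<integral>z. diff_quot e mu n z * (vb (z + s n))\<^sup>2 \<partial>lborel) \<longlonglongrightarrow> (\<integral>z. mue z * (vb z)\<^sup>2 \<partial>lborel)"
  proof (rule integral_limit[where r = r1 and C = "me * Bb\<^sup>2"])
    show "continuous_on UNIV (\<lambda>z. diff_quot e mu n z * (vb (z + s n))\<^sup>2)" for n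
      by (intro continuous_intros continuous_diff_quot continuous_shift cont)
    show "(\<lambda>n. diff_quot e mu n z * (vb (z + s n))\<^sup>2) \<longlonglongrightarrow> mue z * (vb z)\<^sup>2" for z
      by (intro tendsto_intros diff_quot_tendsto mu s_lim cont)
    show "diff_quot e mu n z * (vb (z + s n))\<^sup>2 = 0" if "r1 < norm z" for n z
      using far[OF that] by (simp add: rb)
    show "\<bar>diff_quot e mu n z * (vb (z + s n))\<^sup>2\<bar> \<le> me * Bb\<^sup>2" if "norm z \<le> r1" for n z
      unfolding abs_mult power_abs
    proof (rule mult_mono)
      show "\<bar>diff_quot e mu n z\<bar> \<le> me"
        using mu(2) that me(2) by (rule diff_quot_bound)
      show "\<bar>vb (z + s n)\<bar>\<^sup>2 \<le> Bb\<^sup>2"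
        using Bb(2)[OF near(1)[OF that]] by (intro power_mono) auto
    qed (use me in auto)
  qed
  have "(\<integral>z. diff_quot e v n z * ?F n z \<partial>lborel) = (\<integral>z. diff_quot e mu n z * (vb (z + s n))\<^sup>2 \<partial>lborel)" for n
  proof -
    let ?g = "\<lambda>z. mu z * (vb (z + s n) + vb z)"
    have "(\<integral>z. (vb (z + s n) - vb z) * ?g z \<partial>lborel) = - (\<integral>z. (v (z + s n) - v z) * ?F n z \<partial>lborel)"
    proof (rule integral_by_parts[where e = b and g = ?g and g' = "?F n"])
      show "Cc (\<lambda>z. v (z + s n) - v z)"
        by (intro Cc_diff Cc_translate v)
      show "has_dir_deriv b (\<lambda>z. v (z + s n) - v z) (vb (z + s n) - vb z) z" for z
        by (intro dir_deriv_diff dir_deriv_shift v)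
      show "has_dir_deriv b ?g (?F n z) z" for z
        by (rule dir_deriv_eq[OF dir_deriv_mult[OF mu(1) dir_deriv_add[OF dir_deriv_shift[OF v(3)] v(3)]]]) simp
    qed (intro continuous_intros continuous_shift cont)+
    moreover have "(\<integral>z. mu (z + s n) * (vb (z + s n))\<^sup>2 - mu z * (vb z)\<^sup>2 \<partial>lborel) = 0"
    proof -
      have c: "Cc (\<lambda>z. mu z * (vb z)\<^sup>2)"
        by (intro Cc_mult_left Cc_power2 Ccb cont)
      show ?thesis
        using integral_translate[OF Cc_cont[OF c], of "s n"] c Cc_translate[OF c, of "s n"]
        by (simp add: Cc_integrable)
    qed
    moreover have "(\<integral>z. mu (z + s n) * (vb (z + s n))\<^sup>2 - mu z * (vb z)\<^sup>2 \<partial>lborel) =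
        (\<integral>z. (mu (z + s n) - mu z) * (vb (z + s n))\<^sup>2 \<partial>lborel)
        + (\<integral>z. (vb (z + s n) - vb z) * ?g z \<partial>lborel)"
    proof -
      have "Cc (\<lambda>z. (mu (z + s n) - mu z) * (vb (z + s n))\<^sup>2)" "Cc (\<lambda>z. (vb (z + s n) - vb z) * ?g z)"
        by (intro Cc_mult_left Cc_mult_right Cc_diff Cc_power2 Cc_translate Ccb cont
            continuous_intros continuous_shift)+
      then show ?thesis
        by (subst Bochner_Integration.integral_add[symmetric])
          (auto intro!: Cc_integrable Bochner_Integration.integral_cong simp: algebra_simps power2_eq_square)
    qed
    ultimately have "(\<integral>z. (v (z + s n) - v z) * ?F n z \<partial>lborel) =
        (\<integral>z. (mu (z + s n) - mu z) * (vb (z + s n))\<^sup>2 \<partial>lborel)"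
      by linarith
    then have "real (Suc n) * (\<integral>z. (v (z + s n) - v z) * ?F n z \<partial>lborel) =
        real (Suc n) * (\<integral>z. (mu (z + s n) - mu z) * (vb (z + s n))\<^sup>2 \<partial>lborel)"
      by simp
    then show ?thesis
      unfolding diff_quot_def s_def[symmetric] mult.assoc integral_mult_right_zero .
  qed
  then have "(\<integral>z. ve z * (mub z * (vb z + vb z) + mu z * (vbb z + vbb z)) \<partial>lborel) =
      (\<integral>z. mue z * (vb z)\<^sup>2 \<partial>lborel)"
    using L Rl by (auto intro: LIMSEQ_unique)
  moreover have "(\<lambda>z. ve z * (mub z * (vb z + vb z) + mu z * (vbb z + vbb z))) =
      (\<lambda>z. 2 * (ve z * (mub z * vb z + mu z * vbb z)))"
    by (simp add: fun_eq_iff algebra_simps)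
  ultimately show ?thesis
    by simp
qed

section \<open>The class \<open>C\<^sup>2\<^sup>,\<^sup>1\<close> in terms of directional derivatives\<close>

lemma square_sum3_le: "(x + y + c)\<^sup>2 \<le> 3 * (x\<^sup>2 + y\<^sup>2 + c\<^sup>2)" for x y c :: real
  using zero_le_power2[of "x - y"] zero_le_power2[of "x - c"] zero_le_power2[of "y - c"]
  by (simp add: power2_eq_square algebra_simps)

text \<open>
  The function \<open>f\<close> together with its gradient \<open>G\<close>, the pure second derivatives \<open>H b\<close> in the
  coordinate directions and the time derivative \<open>f\<^sub>t\<close>. Mixed second derivatives do not occur in the
  proof.
\<close>

definition C21 ::
  "('a::euclidean_space \<times> real) set \<Rightarrow> ('a \<times> real \<Rightarrow> real) \<Rightarrow> ('a \<times> real \<Rightarrow> 'a) \<Rightarrow>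
    ('a \<Rightarrow> 'a \<times> real \<Rightarrow> real) \<Rightarrow> ('a \<times> real \<Rightarrow> real) \<Rightarrow> bool" where
  "C21 U f G H f\<^sub>t \<longleftrightarrow>
     continuous_on U f \<and> continuous_on U G \<and> (\<forall>b\<in>Basis. continuous_on U (H b)) \<and> continuous_on U f\<^sub>t \<and>
     (\<forall>z\<in>U. has_dir_deriv (0, 1) f (f\<^sub>t z) z \<and>
        (\<forall>b\<in>Basis. has_dir_deriv (b, 0) f (G z \<bullet> b) z \<and> has_dir_deriv (b, 0) (\<lambda>z. G z \<bullet> b) (H b z) z))"

abbreviation lap :: "('a::euclidean_space \<Rightarrow> 'a \<times> real \<Rightarrow> real) \<Rightarrow> 'a \<times> real \<Rightarrow> real" where
  "lap H z \<equiv> (\<Sum>b\<in>Basis. H b z)"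

lemma C21D:
  assumes "C21 U f G H p"
  shows "continuous_on U f" "continuous_on U G" "b \<in> Basis \<Longrightarrow> continuous_on U (H b)"
    "continuous_on U p" "z \<in> U \<Longrightarrow> has_dir_deriv (0, 1) f (p z) z"
    "z \<in> U \<Longrightarrow> b \<in> Basis \<Longrightarrow> has_dir_deriv (b, 0) f (G z \<bullet> b) z"
    "z \<in> U \<Longrightarrow> b \<in> Basis \<Longrightarrow> has_dir_deriv (b, 0) (\<lambda>z. G z \<bullet> b) (H b z) z"
  using assms by (auto simp: C21_def)

lemma C21_subset: "C21 U f G H p \<Longrightarrow> V \<subseteq> U \<Longrightarrow> C21 V f G H p"
  unfolding C21_def by (meson continuous_on_subset subsetD)

lemma C21_mult:
  assumes f: "C21 U f G H p" and g: "C21 U g G' H' p'"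
  shows "C21 U (\<lambda>z. f z * g z) (\<lambda>z. f z *\<^sub>R G' z + g z *\<^sub>R G z)
    (\<lambda>b z. f z * H' b z + 2 * (G z \<bullet> b) * (G' z \<bullet> b) + g z * H b z) (\<lambda>z. f z * p' z + g z * p z)"
  unfolding C21_def
proof (intro conjI ballI)
  fix z and b :: 'a assume z: "z \<in> U" and b: "b \<in> Basis"
  note F = C21D(6,7)[OF f z b] and Gd = C21D(6,7)[OF g z b]
  show "has_dir_deriv (b, 0) (\<lambda>z. f z * g z) ((f z *\<^sub>R G' z + g z *\<^sub>R G z) \<bullet> b) z"
    by (rule dir_deriv_eq[OF dir_deriv_mult[OF F(1) Gd(1)]]) (simp add: inner_add_left)
  have "has_dir_deriv (b, 0) (\<lambda>z. f z * (G' z \<bullet> b) + g z * (G z \<bullet> b))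
      (f z * H' b z + (G z \<bullet> b) * (G' z \<bullet> b) + (g z * H b z + (G' z \<bullet> b) * (G z \<bullet> b))) z"
    by (intro dir_deriv_add dir_deriv_mult F Gd)
  then show "has_dir_deriv (b, 0) (\<lambda>z. (f z *\<^sub>R G' z + g z *\<^sub>R G z) \<bullet> b)
      (f z * H' b z + 2 * (G z \<bullet> b) * (G' z \<bullet> b) + g z * H b z) z"
    by (simp add: inner_add_left algebra_simps)
next
  fix z assume z: "z \<in> U"
  show "has_dir_deriv (0, 1) (\<lambda>z. f z * g z) (f z * p' z + g z * p z) z"
    by (rule dir_deriv_eq[OF dir_deriv_mult[OF C21D(5)[OF f z] C21D(5)[OF g z]]]) simp
qed (intro continuous_intros C21D(1-4)[OF f] C21D(1-4)[OF g]; assumption)+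

lemma C21_add:
  assumes f: "C21 U f G H p" and g: "C21 U g G' H' p'"
  shows "C21 U (\<lambda>z. f z + g z) (\<lambda>z. G z + G' z) (\<lambda>b z. H b z + H' b z) (\<lambda>z. p z + p' z)"
  unfolding C21_def
  by (intro conjI ballI continuous_intros C21D(1-4)[OF f] C21D(1-4)[OF g] dir_deriv_add,
      (assumption | rule C21D(5)[OF f] C21D(5)[OF g])+)
    (auto simp: inner_add_left intro!: dir_deriv_add C21D(6,7)[OF f] C21D(6,7)[OF g])

lemma C21_chain:
  assumes f: "C21 U f G H p"
    and F: "\<And>y. (F has_real_derivative F1 y) (at y)" "\<And>y. (F1 has_real_derivative F2 y) (at y)"
    and F2: "continuous_on UNIV F2"
  shows "C21 U (\<lambda>z. F (f z)) (\<lambda>z. F1 (f z) *\<^sub>R G z)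
    (\<lambda>b z. F1 (f z) * H b z + F2 (f z) * (G z \<bullet> b)\<^sup>2) (\<lambda>z. F1 (f z) * p z)"
  unfolding C21_def
proof (intro conjI ballI)
  have "continuous_on UNIV F" "continuous_on UNIV F1"
    using F by (auto intro!: continuous_at_imp_continuous_on DERIV_isCont)
  then have c: "continuous_on U (\<lambda>z. F (f z))" "continuous_on U (\<lambda>z. F1 (f z))" "continuous_on U (\<lambda>z. F2 (f z))"
    using F2 C21D(1)[OF f] by (auto intro: continuous_on_compose2)
  show "continuous_on U (\<lambda>z. F (f z))" "continuous_on U (\<lambda>z. F1 (f z) *\<^sub>R G z)"
    "continuous_on U (\<lambda>z. F1 (f z) * p z)"
    by (intro c continuous_intros C21D[OF f])+
  show "continuous_on U (\<lambda>z. F1 (f z) * H b z + F2 (f z) * (G z \<bullet> b)\<^sup>2)" if "b \<in> Basis" for b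
    by (intro c continuous_intros C21D[OF f] that)
next
  fix z and b :: 'a assume z: "z \<in> U" and b: "b \<in> Basis"
  note D = C21D(6,7)[OF f z b]
  show "has_dir_deriv (b, 0) (\<lambda>z. F (f z)) (F1 (f z) *\<^sub>R G z \<bullet> b) z"
    by (rule dir_deriv_eq[OF dir_deriv_chain[OF D(1) F(1)]]) simp
  have "has_dir_deriv (b, 0) (\<lambda>z. F1 (f z) * (G z \<bullet> b)) (F1 (f z) * H b z + F2 (f z) * (G z \<bullet> b) * (G z \<bullet> b)) z"
    by (intro dir_deriv_mult dir_deriv_chain[OF D(1) F(2)] D)
  then show "has_dir_deriv (b, 0) (\<lambda>z. F1 (f z) *\<^sub>R G z \<bullet> b) (F1 (f z) * H b z + F2 (f z) * (G z \<bullet> b)\<^sup>2) z"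
    by (simp add: power2_eq_square mult.assoc)
next
  fix z assume z: "z \<in> U"
  show "has_dir_deriv (0, 1) (\<lambda>z. F (f z)) (F1 (f z) * p z) z"
    by (rule dir_deriv_chain[OF C21D(5)[OF f z] F(1)])
qed

lemma C21_affine:
  assumes "C21 U f G H p"
  shows "C21 U (\<lambda>z. c * f z + d) (\<lambda>z. c *\<^sub>R G z) (\<lambda>b z. c * H b z) (\<lambda>z. c * p z)"
proof -
  have "((\<lambda>y. c * y + d) has_real_derivative c) (at y)" for y
    by (auto intro!: derivative_eq_intros)
  then show ?thesis
    using C21_chain[OF assms, of "\<lambda>y. c * y + d" "\<lambda>_. c" "\<lambda>_. 0"] by simp
qed

lemma continuous_on_time: "continuous_on UNIV a \<Longrightarrow> continuous_on U (\<lambda>z. a (snd z))"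
  by (rule continuous_on_compose2[of UNIV a]) (auto intro: continuous_intros)

lemma dir_deriv_time: "(a has_real_derivative D) (at (snd z)) \<Longrightarrow> has_dir_deriv (0, 1) (\<lambda>z. a (snd z)) D z"
  unfolding has_dir_deriv_def using DERIV_shift[of a D 0 "snd z"] by (simp add: add.commute)

lemma dir_deriv_time_space: "has_dir_deriv (b, 0) (\<lambda>z. a (snd z)) 0 z"
  unfolding has_dir_deriv_def by simp

lemma dir_deriv_space_time: "has_dir_deriv (0, s) (\<lambda>z. f (fst z)) 0 z"
  unfolding has_dir_deriv_def by simp

lemma dir_deriv_inner: "has_dir_deriv (b, 0) (\<lambda>z. fst z \<bullet> e) (b \<bullet> e) z"
  unfolding has_dir_deriv_def by (auto simp: inner_add_left intro!: derivative_eq_intros)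

lemma C21_time:
  assumes "\<And>t. (a has_real_derivative a1 t) (at t)" "continuous_on UNIV a1"
  shows "C21 U (\<lambda>z. a (snd z)) (\<lambda>z. 0) (\<lambda>b z. 0) (\<lambda>z. a1 (snd z))"
proof -
  have "continuous_on UNIV a"
    using assms by (auto intro!: continuous_at_imp_continuous_on DERIV_isCont)
  then show ?thesis
    unfolding C21_def using assms
    by (auto intro!: continuous_on_time dir_deriv_time dir_deriv_time_space dir_deriv_const)
qed

lemma C21_inner: "C21 U (\<lambda>z. fst z \<bullet> e) (\<lambda>z. e) (\<lambda>b z. 0) (\<lambda>z. 0)"
  unfolding C21_def
  by (auto intro!: continuous_intros dir_deriv_space_time dir_deriv_const dir_deriv_inner[THEN dir_deriv_eq] simp: inner_commute[of e])

lemma C21_norm2: "C21 U (\<lambda>z. (norm (fst z))\<^sup>2) (\<lambda>z. 2 *\<^sub>R fst z) (\<lambda>b z. 2) (\<lambda>z. 0)"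
  unfolding C21_def
proof (intro conjI ballI)
  fix z :: "'a \<times> real" and b :: 'a assume b: "b \<in> Basis"
  show "has_dir_deriv (b, 0) (\<lambda>z. (norm (fst z))\<^sup>2) (2 *\<^sub>R fst z \<bullet> b) z"
    unfolding has_dir_deriv_def power2_norm_eq_inner
    by (auto simp: inner_add_left inner_add_right inner_commute intro!: derivative_eq_intros)
  show "has_dir_deriv (b, 0) (\<lambda>z. 2 *\<^sub>R fst z \<bullet> b) 2 z"
    using dir_deriv_cmult[OF dir_deriv_inner[of b b z], of 2] b by simp
next
  show "has_dir_deriv (0, 1) (\<lambda>z::'a \<times> real. (norm (fst z))\<^sup>2) 0 z" for z
    by (rule dir_deriv_space_time)
qed (intro continuous_intros)+

lemma C21_cong:
  assumes "C21 U f G H p" "\<And>z. f z = f' z" "\<And>z. G z = G' z" "\<And>b z. H b z = H' b z" "\<And>z. p z = p' z"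
  shows "C21 U f' G' H' p'"
proof -
  have "f = f'" "G = G'" "H = H'" "p = p'"
    using assms(2-5) by (auto simp: fun_eq_iff)
  then show ?thesis
    using assms(1) by simp
qed

lemma C21_outside:
  assumes f: "C21 U f G H p" and "open V" "V \<subseteq> U" "\<And>z. z \<in> V \<Longrightarrow> f z = 0" "z \<in> V"
  shows "G z = 0" "b \<in> Basis \<Longrightarrow> H b z = 0" "p z = 0"
proof -
  have zero: "D = 0" if "has_dir_deriv e g D y" "\<And>z. z \<in> V \<Longrightarrow> g z = 0" "y \<in> V" for e g D y
  proof -
    have "has_dir_deriv e (\<lambda>_. 0) D y"
      by (rule dir_deriv_cong[OF that(1) assms(2) that(3)]) (rule that(2))
    then show ?thesis
      by (rule dir_deriv_unique) (rule dir_deriv_const)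
  qed
  have *: "G y = 0" if "y \<in> V" for y
  proof (rule euclidean_eqI)
    fix b :: 'a assume "b \<in> Basis"
    then have "has_dir_deriv (b, 0) f (G y \<bullet> b) y"
      using C21D(6)[OF f] subsetD[OF assms(3) that] by blast
    then have "G y \<bullet> b = 0"
      by (rule zero[OF _ assms(4) that])
    then show "G y \<bullet> b = 0 \<bullet> b"
      by simp
  qed
  show "G z = 0"
    by (rule *[OF assms(5)])
  show "H b z = 0" if "b \<in> Basis"
  proof (rule zero)
    show "has_dir_deriv (b, 0) (\<lambda>z. G z \<bullet> b) (H b z) z"
      by (rule C21D(7)[OF f subsetD[OF assms(3,5)] that])
  qed (use * assms(5) in simp_all)
  show "p z = 0"
    by (rule zero[OF C21D(5)[OF f subsetD[OF assms(3,5)]] assms(4,5)])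
qed

lemma continuous_on_zero_extension:
  fixes f :: "'a::topological_space \<Rightarrow> 'b::{topological_space, zero}"
  assumes "continuous_on U f" "open U" "closed S" "S \<subseteq> U" "\<And>z. z \<notin> S \<Longrightarrow> f z = 0"
  shows "continuous_on UNIV f"
proof -
  have "continuous_on (- S) f"
    using assms(5) by (intro continuous_on_cong[THEN iffD2, OF refl _ continuous_on_const[of _ 0]]) auto
  then have "continuous_on (U \<union> - S) f"
    using assms by (intro continuous_on_open_Un) auto
  moreover have "U \<union> - S = UNIV"
    using assms by auto
  ultimately show ?thesis
    by simp
qed

text \<open>
  Multiplication by a cutoff makes a solution on \<open>U\<close> global. Outside \<open>U\<close> the values of \<open>u\<close>
  and of its formal derivatives are arbitrary, but they are multiplied by zero.
\<close>

lemma C21_localize: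
  assumes g: "C21 UNIV g G H p" and u: "C21 U u G' H' p'"
    and S: "open U" "closed S" "S \<subseteq> U" "\<And>z. z \<notin> S \<Longrightarrow> g z = 0"
  shows "C21 UNIV (\<lambda>z. g z * u z) (\<lambda>z. g z *\<^sub>R G' z + u z *\<^sub>R G z)
    (\<lambda>b z. g z * H' b z + 2 * (G z \<bullet> b) * (G' z \<bullet> b) + u z * H b z) (\<lambda>z. g z * p' z + u z * p z)"
    (is "C21 UNIV ?f ?G ?H ?p")
proof -
  have prod: "C21 U ?f ?G ?H ?p"
    by (rule C21_mult[OF C21_subset[OF g subset_UNIV] u])
  have out: "g z = 0" "G z = 0" "b \<in> Basis \<Longrightarrow> H b z = 0" "p z = 0" if "z \<notin> S" for z b
    using C21_outside[OF g, of "- S" z] S(2,4) that by (simp_all add: open_Compl)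
  have dz: "has_dir_deriv e f 0 z" if "z \<notin> S" "\<And>y. y \<notin> S \<Longrightarrow> f y = 0" for e f and z
    by (rule dir_deriv_cong[OF dir_deriv_const[of e 0], of "- S"]) (use that S(2) in auto)
  show ?thesis
    unfolding C21_def
  proof (intro conjI ballI)
    show "continuous_on UNIV ?f"
      by (rule continuous_on_zero_extension[OF C21D(1)[OF prod] S(1-3)]) (simp add: out)
    show "continuous_on UNIV ?G"
      by (rule continuous_on_zero_extension[OF C21D(2)[OF prod] S(1-3)]) (simp add: out)
    show "continuous_on UNIV ?p"
      by (rule continuous_on_zero_extension[OF C21D(4)[OF prod] S(1-3)]) (simp add: out)
    show "continuous_on UNIV (?H b)" if "b \<in> Basis" for b
      by (rule continuous_on_zero_extension[OF C21D(3)[OF prod that] S(1-3)]) (simp add: out that)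
  next
    fix z
    show "has_dir_deriv (0, 1) ?f (?p z) z"
    proof (cases "z \<in> U")
      case False
      then have "z \<notin> S" using S by auto
      then show ?thesis using dz[of z ?f "(0, 1)"] by (simp add: out)
    qed (rule C21D(5)[OF prod])
  next
    fix z and b :: 'a assume b: "b \<in> Basis"
    show "has_dir_deriv (b, 0) ?f (?G z \<bullet> b) z"
    proof (cases "z \<in> U")
      case False
      then have "z \<notin> S" using S by auto
      then show ?thesis using dz[of z ?f "(b, 0)"] by (simp add: out)
    qed (rule C21D(6)[OF prod _ b])
    show "has_dir_deriv (b, 0) (\<lambda>z. ?G z \<bullet> b) (?H b z) z"
    proof (cases "z \<in> U")
      case False
      then have "z \<notin> S" using S by auto
      then show ?thesis using dz[of z "\<lambda>z. ?G z \<bullet> b" "(b, 0)"] b by (simp add: out)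
    qed (rule C21D(7)[OF prod _ b])
  qed
qed

section \<open>Integrands with vanishing integral\<close>

text \<open>
  Integrations by parts are recorded as functions of integral zero. These form a vector
  space, so that an integral identity that combines several of them reduces to a pointwise identity.
\<close>

definition zero_mean :: "('b::euclidean_space \<Rightarrow> real) \<Rightarrow> bool" where
  "zero_mean f \<longleftrightarrow> Cc f \<and> (\<integral>z. f z \<partial>lborel) = 0"

lemma zero_mean_add: "zero_mean f \<Longrightarrow> zero_mean g \<Longrightarrow> zero_mean (\<lambda>z. f z + g z)"
  unfolding zero_mean_def by (auto simp: Cc_add Cc_integrable)

lemma zero_mean_cmult: "zero_mean f \<Longrightarrow> zero_mean (\<lambda>z. c * f z)"
  unfolding zero_mean_def by (auto simp: Cc_cmult)

lemma zero_mean_zero: "zero_mean (\<lambda>z. 0)"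
  unfolding zero_mean_def by (auto simp: Cc_zero)

lemma zero_mean_sum: "(\<And>i. i \<in> I \<Longrightarrow> zero_mean (f i)) \<Longrightarrow> zero_mean (\<lambda>z. \<Sum>i\<in>I. f i z)"
  by (induction I rule: infinite_finite_induct) (auto intro: zero_mean_add zero_mean_zero)

lemma zero_mean_dir_deriv:
  assumes "Cc f" "\<And>z. has_dir_deriv e f (f' z) z" "continuous_on UNIV f'"
  shows "zero_mean f'"
  unfolding zero_mean_def using integral_dir_deriv_zero[OF assms] Cc_dir_deriv[OF assms] by blast

lemma norm2_Basis: "(norm (x::'a::euclidean_space))\<^sup>2 = (\<Sum>b\<in>Basis. (x \<bullet> b)\<^sup>2)"
  unfolding power2_norm_eq_inner euclidean_inner[of x x] by (simp add: power2_eq_square)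

lemma C21_Cc:
  assumes v: "C21 UNIV v G H p" and "Cc v"
  shows "b \<in> Basis \<Longrightarrow> Cc (\<lambda>z. G z \<bullet> b)" "b \<in> Basis \<Longrightarrow> Cc (H b)" "Cc p"
    "Cc (\<lambda>z. \<Sum>b\<in>Basis. H b z)" "Cc (\<lambda>z. (norm (G z))\<^sup>2)"
proof -
  show *: "Cc (\<lambda>z. G z \<bullet> b)" if "b \<in> Basis" for b
    by (rule Cc_dir_deriv[OF assms(2), of "(b, 0)"])
      (auto intro!: C21D(6)[OF v] that continuous_intros C21D(2)[OF v])
  show **: "Cc (H b)" if "b \<in> Basis" for b
    by (rule Cc_dir_deriv[OF *[OF that], of "(b, 0)"]) (auto intro!: C21D(7)[OF v] that C21D(3)[OF v])
  show "Cc p"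
    by (rule Cc_dir_deriv[OF assms(2), of "(0, 1)"]) (auto intro!: C21D(5)[OF v] C21D(4)[OF v])
  show "Cc (\<lambda>z. \<Sum>b\<in>Basis. H b z)"
    by (intro Cc_sum **)
  show "Cc (\<lambda>z. (norm (G z))\<^sup>2)"
    unfolding norm2_Basis by (intro Cc_sum Cc_power2 *)
qed

lemma zero_mean_laplacian:
  assumes v: "C21 UNIV v G H p" and "Cc v" and Y: "continuous_on UNIV Y"
  shows "zero_mean (\<lambda>z. Y (snd z) * v z * (lap H z) + Y (snd z) * (norm (G z))\<^sup>2)"
proof -
  have "zero_mean (\<lambda>z. (Y (snd z) * v z) * H b z + (Y (snd z) * (G z \<bullet> b)) * (G z \<bullet> b))" if b: "b \<in> Basis" for b
  proof (rule zero_mean_dir_deriv)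
    show "Cc (\<lambda>z. (Y (snd z) * v z) * (G z \<bullet> b))"
      using C21_Cc(1)[OF assms(1,2) b]
      by (intro Cc_mult_left continuous_intros continuous_on_time Y C21D[OF v])
    show "has_dir_deriv (b, 0) (\<lambda>z. (Y (snd z) * v z) * (G z \<bullet> b))
        ((Y (snd z) * v z) * H b z + (Y (snd z) * (G z \<bullet> b)) * (G z \<bullet> b)) z" for z
      by (rule dir_deriv_eq[OF dir_deriv_mult[OF dir_deriv_mult[OF dir_deriv_time_space C21D(6)[OF v]] C21D(7)[OF v]]])
        (use b in auto)
    show "continuous_on UNIV (\<lambda>z. (Y (snd z) * v z) * H b z + (Y (snd z) * (G z \<bullet> b)) * (G z \<bullet> b))"
      by (intro continuous_intros continuous_on_time Y C21D[OF v] b)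
  qed
  then have "zero_mean (\<lambda>z. \<Sum>b\<in>Basis. (Y (snd z) * v z) * H b z + (Y (snd z) * (G z \<bullet> b)) * (G z \<bullet> b))"
    by (rule zero_mean_sum)
  then show ?thesis
    unfolding norm2_Basis unfolding power2_eq_square by (simp add: sum.distrib sum_distrib_left mult.assoc)
qed

lemma zero_mean_time_laplacian:
  assumes v: "C21 UNIV v G H p" and "Cc v"
  shows "zero_mean (\<lambda>z. p z * (lap H z))"
proof -
  have "zero_mean (\<lambda>z. p z * H b z)" if b: "b \<in> Basis" for b
  proof -
    have "2 * (\<integral>z. p z * (0 * (G z \<bullet> b) + 1 * H b z) \<partial>lborel) = (\<integral>z. 0 * (G z \<bullet> b)\<^sup>2 \<partial>lborel)"
      by (rule integral_second_derivative_times_derivative[OF assms(2),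
            where b = "(b, 0)" and e = "(0, 1)" and mu = "\<lambda>_. 1"])
        (auto intro!: C21D[OF v] b dir_deriv_const continuous_intros)
    moreover have "Cc (\<lambda>z. p z * H b z)"
      using C21_Cc(2)[OF assms b] by (intro Cc_mult_left C21D(4)[OF v])
    ultimately show ?thesis
      by (simp add: zero_mean_def)
  qed
  then show ?thesis
    unfolding sum_distrib_left by (rule zero_mean_sum)
qed

text \<open>
  Rellich's identity for a vector field \<open>W\<close> with Jacobian \<open>2\<kappa> I\<close>. It is the sum over all pairs of
  coordinate directions of \<open>integral_second_derivative_times_derivative\<close> with a component of \<open>W\<close> as
  the factor \<open>mu\<close>.
\<close>

lemma zero_mean_drift_laplacian:
  fixes v :: "'a::euclidean_space \<times> real \<Rightarrow> real" and \<kappa> a :: "real \<Rightarrow> real" and e :: 'a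
  assumes v: "C21 UNIV v G H p" and "Cc v" and c: "continuous_on UNIV \<kappa>" "continuous_on UNIV a"
  defines "W \<equiv> \<lambda>z::'a \<times> real. (2 * \<kappa> (snd z)) *\<^sub>R fst z + a (snd z) *\<^sub>R e"
  shows "zero_mean (\<lambda>z. (W z \<bullet> G z) * (lap H z) - (real DIM('a) - 2) * (\<kappa> (snd z) * (norm (G z))\<^sup>2))"
proof -
  have cW: "continuous_on UNIV W"
    unfolding W_def by (intro continuous_intros continuous_on_time c)
  have "zero_mean (\<lambda>z. 2 * ((G z \<bullet> c) * ((2 * \<kappa> (snd z) * (b \<bullet> c)) * (G z \<bullet> b) + (W z \<bullet> c) * H b z))
      + (-1) * ((2 * \<kappa> (snd z)) * (G z \<bullet> b)\<^sup>2))" if b: "b \<in> Basis" and c': "c \<in> Basis" for b c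
  proof -
    let ?f = "\<lambda>z. (G z \<bullet> c) * ((2 * \<kappa> (snd z) * (b \<bullet> c)) * (G z \<bullet> b) + (W z \<bullet> c) * H b z)"
    let ?g = "\<lambda>z. (2 * \<kappa> (snd z)) * (G z \<bullet> b)\<^sup>2"
    have "2 * (\<integral>z. ?f z \<partial>lborel) = (\<integral>z. ?g z \<partial>lborel)"
    proof (rule integral_second_derivative_times_derivative[OF assms(2), where b = "(b, 0)" and e = "(c, 0)"])
      show "has_dir_deriv (b, 0) (\<lambda>z. W z \<bullet> c) (2 * \<kappa> (snd z) * (b \<bullet> c)) z"
        "has_dir_deriv (c, 0) (\<lambda>z. W z \<bullet> c) (2 * \<kappa> (snd z)) z" for z
        unfolding W_def has_dir_deriv_def using c'
        by (auto simp: inner_add_left intro!: derivative_eq_intros)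
    qed (auto intro!: C21D[OF v] b c' cW continuous_intros continuous_on_time c)
    moreover have "Cc ?f"
      by (intro Cc_mult_right[OF C21_Cc(1)[OF assms(1,2) c']] continuous_intros continuous_on_time
          c cW C21D[OF v] b)
    moreover have "Cc ?g"
      by (intro Cc_mult_left[OF Cc_power2] C21_Cc(1)[OF assms(1,2) b] continuous_intros continuous_on_time c)
    ultimately show ?thesis
      unfolding zero_mean_def by (simp add: Cc_add Cc_cmult Cc_minus Cc_diff Cc_integrable)
  qed
  then have "zero_mean (\<lambda>z. \<Sum>b\<in>Basis. \<Sum>c\<in>Basis.
      2 * ((G z \<bullet> c) * ((2 * \<kappa> (snd z) * (b \<bullet> c)) * (G z \<bullet> b) + (W z \<bullet> c) * H b z))
      + (-1) * ((2 * \<kappa> (snd z)) * (G z \<bullet> b)\<^sup>2))"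
    by (intro zero_mean_sum)
  then have "zero_mean (\<lambda>z. (1/2) * (\<Sum>b\<in>Basis. \<Sum>c\<in>Basis.
      2 * ((G z \<bullet> c) * ((2 * \<kappa> (snd z) * (b \<bullet> c)) * (G z \<bullet> b) + (W z \<bullet> c) * H b z))
      + (-1) * ((2 * \<kappa> (snd z)) * (G z \<bullet> b)\<^sup>2)))"
    by (rule zero_mean_cmult)
  moreover have "(1/2) * (\<Sum>b\<in>Basis. \<Sum>c\<in>Basis.
      2 * ((G z \<bullet> c) * ((2 * \<kappa> (snd z) * (b \<bullet> c)) * (G z \<bullet> b) + (W z \<bullet> c) * H b z))
      + (-1) * ((2 * \<kappa> (snd z)) * (G z \<bullet> b)\<^sup>2)) =
      (W z \<bullet> G z) * (lap H z) - (real DIM('a) - 2) * (\<kappa> (snd z) * (norm (G z))\<^sup>2)" for z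
  proof -
    have inner: "(\<Sum>c\<in>Basis.
        2 * ((G z \<bullet> c) * ((2 * \<kappa> (snd z) * (b \<bullet> c)) * (G z \<bullet> b) + (W z \<bullet> c) * H b z))
        + (-1) * ((2 * \<kappa> (snd z)) * (G z \<bullet> b)\<^sup>2)) =
        4 * \<kappa> (snd z) * (G z \<bullet> b)\<^sup>2 + 2 * (W z \<bullet> G z) * H b z
        - real DIM('a) * (2 * \<kappa> (snd z) * (G z \<bullet> b)\<^sup>2)" if b: "b \<in> Basis" for b
    proof -
      have 1: "(\<Sum>c\<in>Basis. (G z \<bullet> c) * (b \<bullet> c)) = G z \<bullet> b"
        by (rule euclidean_inner[symmetric])
      have 2: "(\<Sum>c\<in>Basis. (G z \<bullet> c) * (W z \<bullet> c)) = W z \<bullet> G z"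
        by (subst euclidean_inner) (simp add: mult.commute)
      have "(\<Sum>c\<in>Basis.
        2 * ((G z \<bullet> c) * ((2 * \<kappa> (snd z) * (b \<bullet> c)) * (G z \<bullet> b) + (W z \<bullet> c) * H b z))
        + (-1) * ((2 * \<kappa> (snd z)) * (G z \<bullet> b)\<^sup>2)) =
        (4 * \<kappa> (snd z) * (G z \<bullet> b)) * (\<Sum>c\<in>Basis. (G z \<bullet> c) * (b \<bullet> c))
        + (2 * H b z) * (\<Sum>c\<in>Basis. (G z \<bullet> c) * (W z \<bullet> c))
        - (\<Sum>c\<in>(Basis::'a set). 2 * \<kappa> (snd z) * (G z \<bullet> b)\<^sup>2)"
        unfolding sum_distrib_left sum.distrib[symmetric] sum_subtractf[symmetric]
        by (intro sum.cong) (auto simp: algebra_simps)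
      then show ?thesis
        unfolding 1 2 by (simp add: power2_eq_square)
    qed
    have "(1/2) * (\<Sum>b\<in>Basis. 4 * \<kappa> (snd z) * (G z \<bullet> b)\<^sup>2 + 2 * (W z \<bullet> G z) * H b z
        - real DIM('a) * (2 * \<kappa> (snd z) * (G z \<bullet> b)\<^sup>2)) =
      (W z \<bullet> G z) * (lap H z) - (real DIM('a) - 2) * (\<kappa> (snd z) * (norm (G z))\<^sup>2)"
      unfolding norm2_Basis sum_distrib_left sum_subtractf[symmetric]
      by (intro sum.cong) (auto simp: algebra_simps)
    then show ?thesis
      using inner by simp
  qed
  ultimately show ?thesis
    by (simp only:)
qed

section \<open>A Carleman inequality for quadratic weights\<close>

text \<open>
  In the notation of the introduction, \<open>W = \<nabla>\<phi>\<close>, \<open>X = |\<nabla>\<phi>|\<^sup>2 - \<phi>\<^sub>t\<close>, and \<open>Xt\<close>, \<open>XG\<close> are the time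
  derivative and the gradient of \<open>X\<close>. The function \<open>Q = 2 \<nabla>X \<bullet> \<nabla>\<phi> - X\<^sub>t - l X\<close> is the
  coefficient of \<open>v\<^sup>2\<close> that the commutator of \<open>S\<close> and \<open>A\<close> and the factor \<open>exp(l t / 2)\<close> produce.
\<close>

locale quadratic_weight =
  fixes k0 k1 l b0 :: real and e :: "'a::euclidean_space" and a a1 a2 :: "real \<Rightarrow> real"
  assumes a1: "\<And>t. (a has_real_derivative a1 t) (at t)"
    and a2: "\<And>t. (a1 has_real_derivative a2 t) (at t)"
    and cont_a2: "continuous_on UNIV a2"
begin

definition \<kappa> :: "real \<Rightarrow> real" where
  "\<kappa> t = k0 + k1 * t"

definition W :: "'a \<times> real \<Rightarrow> 'a" where
  "W z = (2 * \<kappa> (snd z)) *\<^sub>R fst z + a (snd z) *\<^sub>R e"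

definition X :: "'a \<times> real \<Rightarrow> real" where
  "X z = (norm (W z))\<^sup>2 - k1 * (norm (fst z))\<^sup>2 - a1 (snd z) * (fst z \<bullet> e - b0)"

definition Xt :: "'a \<times> real \<Rightarrow> real" where
  "Xt z = 2 * (W z \<bullet> ((2 * k1) *\<^sub>R fst z + a1 (snd z) *\<^sub>R e)) - a2 (snd z) * (fst z \<bullet> e - b0)"

definition XG :: "'a \<times> real \<Rightarrow> 'a" where
  "XG z = (4 * \<kappa> (snd z)) *\<^sub>R W z - (2 * k1) *\<^sub>R fst z - a1 (snd z) *\<^sub>R e"

definition Q :: "'a \<times> real \<Rightarrow> real" where
  "Q z = 2 * (XG z \<bullet> W z) - Xt z - l * X z"

definition weight :: "'a \<times> real \<Rightarrow> real" where
  "weight z = exp (\<kappa> (snd z) * (norm (fst z))\<^sup>2 + a (snd z) * (fst z \<bullet> e - b0) + l / 2 * snd z)"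

lemma cont_a: "continuous_on UNIV a" "continuous_on UNIV a1" "continuous_on UNIV \<kappa>"
proof -
  show "continuous_on UNIV a" "continuous_on UNIV a1"
    using a1 a2 by (auto intro!: continuous_at_imp_continuous_on DERIV_isCont)
  show "continuous_on UNIV \<kappa>"
    unfolding \<kappa>_def by (intro continuous_intros)
qed

lemma cont_W: "continuous_on U W"
  unfolding W_def by (intro continuous_intros continuous_on_time cont_a)

lemma cont_X: "continuous_on U X" "continuous_on U Xt" "continuous_on U XG" "continuous_on U Q"
  unfolding X_def Xt_def XG_def Q_def
  by (intro continuous_intros continuous_on_time cont_a cont_W cont_a2)+

lemma dir_deriv_W: "has_dir_deriv (b, 0) (\<lambda>z. W z \<bullet> c) (2 * \<kappa> (snd z) * (b \<bullet> c)) z"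
  unfolding W_def has_dir_deriv_def by (auto simp: inner_add_left intro!: derivative_eq_intros)

lemma dir_deriv_X_space: "has_dir_deriv (b, 0) X (XG z \<bullet> b) z"
proof -
  define c where "c = (2 * \<kappa> (snd z))\<^sup>2 * (b \<bullet> b) - k1 * (b \<bullet> b)"
  have "X (z + h *\<^sub>R (b, 0)) = X z + h * (XG z \<bullet> b) + h\<^sup>2 * c" for h
  proof -
    have "W (z + h *\<^sub>R (b, 0)) = W z + (h * (2 * \<kappa> (snd z))) *\<^sub>R b"
      unfolding W_def by (simp add: algebra_simps)
    then show ?thesis
      unfolding X_def XG_def power2_norm_eq_inner c_def
      by (simp add: inner_add_left inner_add_right inner_diff_left inner_commute[of b "W z"] inner_commute[of b "fst z"]
          inner_commute[of b e])
        (simp add: algebra_simps power2_eq_square)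
  qed
  then show ?thesis
    unfolding has_dir_deriv_def by (auto intro!: derivative_eq_intros)
qed

lemma dir_deriv_X_time: "has_dir_deriv (0, 1) X (Xt z) z"
proof -
  define x2 xe e2 t where "x2 = fst z \<bullet> fst z" "xe = fst z \<bullet> e" "e2 = e \<bullet> e" "t = snd z"
  have a: "((\<lambda>h. a (t + h)) has_real_derivative a1 t) (at 0)"
    "((\<lambda>h. a1 (t + h)) has_real_derivative a2 t) (at 0)"
    using DERIV_shift[of a _ 0 t] DERIV_shift[of a1 _ 0 t] a1 a2 by (auto simp: add.commute)
  have "X (z + h *\<^sub>R (0, 1)) = 4 * (\<kappa> t + h * k1)\<^sup>2 * x2 + 4 * (\<kappa> t + h * k1) * a (t + h) * xe
      + (a (t + h))\<^sup>2 * e2 - k1 * x2 - a1 (t + h) * (xe - b0)" for h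
    unfolding X_def W_def power2_norm_eq_inner x2_xe_e2_t_def \<kappa>_def
    by (simp add: inner_add_left inner_add_right inner_commute[of e "fst z"])
      (simp add: algebra_simps power2_eq_square)
  moreover have "((\<lambda>h. 4 * (\<kappa> t + h * k1)\<^sup>2 * x2 + 4 * (\<kappa> t + h * k1) * a (t + h) * xe
      + (a (t + h))\<^sup>2 * e2 - k1 * x2 - a1 (t + h) * (xe - b0)) has_real_derivative
      8 * \<kappa> t * k1 * x2 + (4 * k1 * a t + 4 * \<kappa> t * a1 t) * xe + 2 * a t * a1 t * e2
      - a2 t * (xe - b0)) (at 0)"
    by (rule derivative_eq_intros a refl)+ (simp add: algebra_simps)
  moreover have "8 * \<kappa> t * k1 * x2 + (4 * k1 * a t + 4 * \<kappa> t * a1 t) * xe + 2 * a t * a1 t * e2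
      - a2 t * (xe - b0) = Xt z"
    unfolding Xt_def W_def x2_xe_e2_t_def
    by (simp add: inner_add_left inner_add_right inner_commute[of e "fst z"])
      (simp add: algebra_simps)
  ultimately show ?thesis
    unfolding has_dir_deriv_def by simp
qed

lemma zero_mean_multiplier_time:
  assumes v: "C21 UNIV v G H p" and "Cc v"
  shows "zero_mean (\<lambda>z. 2 * X z * v z * p z + Xt z * (v z)\<^sup>2)"
proof (rule zero_mean_dir_deriv)
  show "Cc (\<lambda>z. X z * (v z)\<^sup>2)"
    by (intro Cc_mult_left Cc_power2 assms(2) cont_X)
  show "has_dir_deriv (0, 1) (\<lambda>z. X z * (v z)\<^sup>2) (2 * X z * v z * p z + Xt z * (v z)\<^sup>2) z" for z
    unfolding power2_eq_square
    by (rule dir_deriv_eq[OF dir_deriv_mult[OF dir_deriv_X_time dir_deriv_mult[OF C21D(5)[OF v] C21D(5)[OF v]]]])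
      (auto simp: algebra_simps)
qed (intro continuous_intros cont_X C21D[OF v])+

lemma zero_mean_multiplier_drift:
  assumes v: "C21 UNIV v G H p" and "Cc v"
  shows "zero_mean (\<lambda>z. 2 * X z * v z * (W z \<bullet> G z)
    + (XG z \<bullet> W z + 2 * real DIM('a) * \<kappa> (snd z) * X z) * (v z)\<^sup>2)"
proof -
  have "zero_mean (\<lambda>z. X z * (W z \<bullet> b) * (2 * v z * (G z \<bullet> b))
      + (X z * (2 * \<kappa> (snd z)) + (XG z \<bullet> b) * (W z \<bullet> b)) * (v z)\<^sup>2)" if b: "b \<in> Basis" for b
  proof (rule zero_mean_dir_deriv)
    show "Cc (\<lambda>z. (X z * (W z \<bullet> b)) * (v z)\<^sup>2)"
      by (intro Cc_mult_left Cc_power2 assms(2) cont_X cont_W continuous_intros)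
    show "has_dir_deriv (b, 0) (\<lambda>z. (X z * (W z \<bullet> b)) * (v z)\<^sup>2)
       (X z * (W z \<bullet> b) * (2 * v z * (G z \<bullet> b))
        + (X z * (2 * \<kappa> (snd z)) + (XG z \<bullet> b) * (W z \<bullet> b)) * (v z)\<^sup>2) z" for z
      unfolding power2_eq_square
      by (rule dir_deriv_eq[OF dir_deriv_mult[OF dir_deriv_mult[OF dir_deriv_X_space dir_deriv_W]
              dir_deriv_mult[OF C21D(6)[OF v] C21D(6)[OF v]]]])
        (use b in \<open>auto simp: algebra_simps\<close>)
  qed (intro continuous_intros cont_X cont_W C21D[OF v] continuous_on_time cont_a)+
  then have "zero_mean (\<lambda>z. \<Sum>b\<in>Basis. X z * (W z \<bullet> b) * (2 * v z * (G z \<bullet> b))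
      + (X z * (2 * \<kappa> (snd z)) + (XG z \<bullet> b) * (W z \<bullet> b)) * (v z)\<^sup>2)"
    by (rule zero_mean_sum)
  moreover have "(\<Sum>b\<in>Basis. X z * (W z \<bullet> b) * (2 * v z * (G z \<bullet> b))
      + (X z * (2 * \<kappa> (snd z)) + (XG z \<bullet> b) * (W z \<bullet> b)) * (v z)\<^sup>2) =
    2 * X z * v z * (W z \<bullet> G z) + (XG z \<bullet> W z + 2 * real DIM('a) * \<kappa> (snd z) * X z) * (v z)\<^sup>2" for z
  proof -
    have "(\<Sum>b\<in>Basis. X z * (W z \<bullet> b) * (2 * v z * (G z \<bullet> b))
      + (X z * (2 * \<kappa> (snd z)) + (XG z \<bullet> b) * (W z \<bullet> b)) * (v z)\<^sup>2) =
      2 * X z * v z * (\<Sum>b\<in>Basis. (W z \<bullet> b) * (G z \<bullet> b))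
      + (\<Sum>b\<in>(Basis::'a set). X z * (2 * \<kappa> (snd z)) * (v z)\<^sup>2)
      + (v z)\<^sup>2 * (\<Sum>b\<in>Basis. (XG z \<bullet> b) * (W z \<bullet> b))"
      unfolding sum_distrib_left sum.distrib[symmetric]
      by (intro sum.cong) (auto simp: algebra_simps)
    then show ?thesis
      unfolding euclidean_inner[symmetric] by (simp add: algebra_simps)
  qed
  ultimately show ?thesis
    by (simp only:)
qed

text \<open>
  The Carleman inequality for the conjugated operator. The product \<open>2 (S v) (A v - l v / 2)\<close> differs
  from the quadratic form on the left by the integrand \<open>D\<close>, a combination of
  integrands with vanishing integral.
\<close>

lemma carleman_conjugated:
  assumes v: "C21 UNIV v G H p" and "Cc v"
  shows "(\<integral>z. (8 * \<kappa> (snd z) + l) * (norm (G z))\<^sup>2 + Q z * (v z)\<^sup>2 \<partial>lborel)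
    \<le> (\<integral>z. (p z + lap H z - 2 * (W z \<bullet> G z)
        + (X z - 2 * real DIM('a) * \<kappa> (snd z) - l / 2) * v z)\<^sup>2 \<partial>lborel)"
proof -
  define n where "n = real DIM('a)"
  define L where "L z = (lap H z)" for z
  define Y where "Y t = 2 * n * \<kappa> t + l / 2" for t
  define D where "D z = 2 * (p z * L z) + ((-4) * ((W z \<bullet> G z) * L z - (n - 2) * (\<kappa> (snd z) * (norm (G z))\<^sup>2))
      + ((-2) * (Y (snd z) * v z * L z + Y (snd z) * (norm (G z))\<^sup>2)
      + ((2 * X z * v z * p z + Xt z * (v z)\<^sup>2)
      + (-2) * (2 * X z * v z * (W z \<bullet> G z) + (XG z \<bullet> W z + 2 * n * \<kappa> (snd z) * X z) * (v z)\<^sup>2))))" for z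
  have cY: "continuous_on UNIV Y"
    unfolding Y_def by (intro continuous_intros cont_a)
  have N: "zero_mean (\<lambda>z. p z * L z)"
      "zero_mean (\<lambda>z. (W z \<bullet> G z) * L z - (n - 2) * (\<kappa> (snd z) * (norm (G z))\<^sup>2))"
      "zero_mean (\<lambda>z. Y (snd z) * v z * L z + Y (snd z) * (norm (G z))\<^sup>2)"
      "zero_mean (\<lambda>z. 2 * X z * v z * (W z \<bullet> G z) + (XG z \<bullet> W z + 2 * n * \<kappa> (snd z) * X z) * (v z)\<^sup>2)"
    unfolding L_def n_def
    using zero_mean_time_laplacian[OF assms] zero_mean_drift_laplacian[OF assms cont_a(3) cont_a(1), of e]
      zero_mean_laplacian[OF assms cY] zero_mean_multiplier_drift[OF assms]
    by (simp_all only: W_def)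
  have "zero_mean D"
    unfolding D_def
    by (rule zero_mean_add[OF zero_mean_cmult[OF N(1)] zero_mean_add[OF zero_mean_cmult[OF N(2)] zero_mean_add[OF zero_mean_cmult[OF N(3)]
          zero_mean_add[OF zero_mean_multiplier_time[OF assms] zero_mean_cmult[OF N(4)]]]]])
  define A where "A z = (8 * \<kappa> (snd z) + l) * (norm (G z))\<^sup>2 + Q z * (v z)\<^sup>2" for z
  define B where "B z = (p z + L z - 2 * (W z \<bullet> G z) + (X z - 2 * n * \<kappa> (snd z) - l / 2) * v z)\<^sup>2" for z
  have "Cc A"
    unfolding A_def
    by (rule Cc_add[OF Cc_mult_left[OF C21_Cc(5)[OF assms]] Cc_mult_left[OF Cc_power2[OF assms(2)]]])
      (intro continuous_intros continuous_on_time cont_a cont_X)+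
  have CWG: "Cc (\<lambda>z. W z \<bullet> G z)"
    unfolding euclidean_inner[of "W z" "G z" for z]
    by (intro Cc_sum Cc_mult_left[OF C21_Cc(1)[OF assms]]) (auto intro!: continuous_intros cont_W)
  have "Cc B"
    unfolding B_def L_def
    by (rule Cc_power2[OF Cc_add[OF Cc_diff[OF Cc_add[OF C21_Cc(3,4)[OF assms]] Cc_cmult[OF CWG]]
          Cc_mult_left[OF assms(2)]]])
      (intro continuous_intros continuous_on_time cont_a cont_X)
  have "A z + D z \<le> B z" for z
  proof -
    \<comment> \<open>\<open>L z + X z * v z\<close> is \<open>S v\<close>, the other factor is \<open>A v - l v / 2\<close>, and \<open>Y = \<Delta>\<phi> + l / 2\<close>.\<close>
    have "A z + D z = 2 * (L z + X z * v z) * (p z - 2 * (W z \<bullet> G z) - Y (snd z) * v z)"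
      unfolding A_def D_def Q_def Y_def by (simp add: algebra_simps power2_eq_square)
    also have "\<dots> \<le> (L z + X z * v z)\<^sup>2 + (p z - 2 * (W z \<bullet> G z) - Y (snd z) * v z)\<^sup>2
        + 2 * (L z + X z * v z) * (p z - 2 * (W z \<bullet> G z) - Y (snd z) * v z)"
      using zero_le_power2[of "L z + X z * v z"] zero_le_power2[of "p z - 2 * (W z \<bullet> G z) - Y (snd z) * v z"]
      by linarith
    also have "\<dots> = ((L z + X z * v z) + (p z - 2 * (W z \<bullet> G z) - Y (snd z) * v z))\<^sup>2"
      by (rule power2_sum[symmetric])
    also have "\<dots> = B z"
      unfolding B_def Y_def by (rule arg_cong[where f = "\<lambda>x. x\<^sup>2"]) (simp add: algebra_simps)
    finally show ?thesis .
  qed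
  then have "(\<integral>z. A z + D z \<partial>lborel) \<le> (\<integral>z. B z \<partial>lborel)"
    using \<open>zero_mean D\<close> \<open>Cc A\<close> \<open>Cc B\<close> by (intro integral_mono Cc_integrable Cc_add) (auto simp: zero_mean_def)
  moreover have "(\<integral>z. A z + D z \<partial>lborel) = (\<integral>z. A z \<partial>lborel)"
    using \<open>zero_mean D\<close> \<open>Cc A\<close> by (simp add: zero_mean_def Cc_integrable)
  ultimately show ?thesis
    unfolding A_def B_def L_def n_def by simp
qed

end

context quadratic_weight
begin

lemma C21_weight:
  "C21 UNIV weight (\<lambda>z. weight z *\<^sub>R W z) (\<lambda>b z. weight z * (2 * \<kappa> (snd z)) + weight z * (W z \<bullet> b)\<^sup>2)
    (\<lambda>z. weight z * (k1 * (norm (fst z))\<^sup>2 + a1 (snd z) * (fst z \<bullet> e - b0) + l / 2))"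
proof -
  have k: "(\<kappa> has_real_derivative k1) (at t)" for t
    unfolding \<kappa>_def by (auto intro!: derivative_eq_intros)
  have s: "((\<lambda>t. l / 2 * t) has_real_derivative l / 2) (at t)" for t
    by (auto intro!: derivative_eq_intros)
  have x: "C21 UNIV (\<lambda>z::'a \<times> real. fst z \<bullet> e - b0) (\<lambda>z. e) (\<lambda>b z. 0) (\<lambda>z. 0)"
    using C21_affine[OF C21_inner, of UNIV 1 e "- b0"] by simp
  have "C21 UNIV (\<lambda>z. \<kappa> (snd z) * (norm (fst z))\<^sup>2 + a (snd z) * (fst z \<bullet> e - b0) + l / 2 * snd z) W
      (\<lambda>b z. 2 * \<kappa> (snd z)) (\<lambda>z. k1 * (norm (fst z))\<^sup>2 + a1 (snd z) * (fst z \<bullet> e - b0) + l / 2)"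
    by (rule C21_cong[OF C21_add[OF C21_add[OF C21_mult[OF C21_time[OF k] C21_norm2]
            C21_mult[OF C21_time[OF a1 cont_a(2)] x]] C21_time[OF s]]])
      (simp_all add: W_def)
  from C21_chain[OF this DERIV_exp DERIV_exp continuous_on_exp[OF continuous_on_id]]
  show ?thesis
    by (rule C21_cong) (simp_all add: weight_def)
qed

lemma carleman_weighted:
  assumes w: "C21 UNIV w G H p" and "Cc w"
  shows "(\<integral>z. (weight z)\<^sup>2 * ((8 * \<kappa> (snd z) + l) * (norm (G z + w z *\<^sub>R W z))\<^sup>2 + Q z * (w z)\<^sup>2) \<partial>lborel)
    \<le> (\<integral>z. (weight z)\<^sup>2 * (p z + lap H z)\<^sup>2 \<partial>lborel)"
proof -
  define n where "n = real DIM('a)"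
  let ?G = "\<lambda>z. weight z *\<^sub>R G z + w z *\<^sub>R (weight z *\<^sub>R W z)"
  let ?H = "\<lambda>b z. weight z * H b z + 2 * (weight z *\<^sub>R W z \<bullet> b) * (G z \<bullet> b)
      + w z * (weight z * (2 * \<kappa> (snd z)) + weight z * (W z \<bullet> b)\<^sup>2)"
  let ?p = "\<lambda>z. weight z * p z + w z * (weight z * (k1 * (norm (fst z))\<^sup>2 + a1 (snd z) * (fst z \<bullet> e - b0) + l / 2))"
  have v: "C21 UNIV (\<lambda>z. weight z * w z) ?G ?H ?p"
    by (rule C21_mult[OF C21_weight w])
  have Cv: "Cc (\<lambda>z. weight z * w z)"
    by (intro Cc_mult_left assms(2) C21D(1)[OF C21_weight])
  have H: "(\<Sum>b\<in>Basis. ?H b z) = weight z * (lap H z + 2 * (W z \<bullet> G z)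
      + w z * (2 * n * \<kappa> (snd z) + (norm (W z))\<^sup>2))" for z
  proof -
    have "(\<Sum>b\<in>Basis. ?H b z) = weight z * (lap H z)
        + 2 * weight z * (\<Sum>b\<in>Basis. (W z \<bullet> b) * (G z \<bullet> b))
        + (\<Sum>b\<in>(Basis::'a set). w z * weight z * (2 * \<kappa> (snd z)))
        + w z * weight z * (\<Sum>b\<in>Basis. (W z \<bullet> b)\<^sup>2)"
      unfolding sum_distrib_left sum.distrib[symmetric] by (intro sum.cong) (auto simp: algebra_simps)
    then show ?thesis
      unfolding norm2_Basis[symmetric] euclidean_inner[symmetric] by (simp add: n_def algebra_simps)
  qed
  have "(8 * \<kappa> (snd z) + l) * (norm (?G z))\<^sup>2 + Q z * (weight z * w z)\<^sup>2 =
      (weight z)\<^sup>2 * ((8 * \<kappa> (snd z) + l) * (norm (G z + w z *\<^sub>R W z))\<^sup>2 + Q z * (w z)\<^sup>2)" for z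
  proof -
    have "?G z = weight z *\<^sub>R (G z + w z *\<^sub>R W z)"
      by (simp add: algebra_simps)
    then have "(norm (?G z))\<^sup>2 = (weight z)\<^sup>2 * (norm (G z + w z *\<^sub>R W z))\<^sup>2"
      by (simp add: power_mult_distrib)
    then show ?thesis
      by (simp add: power_mult_distrib algebra_simps)
  qed
  moreover have "?p z + (\<Sum>b\<in>Basis. ?H b z) - 2 * (W z \<bullet> ?G z)
        + (X z - 2 * n * \<kappa> (snd z) - l / 2) * (weight z * w z) =
      weight z * (p z + lap H z)" for z
  proof -
    have eq: "W z \<bullet> ?G z = weight z * (W z \<bullet> G z) + w z * weight z * (norm (W z))\<^sup>2"
      by (simp add: inner_add_right dot_square_norm)
    show ?thesis
      unfolding H X_def eq by (simp add: algebra_simps)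
  qed
  ultimately show ?thesis
    using carleman_conjugated[OF v Cv] by (simp add: n_def power_mult_distrib)
qed

text \<open>
  Here \<open>w = \<omega> u\<close> is a localized solution. Under the weight, \<open>w\<^sub>t + \<Delta>w\<close> is at most
  \<open>M |\<nabla>v| + (M|\<nabla>\<phi>| + V) |v|\<close> plus a term \<open>er\<close> with derivatives of \<open>\<omega>\<close>, where \<open>\<nabla>v\<close>
  appears because \<open>\<omega> \<nabla>u = (\<nabla>w + w \<nabla>\<phi>) - w \<nabla>\<phi> - u \<nabla>\<omega>\<close>. The factors 3 come from
  \<open>(x + y + z)\<^sup>2 \<le> 3 (x\<^sup>2 + y\<^sup>2 + z\<^sup>2)\<close>.
\<close>

lemma carleman_absorbed:
  assumes \<omega>: "C21 UNIV \<omega> G\<omega> H\<omega> p\<omega>" and u: "C21 U u Gu Hu pu"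
    and S: "open U" "closed S" "S \<subseteq> U" "\<And>z. z \<notin> S \<Longrightarrow> \<omega> z = 0" "\<And>z. 0 \<le> \<omega> z"
    and K: "compact K" "\<And>z. z \<notin> K \<Longrightarrow> \<omega> z * u z = 0"
    and pde: "\<And>z. z \<in> K \<Longrightarrow> \<bar>pu z + lap Hu z\<bar> \<le> M * norm (Gu z) + V z * \<bar>u z\<bar>"
    and M: "0 \<le> M" "\<And>z. z \<in> K \<Longrightarrow> 0 \<le> V z"
    and grad: "\<And>z. z \<in> K \<Longrightarrow> 3 * M\<^sup>2 \<le> 8 * \<kappa> (snd z) + l"
    and pot: "\<And>z. z \<in> K \<Longrightarrow> 3 * (M * norm (W z) + V z)\<^sup>2 + 1 \<le> Q z"
    and F: "integrable lborel F" "\<And>z. z \<notin> K \<Longrightarrow> 0 \<le> F z"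
    and err: "\<And>z. z \<in> K \<Longrightarrow> 3 * (weight z)\<^sup>2 * (\<bar>u z\<bar> * (\<bar>p\<omega> z + lap H\<omega> z\<bar> + M * norm (G\<omega> z))
        + 2 * norm (G\<omega> z) * norm (Gu z))\<^sup>2 \<le> F z"
  shows "Cc (\<lambda>z. \<omega> z * u z)"
    and "(\<integral>z. (weight z * (\<omega> z * u z))\<^sup>2 \<partial>lborel) \<le> (\<integral>z. F z \<partial>lborel)"
proof -
  define w where "w z = \<omega> z * u z" for z
  define G where "G z = \<omega> z *\<^sub>R Gu z + u z *\<^sub>R G\<omega> z" for z
  define H where "H b z = \<omega> z * Hu b z + 2 * (G\<omega> z \<bullet> b) * (Gu z \<bullet> b) + u z * H\<omega> b z" for b z
  define p where "p z = \<omega> z * pu z + u z * p\<omega> z" for z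
  define L where "L z = (lap H z)" for z
  have w: "C21 UNIV w G H p"
    unfolding w_def[abs_def] G_def[abs_def] H_def[abs_def] p_def[abs_def]
    by (rule C21_localize[OF \<omega> u S(1-4)])
  obtain r where r: "\<And>z. z \<in> K \<Longrightarrow> norm z \<le> r"
    using compact_imp_bounded[OF K(1)] unfolding bounded_iff by blast
  have "Cc w"
    unfolding Cc_def
  proof (intro conjI exI allI impI)
    show "w z = 0" if "r < norm z" for z
      using r[of z] K(2)[of z] that unfolding w_def by fastforce
  qed (rule C21D(1)[OF w])
  then show "Cc (\<lambda>z. \<omega> z * u z)"
    unfolding w_def .
  have out: "w z = 0" "G z = 0" "L z = 0" "p z = 0" if "z \<notin> K" for z
    using K(2)[OF that] C21_outside[OF w, of "- K" z] K(2) that compact_imp_closed[OF K(1)]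
    unfolding L_def w_def by (simp_all add: open_Compl)
  define A where "A z = (weight z)\<^sup>2 * ((8 * \<kappa> (snd z) + l) * (norm (G z + w z *\<^sub>R W z))\<^sup>2 + Q z * (w z)\<^sup>2)" for z
  define B where "B z = (weight z)\<^sup>2 * (p z + L z)\<^sup>2" for z
  have AB: "(\<integral>z. A z \<partial>lborel) \<le> (\<integral>z. B z \<partial>lborel)"
    unfolding A_def B_def L_def by (rule carleman_weighted[OF w \<open>Cc w\<close>])
  have cw: "continuous_on UNIV weight"
    by (rule C21D(1)[OF C21_weight])
  have zero: "A z = 0" "B z = 0" "weight z * w z = 0" if "z \<notin> K" for z
    using out[OF that] by (auto simp: A_def B_def)
  have CcK: "Cc f" if "continuous_on UNIV f" "\<And>z. z \<notin> K \<Longrightarrow> f z = 0" for f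
    unfolding Cc_def using that r by (meson not_le)
  have "Cc A"
  proof (rule CcK)
    show "continuous_on UNIV A"
      unfolding A_def by (intro continuous_intros cw C21D(1,2)[OF w] cont_W cont_X continuous_on_time cont_a)
  qed (rule zero)
  have "Cc B"
  proof (rule CcK)
    show "continuous_on UNIV B"
      unfolding B_def L_def by (intro continuous_intros cw C21D[OF w])
  qed (rule zero)
  have CE: "Cc (\<lambda>z. (weight z * w z)\<^sup>2)"
    by (intro Cc_power2 Cc_mult_left \<open>Cc w\<close> cw)
  have "(weight z * w z)\<^sup>2 - F z \<le> A z - B z" for z
  proof (cases "z \<in> K")
    case False
    then show ?thesis
      using F(2)[OF False] unfolding zero[OF False] by simp
  next
    case True
    define v where "v = G z + w z *\<^sub>R W z"
    define er where "er = \<bar>u z\<bar> * (\<bar>p\<omega> z + lap H\<omega> z\<bar> + M * norm (G\<omega> z))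
        + 2 * norm (G\<omega> z) * norm (Gu z)"
    have "p z + L z = \<omega> z * (pu z + lap Hu z) + u z * (p\<omega> z + lap H\<omega> z)
        + 2 * (G\<omega> z \<bullet> Gu z)"
      unfolding L_def p_def H_def euclidean_inner[of "G\<omega> z" "Gu z"]
      by (simp add: sum.distrib sum_distrib_left distrib_left mult.assoc)
    then have "\<bar>p z + L z\<bar> \<le> \<bar>\<omega> z * (pu z + lap Hu z)\<bar> + \<bar>u z * (p\<omega> z + lap H\<omega> z)\<bar>
        + 2 * \<bar>G\<omega> z \<bullet> Gu z\<bar>"
      by linarith
    also have "\<dots> \<le> \<omega> z * (M * norm (Gu z) + V z * \<bar>u z\<bar>) + \<bar>u z\<bar> * \<bar>p\<omega> z + lap H\<omega> z\<bar>
        + 2 * (norm (G\<omega> z) * norm (Gu z))"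
      using pde[OF True] S(5)[of z] Cauchy_Schwarz_ineq2[of "G\<omega> z" "Gu z"]
      by (intro add_mono mult_left_mono) (auto simp: abs_mult intro!: mult_left_mono)
    also have "\<dots> = M * norm (\<omega> z *\<^sub>R Gu z) + V z * \<bar>w z\<bar> + \<bar>u z\<bar> * \<bar>p\<omega> z + lap H\<omega> z\<bar>
        + 2 * (norm (G\<omega> z) * norm (Gu z))"
      using S(5)[of z] by (simp add: w_def abs_mult algebra_simps)
    also have "\<dots> \<le> M * (norm v + \<bar>w z\<bar> * norm (W z) + \<bar>u z\<bar> * norm (G\<omega> z)) + V z * \<bar>w z\<bar>
        + \<bar>u z\<bar> * \<bar>p\<omega> z + lap H\<omega> z\<bar> + 2 * (norm (G\<omega> z) * norm (Gu z))"
    proof -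
      have "\<omega> z *\<^sub>R Gu z = v - w z *\<^sub>R W z - u z *\<^sub>R G\<omega> z"
        unfolding v_def G_def by simp
      then have "norm (\<omega> z *\<^sub>R Gu z) \<le> norm v + norm (w z *\<^sub>R W z) + norm (u z *\<^sub>R G\<omega> z)"
        using norm_triangle_ineq4[of "v - w z *\<^sub>R W z" "u z *\<^sub>R G\<omega> z"] norm_triangle_ineq4[of v "w z *\<^sub>R W z"]
        by simp
      then show ?thesis
        using M(1) by (simp add: mult_left_mono)
    qed
    also have "\<dots> = M * norm v + (M * norm (W z) + V z) * \<bar>w z\<bar> + er"
      unfolding er_def by (simp add: algebra_simps)
    finally have "\<bar>p z + L z\<bar> \<le> M * norm v + (M * norm (W z) + V z) * \<bar>w z\<bar> + er" .
    then have "(p z + L z)\<^sup>2 \<le> (M * norm v + (M * norm (W z) + V z) * \<bar>w z\<bar> + er)\<^sup>2"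
      using abs_le_square_iff by (metis abs_ge_self order_trans)
    also have "\<dots> \<le> 3 * ((M * norm v)\<^sup>2 + ((M * norm (W z) + V z) * \<bar>w z\<bar>)\<^sup>2 + er\<^sup>2)"
      by (rule square_sum3_le)
    also have "\<dots> = (3 * M\<^sup>2) * (norm v)\<^sup>2 + (3 * (M * norm (W z) + V z)\<^sup>2) * (w z)\<^sup>2 + 3 * er\<^sup>2"
      by (simp add: power_mult_distrib)
    also have "\<dots> \<le> (8 * \<kappa> (snd z) + l) * (norm v)\<^sup>2 + (Q z - 1) * (w z)\<^sup>2 + 3 * er\<^sup>2"
      using grad[OF True] pot[OF True] by (intro add_mono mult_right_mono) auto
    finally have "(weight z)\<^sup>2 * (p z + L z)\<^sup>2 \<le>
        (weight z)\<^sup>2 * ((8 * \<kappa> (snd z) + l) * (norm v)\<^sup>2 + (Q z - 1) * (w z)\<^sup>2 + 3 * er\<^sup>2)"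
      by (intro mult_left_mono) auto
    moreover have "3 * (weight z)\<^sup>2 * er\<^sup>2 \<le> F z"
      using err[OF True] unfolding er_def .
    ultimately show ?thesis
      unfolding A_def B_def v_def[symmetric] by (simp add: algebra_simps power_mult_distrib)
  qed
  then have "(\<integral>z. (weight z * w z)\<^sup>2 - F z \<partial>lborel) \<le> (\<integral>z. A z - B z \<partial>lborel)"
    by (intro integral_mono Bochner_Integration.integrable_diff F(1) Cc_integrable CE \<open>Cc A\<close> \<open>Cc B\<close>)
  then have "(\<integral>z. (weight z * w z)\<^sup>2 \<partial>lborel) \<le> (\<integral>z. F z \<partial>lborel)"
    using AB F(1) Cc_integrable[OF CE] Cc_integrable[OF \<open>Cc A\<close>] Cc_integrable[OF \<open>Cc B\<close>] by simp
  then show "(\<integral>z. (weight z * (\<omega> z * u z))\<^sup>2 \<partial>lborel) \<le> (\<integral>z. F z \<partial>lborel)"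
    unfolding w_def .
qed

end

section \<open>Cutoff functions\<close>

lemma DERIV_pos_part_power:
  "((\<lambda>y::real. max 0 y ^ Suc (Suc n)) has_real_derivative (real (Suc (Suc n)) * max 0 y ^ Suc n)) (at y)"
proof -
  consider "y > 0" | "y < 0" | "y = 0" by linarith
  then show ?thesis
  proof cases
    case 1
    have "((\<lambda>y::real. y ^ Suc (Suc n)) has_real_derivative (real (Suc (Suc n)) * max 0 y ^ Suc n)) (at y)"
      using DERIV_pow[of "Suc (Suc n)" y UNIV] 1 by simp
    then show ?thesis
      by (rule has_field_derivative_transform_within_open[where S = "{0<..}"]) (use 1 in auto)
  next
    case 2
    have "((\<lambda>y::real. 0) has_real_derivative (real (Suc (Suc n)) * max 0 y ^ Suc n)) (at y)"
      using 2 by auto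
    then show ?thesis
      by (rule has_field_derivative_transform_within_open[where S = "{..<0}"]) (use 2 in auto)
  next
    case 3
    have "((\<lambda>h::real. max 0 h ^ Suc n) \<longlongrightarrow> max 0 0 ^ Suc n) (at 0)"
      by (intro tendsto_intros)
    moreover have "max 0 h ^ Suc n = (max 0 (0 + h) ^ Suc (Suc n) - max 0 0 ^ Suc (Suc n)) / h"
      if "h \<noteq> 0" for h :: real
      using that by (auto simp: max_def)
    ultimately have "((\<lambda>h::real. (max 0 (0 + h) ^ Suc (Suc n) - max 0 0 ^ Suc (Suc n)) / h) \<longlongrightarrow> 0) (at 0)"
      by (subst LIM_equal[where g = "\<lambda>h. max 0 h ^ Suc n"]) auto
    then show ?thesis
      using 3 by (simp add: DERIV_def)
  qed
qed

lemma DERIV_pos_part_cube: "((\<lambda>y::real. max 0 y ^ 3) has_real_derivative 3 * (max 0 y)\<^sup>2) (at y)"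
  using DERIV_pos_part_power[of 1 y] by (simp add: numeral_3_eq_3 power2_eq_square)

lemma DERIV_pos_part_square: "((\<lambda>y::real. (max 0 y)\<^sup>2) has_real_derivative 2 * max 0 y) (at y)"
  using DERIV_pos_part_power[of 0 y] by (simp add: numeral_2_eq_2)

text \<open>
  With \<open>c y = (y\<^sub>+)\<^sup>3\<close>, which is of class \<open>C\<^sup>2\<close>, the function \<open>1 - c (1 - c y)\<close> is a \<open>C\<^sup>2\<close> transition
  from 0 on \<open>y \<le> 0\<close> to 1 on \<open>y \<ge> 1\<close>, and the chain rule gives its derivatives \<open>step1\<close> and \<open>step2\<close>.
\<close>

definition step :: "real \<Rightarrow> real" where
  "step y = 1 - max 0 (1 - max 0 y ^ 3) ^ 3"

definition step1 :: "real \<Rightarrow> real" where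
  "step1 y = 9 * (max 0 (1 - max 0 y ^ 3))\<^sup>2 * (max 0 y)\<^sup>2"

definition step2 :: "real \<Rightarrow> real" where
  "step2 y = 18 * (max 0 (1 - max 0 y ^ 3))\<^sup>2 * max 0 y - 54 * max 0 (1 - max 0 y ^ 3) * max 0 y ^ 4"

lemma DERIV_step: "(step has_real_derivative step1 y) (at y)"
  unfolding step_def[abs_def] step1_def
  by (rule derivative_eq_intros DERIV_pos_part_cube DERIV_chain2[where f = "\<lambda>y. max 0 y ^ 3"] refl)+ simp

lemma DERIV_step1: "(step1 has_real_derivative step2 y) (at y)"
  unfolding step1_def[abs_def] step2_def
  by (rule derivative_eq_intros DERIV_pos_part_cube DERIV_pos_part_square
      DERIV_chain2[where f = "\<lambda>y. (max 0 y)\<^sup>2"] refl)+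
    (simp add: algebra_simps power2_eq_square power4_eq_xxxx)

lemma continuous_step2: "continuous_on UNIV step2"
  unfolding step2_def[abs_def] by (intro continuous_intros)

lemma step_below: "y \<le> 0 \<Longrightarrow> step y = 0" "y \<le> 0 \<Longrightarrow> step1 y = 0" "y \<le> 0 \<Longrightarrow> step2 y = 0"
  by (auto simp: step_def step1_def step2_def max_def)

lemma step_above: assumes "y \<ge> 1" shows "step y = 1" "step1 y = 0" "step2 y = 0"
proof -
  have "max 0 (1 - max 0 y ^ 3) = 0"
    using assms one_le_power[of y 3] by auto
  then show "step y = 1" "step1 y = 0" "step2 y = 0"
    by (simp_all add: step_def step1_def step2_def)
qed

lemma step_bounds: "0 \<le> step y" "step y \<le> 1" "\<bar>step1 y\<bar> \<le> 9" "\<bar>step2 y\<bar> \<le> 72"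
proof -
  define c where "c = max 0 (1 - max 0 y ^ 3)"
  have c: "0 \<le> c" "c \<le> 1"
    by (auto simp: c_def)
  show "0 \<le> step y" "step y \<le> 1"
    using c power_le_one[of c 3] by (auto simp: step_def c_def[symmetric])
  show "\<bar>step1 y\<bar> \<le> 9"
  proof (cases "y \<le> 0 \<or> y \<ge> 1")
    case False
    then have "c\<^sup>2 * (max 0 y)\<^sup>2 \<le> 1 * 1"
      using c by (intro mult_mono power_le_one) auto
    then show ?thesis
      by (simp add: step1_def c_def[symmetric] mult.assoc)
  qed (auto simp: step_below step_above)
  show "\<bar>step2 y\<bar> \<le> 72"
  proof (cases "y \<le> 0 \<or> y \<ge> 1")
    case False
    then have "c\<^sup>2 * max 0 y \<le> 1 * 1" "c * max 0 y ^ 4 \<le> 1 * 1"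
      using c by (intro mult_mono power_le_one; simp)+
    moreover have "0 \<le> c\<^sup>2 * max 0 y" "0 \<le> c * max 0 y ^ 4"
      using c by auto
    ultimately show ?thesis
      unfolding step2_def c_def[symmetric] mult.assoc by linarith
  qed (auto simp: step_below step_above)
qed

text \<open>
  One constant bounds the gradient and the operator \<open>\<partial>\<^sub>t + \<Delta>\<close>, so that bounds for
  products of cutoffs follow from bounds for the factors.
\<close>

definition cutoff where
  "cutoff f G H p c \<longleftrightarrow> C21 UNIV f G H p \<and>
    (\<forall>z. 0 \<le> f z \<and> f z \<le> 1 \<and> norm (G z) \<le> c \<and> \<bar>p z + lap H z\<bar> \<le> c)"

lemma cutoff_mult:
  assumes f: "cutoff f G H p c" and g: "cutoff g G' H' p' c'"
  shows "cutoff (\<lambda>z. f z * g z) (\<lambda>z. f z *\<^sub>R G' z + g z *\<^sub>R G z)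
    (\<lambda>b z. f z * H' b z + 2 * (G z \<bullet> b) * (G' z \<bullet> b) + g z * H b z) (\<lambda>z. f z * p' z + g z * p z)
    (c + c' + 2 * c * c')"
  unfolding cutoff_def
proof (intro conjI allI)
  fix z
  let ?L = "p z + lap H z" and ?L' = "p' z + (\<Sum>b\<in>Basis. H' b z)"
  have F: "0 \<le> f z" "f z \<le> 1" "norm (G z) \<le> c" "\<bar>?L\<bar> \<le> c"
    and G: "0 \<le> g z" "g z \<le> 1" "norm (G' z) \<le> c'" "\<bar>?L'\<bar> \<le> c'"
    using f g unfolding cutoff_def by blast+
  have c: "0 \<le> c" "0 \<le> c'"
    using F(3) G(3) norm_ge_zero[of "G z"] norm_ge_zero[of "G' z"] by linarith+
  show "0 \<le> f z * g z" "f z * g z \<le> 1"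
    using F G mult_mono[of "f z" 1 "g z" 1] by auto
  have m: "\<bar>f z * y\<bar> \<le> r" if "\<bar>y\<bar> \<le> r" for y r
    using mult_mono[OF F(2) that] F(1) by (auto simp: abs_mult)
  have m': "\<bar>g z * y\<bar> \<le> r" if "\<bar>y\<bar> \<le> r" for y r
    using mult_mono[OF G(2) that] G(1) by (auto simp: abs_mult)
  have "norm (f z *\<^sub>R G' z + g z *\<^sub>R G z) \<le> \<bar>f z * norm (G' z)\<bar> + \<bar>g z * norm (G z)\<bar>"
    by (rule order_trans[OF norm_triangle_ineq]) (simp add: abs_mult)
  also have "\<dots> \<le> c' + c"
    using F(3) G(3) by (intro add_mono m m') auto
  finally show "norm (f z *\<^sub>R G' z + g z *\<^sub>R G z) \<le> c + c' + 2 * c * c'"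
    using c by (smt (verit) mult_nonneg_nonneg)
  have "f z * p' z + g z * p z + (\<Sum>b\<in>Basis. f z * H' b z + 2 * (G z \<bullet> b) * (G' z \<bullet> b) + g z * H b z) =
      f z * ?L' + g z * ?L + 2 * (G z \<bullet> G' z)"
    unfolding euclidean_inner[of "G z" "G' z"]
    by (simp add: sum.distrib sum_distrib_left distrib_left mult.assoc)
  also have "\<bar>\<dots>\<bar> \<le> c' + c + 2 * (c * c')"
  proof -
    have "\<bar>G z \<bullet> G' z\<bar> \<le> c * c'"
      by (rule order_trans[OF Cauchy_Schwarz_ineq2 mult_mono]) (use F G c in auto)
    then show ?thesis
      using m[OF G(4)] m'[OF F(4)] by linarith
  qed
  finally show "\<bar>f z * p' z + g z * p z + (\<Sum>b\<in>Basis. f z * H' b z + 2 * (G z \<bullet> b) * (G' z \<bullet> b) + g z * H b z)\<bar>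
      \<le> c + c' + 2 * c * c'"
    by simp
qed (use f g in \<open>auto simp: cutoff_def intro: C21_mult\<close>)

lemmas C21_step = C21_chain[OF _ DERIV_step DERIV_step1 continuous_step2]

lemma cutoff_halfspace:
  fixes e :: "'a::euclidean_space" and c d :: real
  assumes e: "norm e = 1" and d: "d > 0"
  defines "y \<equiv> \<lambda>z. d * (fst z \<bullet> e) + c"
  shows "cutoff (\<lambda>z. step (y z)) (\<lambda>z. step1 (y z) *\<^sub>R (d *\<^sub>R e))
      (\<lambda>b z. step1 (y z) * (d * 0) + step2 (y z) * (d *\<^sub>R e \<bullet> b)\<^sup>2) (\<lambda>z. step1 (y z) * (d * 0))
      (9 * d + 72 * d\<^sup>2)"
  unfolding cutoff_def
proof (intro conjI allI)
  fix z
  have ee: "(\<Sum>b\<in>Basis. (e \<bullet> b)\<^sup>2) = 1"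
    using e by (simp add: norm2_Basis[symmetric])
  have b: "\<bar>step1 (y z)\<bar> * d \<le> 9 * d" "\<bar>step2 (y z)\<bar> * d\<^sup>2 \<le> 72 * d\<^sup>2"
    using step_bounds[of "y z"] d by (auto intro!: mult_right_mono)
  have "norm (step1 (y z) *\<^sub>R (d *\<^sub>R e)) = \<bar>step1 (y z)\<bar> * d"
    using e d by (simp add: abs_mult)
  also have "\<dots> \<le> 9 * d + 72 * d\<^sup>2"
    using b(1) zero_le_power2[of d] by linarith
  finally show "norm (step1 (y z) *\<^sub>R (d *\<^sub>R e)) \<le> 9 * d + 72 * d\<^sup>2" .
  have "(\<Sum>b\<in>Basis. step1 (y z) * (d * 0) + step2 (y z) * (d *\<^sub>R e \<bullet> b)\<^sup>2) =
      (\<Sum>b\<in>Basis. (step2 (y z) * d\<^sup>2) * (e \<bullet> b)\<^sup>2)"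
    by (intro sum.cong) (simp_all add: power_mult_distrib)
  also have "\<dots> = step2 (y z) * d\<^sup>2"
    unfolding sum_distrib_left[symmetric] ee by simp
  finally have "\<bar>step1 (y z) * (d * 0) + (\<Sum>b\<in>Basis. step1 (y z) * (d * 0) + step2 (y z) * (d *\<^sub>R e \<bullet> b)\<^sup>2)\<bar>
      = \<bar>step2 (y z)\<bar> * d\<^sup>2"
    by (simp add: abs_mult)
  also have "\<dots> \<le> 9 * d + 72 * d\<^sup>2"
    using b(2) d by linarith
  finally show "\<bar>step1 (y z) * (d * 0) + (\<Sum>b\<in>Basis. step1 (y z) * (d * 0) + step2 (y z) * (d *\<^sub>R e \<bullet> b)\<^sup>2)\<bar>
      \<le> 9 * d + 72 * d\<^sup>2" .
  show "C21 UNIV (\<lambda>z. step (y z)) (\<lambda>z. step1 (y z) *\<^sub>R (d *\<^sub>R e))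
      (\<lambda>b z. step1 (y z) * (d * 0) + step2 (y z) * (d *\<^sub>R e \<bullet> b)\<^sup>2) (\<lambda>z. step1 (y z) * (d * 0))"
    unfolding y_def by (rule C21_step[OF C21_affine[OF C21_inner]])
qed (rule step_bounds)+

lemma cutoff_time:
  fixes c h :: real
  assumes h: "h > 0"
  defines "y \<equiv> \<lambda>z::'a::euclidean_space \<times> real. - h * snd z + c"
  shows "cutoff (\<lambda>z. step (y z)) (\<lambda>z. step1 (y z) *\<^sub>R 0)
      (\<lambda>b z. step1 (y z) * 0 + step2 (y z) * (0 \<bullet> b)\<^sup>2) (\<lambda>z. step1 (y z) * - h) (9 * h)"
  unfolding cutoff_def
proof (intro conjI allI)
  fix z
  have "((\<lambda>t. - h * t + c) has_real_derivative - h) (at t)" for t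
    by (auto intro!: derivative_eq_intros)
  from C21_time[OF this]
  have "C21 UNIV y (\<lambda>z. 0) (\<lambda>b z. 0) (\<lambda>z. - h)"
    unfolding y_def by simp
  from C21_step[OF this]
  show "C21 UNIV (\<lambda>z. step (y z)) (\<lambda>z. step1 (y z) *\<^sub>R 0)
      (\<lambda>b z. step1 (y z) * 0 + step2 (y z) * (0 \<bullet> b)\<^sup>2) (\<lambda>z. step1 (y z) * - h)" .
  have "\<bar>step1 (y z)\<bar> * h \<le> 9 * h"
    using step_bounds[of "y z"] h by (intro mult_right_mono) auto
  then show "\<bar>step1 (y z) * - h + (\<Sum>b\<in>Basis. step1 (y z) * 0 + step2 (y z) * ((0::'a) \<bullet> b)\<^sup>2)\<bar> \<le> 9 * h"
    using h by (simp add: abs_mult)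
  show "norm (step1 (y z) *\<^sub>R (0::'a)) \<le> 9 * h"
    using h by simp
qed (rule step_bounds)+

lemma cutoff_ball:
  assumes r: "r \<ge> 1"
  defines "y \<equiv> \<lambda>z::'a::euclidean_space \<times> real. - (1 / r\<^sup>2) * (norm (fst z))\<^sup>2 + 2"
  shows "cutoff (\<lambda>z. step (y z)) (\<lambda>z. step1 (y z) *\<^sub>R (- (1 / r\<^sup>2) *\<^sub>R (2 *\<^sub>R fst z)))
      (\<lambda>b z. step1 (y z) * (- (1 / r\<^sup>2) * 2) + step2 (y z) * (- (1 / r\<^sup>2) *\<^sub>R (2 *\<^sub>R fst z) \<bullet> b)\<^sup>2)
      (\<lambda>z. step1 (y z) * (- (1 / r\<^sup>2) * 0)) (612 + 18 * real DIM('a))"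
  unfolding cutoff_def
proof (intro conjI allI)
  fix z :: "'a \<times> real"
  let ?x = "fst z"
  define n where "n = real DIM('a)"
  have n: "n \<ge> 0"
    by (simp add: n_def)
  define q where "q = (norm ?x)\<^sup>2 / r\<^sup>2"
  have r2: "1 \<le> r\<^sup>2"
    using r by simp
  have small: "\<bar>step1 (y z)\<bar> * (norm ?x * 2 / r\<^sup>2) \<le> 36 \<and> \<bar>step2 (y z)\<bar> * (4 * q / r\<^sup>2) \<le> 576"
  proof (cases "y z \<le> 0")
    case True
    then show ?thesis by (simp add: step_below)
  next
    case False
    then have q: "q \<le> 2"
      by (simp add: y_def q_def)
    then have "(norm ?x)\<^sup>2 \<le> 2 * r\<^sup>2"
      using r by (simp add: q_def divide_le_eq)
    also have "\<dots> \<le> (2 * r)\<^sup>2"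
      unfolding power_mult_distrib using r2 by simp
    finally have x': "norm ?x \<le> 2 * r"
      by (rule power2_le_imp_le) (use r in simp)
    have "r * 1 \<le> r * r"
      using r by (intro mult_left_mono) auto
    then have "norm ?x * 2 \<le> 4 * r\<^sup>2"
      using x' unfolding power2_eq_square by linarith
    then have "norm ?x * 2 / r\<^sup>2 \<le> 4"
      using r by (simp add: divide_le_eq)
    then have a: "\<bar>step1 (y z)\<bar> * (norm ?x * 2 / r\<^sup>2) \<le> 9 * 4"
      using step_bounds[of "y z"] by (intro mult_mono) auto
    have "4 * q \<le> 8 * r\<^sup>2"
      using q r2 by linarith
    then have "4 * q / r\<^sup>2 \<le> 8"
      using r by (simp add: divide_le_eq)
    then have c: "\<bar>step2 (y z)\<bar> * (4 * q / r\<^sup>2) \<le> 72 * 8"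
      using step_bounds[of "y z"] by (intro mult_mono) (auto simp: q_def)
    show ?thesis
      using a c by simp
  qed
  have "norm (step1 (y z) *\<^sub>R (- (1 / r\<^sup>2) *\<^sub>R (2 *\<^sub>R ?x))) = \<bar>step1 (y z)\<bar> * (norm ?x * 2 / r\<^sup>2)"
    by (simp add: abs_mult)
  then show "norm (step1 (y z) *\<^sub>R (- (1 / r\<^sup>2) *\<^sub>R (2 *\<^sub>R ?x))) \<le> 612 + 18 * real DIM('a)"
    using small n unfolding n_def by linarith
  have "2 / r\<^sup>2 \<le> 2"
    using r r2 by (simp add: divide_le_eq)
  then have b: "\<bar>step1 (y z)\<bar> * (2 / r\<^sup>2) \<le> 9 * 2"
    using step_bounds[of "y z"] by (intro mult_mono) auto
  have "(\<Sum>b\<in>Basis. step1 (y z) * (- (1 / r\<^sup>2) * 2) + step2 (y z) * (- (1 / r\<^sup>2) *\<^sub>R (2 *\<^sub>R ?x) \<bullet> b)\<^sup>2) =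
      (\<Sum>b\<in>(Basis::'a set). step1 (y z) * (- (1 / r\<^sup>2) * 2))
      + step2 (y z) * (4 / r\<^sup>2 / r\<^sup>2) * (\<Sum>b\<in>Basis. (?x \<bullet> b)\<^sup>2)"
    unfolding sum_distrib_left sum.distrib[symmetric]
    by (intro sum.cong) (simp_all add: power_mult_distrib power_divide power2_eq_square)
  also have "\<dots> = n * (step1 (y z) * (- (1 / r\<^sup>2) * 2)) + step2 (y z) * (4 * q / r\<^sup>2)"
    unfolding norm2_Basis[symmetric] q_def n_def by simp
  finally have "\<bar>step1 (y z) * (- (1 / r\<^sup>2) * 0) + (\<Sum>b\<in>Basis. step1 (y z) * (- (1 / r\<^sup>2) * 2)
      + step2 (y z) * (- (1 / r\<^sup>2) *\<^sub>R (2 *\<^sub>R ?x) \<bullet> b)\<^sup>2)\<bar>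
      \<le> \<bar>n * (step1 (y z) * (- (1 / r\<^sup>2) * 2))\<bar> + \<bar>step2 (y z) * (4 * q / r\<^sup>2)\<bar>"
    by (simp only: mult_zero_right add_0_left abs_triangle_ineq)
  also have "\<dots> = n * (\<bar>step1 (y z)\<bar> * (2 / r\<^sup>2)) + \<bar>step2 (y z)\<bar> * (4 * q / r\<^sup>2)"
    using n by (simp add: abs_mult q_def)
  also have "\<dots> \<le> n * (9 * 2) + 576"
    using small b n by (intro add_mono mult_left_mono) auto
  finally show "\<bar>step1 (y z) * (- (1 / r\<^sup>2) * 0) + (\<Sum>b\<in>Basis. step1 (y z) * (- (1 / r\<^sup>2) * 2)
      + step2 (y z) * (- (1 / r\<^sup>2) *\<^sub>R (2 *\<^sub>R ?x) \<bullet> b)\<^sup>2)\<bar> \<le> 612 + 18 * real DIM('a)"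
    unfolding n_def by linarith
  show "C21 UNIV (\<lambda>z. step (y z)) (\<lambda>z. step1 (y z) *\<^sub>R (- (1 / r\<^sup>2) *\<^sub>R (2 *\<^sub>R fst z)))
      (\<lambda>b z. step1 (y z) * (- (1 / r\<^sup>2) * 2) + step2 (y z) * (- (1 / r\<^sup>2) *\<^sub>R (2 *\<^sub>R fst z) \<bullet> b)\<^sup>2)
      (\<lambda>z. step1 (y z) * (- (1 / r\<^sup>2) * 0))"
    unfolding y_def by (rule C21_step[OF C21_affine[OF C21_norm2]])
qed (rule step_bounds)+

definition halfspace_cutoff where
  "halfspace_cutoff e R1 R2 T1 T2 r C \<omega> G H p \<longleftrightarrow> cutoff \<omega> G H p C \<and>
    (\<forall>z. \<omega> z \<noteq> 0 \<longrightarrow> R1 \<le> fst z \<bullet> e \<and> snd z \<le> T2 \<and> norm (fst z) \<le> 2 * r) \<and>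
    (\<forall>z. R2 \<le> fst z \<bullet> e \<longrightarrow> snd z \<le> T1 \<longrightarrow> norm (fst z) \<le> r \<longrightarrow>
      \<omega> z = 1 \<and> G z = 0 \<and> p z + lap H z = 0)"

text \<open>
  The product of a cutoff at the face of the half-space, one in time and one at infinity.
  It matters that the bound \<open>C\<close> does not depend on the radius \<open>r\<close>.
\<close>

lemma cutoff_exists:
  fixes e :: "'a::euclidean_space"
  assumes e: "norm e = 1" and R: "R1 < R2" and T: "T1 < T2"
  obtains C where "C \<ge> 0" and "\<And>r. r \<ge> 1 \<Longrightarrow> \<exists>\<omega> G H p. halfspace_cutoff e R1 R2 T1 T2 r C \<omega> G H p"
proof -
  define d h where "d = 1 / (R2 - R1)" and "h = 1 / (T2 - T1)"
  have d: "d > 0" "h > 0"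
    using R T by (auto simp: d_def h_def)
  define c1 c2 c3 where "c1 = 9 * d + 72 * d\<^sup>2" and "c2 = 9 * h" and "c3 = 612 + 18 * real DIM('a)"
  define y1 y2 where "y1 z = d * (fst z \<bullet> e) + (- d * R1)" and "y2 z = - h * snd z + h * T2"
    for z :: "'a \<times> real"
  define c12 where "c12 = c1 + c2 + 2 * c1 * c2"
  note cut12 = cutoff_mult[OF cutoff_halfspace[OF e d(1), of "- d * R1", folded y1_def]
      cutoff_time[OF d(2), of "h * T2", where ?'a = 'a, folded y2_def]]
  show thesis
  proof (rule that)
    have "c1 \<ge> 0" "c2 \<ge> 0" "c3 \<ge> 0"
      using d by (auto simp: c1_def c2_def c3_def)
    then show "c12 + c3 + 2 * c12 * c3 \<ge> 0"
      by (simp add: c12_def)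
    fix r :: real assume r: "r \<ge> 1"
    define y3 where "y3 z = - (1 / r\<^sup>2) * (norm (fst z))\<^sup>2 + 2" for z :: "'a \<times> real"
    note cut = cutoff_mult[OF cut12 cutoff_ball[OF r, where ?'a = 'a, folded y3_def],
        folded c1_def c2_def c3_def, folded c12_def]
    have good: "y1 z \<ge> 1" "y2 z \<ge> 1" "y3 z \<ge> 1"
      if "R2 \<le> fst z \<bullet> e" "snd z \<le> T1" "norm (fst z) \<le> r" for z
    proof -
      have "(norm (fst z))\<^sup>2 \<le> r\<^sup>2"
        using that(3) by (intro power_mono) auto
      then show "y3 z \<ge> 1"
        using r by (simp add: y3_def field_simps)
      have "d * (R2 - R1) \<le> d * (fst z \<bullet> e - R1)"
        using that d by (intro mult_left_mono) auto
      moreover have "d * (R2 - R1) = 1"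
        using R by (simp add: d_def)
      ultimately show "y1 z \<ge> 1"
        by (simp add: y1_def algebra_simps)
      have "h * (T2 - T1) \<le> h * (T2 - snd z)"
        using that d by (intro mult_left_mono) auto
      moreover have "h * (T2 - T1) = 1"
        using T by (simp add: h_def)
      ultimately show "y2 z \<ge> 1"
        by (simp add: y2_def algebra_simps)
    qed
    have supp: "R1 \<le> fst z \<bullet> e \<and> snd z \<le> T2 \<and> norm (fst z) \<le> 2 * r"
      if nz: "step (y1 z) * step (y2 z) * step (y3 z) \<noteq> 0" for z
    proof -
      have "step (y1 z) \<noteq> 0" "step (y2 z) \<noteq> 0" "step (y3 z) \<noteq> 0"
        using nz by simp_all
      then have "y1 z > 0" "y2 z > 0" "y3 z > 0"
        using step_below(1) not_le by blast+
      then have "d * R1 < d * (fst z \<bullet> e)" "h * snd z < h * T2" "(norm (fst z))\<^sup>2 \<le> 2 * r\<^sup>2"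
        using r by (auto simp: y1_def y2_def y3_def field_simps)
      moreover have "2 * r\<^sup>2 \<le> (2 * r)\<^sup>2"
        unfolding power_mult_distrib using r by simp
      ultimately have "(norm (fst z))\<^sup>2 \<le> (2 * r)\<^sup>2"
        by linarith
      then have "norm (fst z) \<le> 2 * r"
        using r by (intro power2_le_imp_le[of "norm (fst z)" "2 * r"]) auto
      then show ?thesis
        using d \<open>d * R1 < d * (fst z \<bullet> e)\<close> \<open>h * snd z < h * T2\<close> by auto
    qed
    have flat: "step (y1 z) = 1" "step1 (y1 z) = 0" "step2 (y1 z) = 0" "step (y2 z) = 1" "step1 (y2 z) = 0"
      "step2 (y2 z) = 0" "step (y3 z) = 1" "step1 (y3 z) = 0" "step2 (y3 z) = 0"
      if "R2 \<le> fst z \<bullet> e" "snd z \<le> T1" "norm (fst z) \<le> r" for z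
      using step_above[OF good(1)[OF that]] step_above[OF good(2)[OF that]] step_above[OF good(3)[OF that]] by this+
    show "\<exists>\<omega> G H p. halfspace_cutoff e R1 R2 T1 T2 r (c12 + c3 + 2 * c12 * c3) \<omega> G H p"
      unfolding halfspace_cutoff_def
      apply (rule exI)+
      apply (rule conjI)
       apply (rule cut)
      apply (rule conjI)
       apply (intro allI impI supp)
       apply assumption
      apply (intro allI impI)
      apply (simp only: flat)
      apply simp
      done
  qed
qed

section \<open>Solutions of the differential inequality and their Gaussian energy bound\<close>

lemma integrable_gaussian: "integrable lborel (\<lambda>x::'a::euclidean_space. exp (- (norm x)\<^sup>2))"
proof -
  have "integrable lborel (\<lambda>x::real. exp (- x\<^sup>2))"
    using has_bochner_integral_even_function[OF gaussian_moment_0] by (simp add: has_bochner_integral_iff)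
  then have fin: "(nn_integral lborel (\<lambda>x::real. ennreal (exp (- x\<^sup>2)))) < \<infinity>"
    by (simp add: integrable_iff_bounded)
  have "(nn_integral lborel (\<lambda>x::'a. ennreal (exp (- (norm x)\<^sup>2)))) =
      (nn_integral lborel (\<lambda>x::'a. (\<Prod>b\<in>Basis. ennreal (exp (- (x \<bullet> b)\<^sup>2)))))"
  proof -
    have "- (norm x)\<^sup>2 = (\<Sum>b\<in>Basis. - (x \<bullet> b)\<^sup>2)" for x :: 'a
      by (simp add: norm2_Basis sum_negf)
    then show ?thesis
      by (simp add: exp_sum prod_ennreal)
  qed
  also have "\<dots> = (\<Prod>b\<in>(Basis::'a set). nn_integral lborel (\<lambda>x::real. ennreal (exp (- x\<^sup>2))))"
    by (rule nn_integral_lborel_prod) auto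
  also have "\<dots> < \<infinity>"
    using fin by (simp add: power_less_top_ennreal)
  finally show ?thesis
    by (simp add: integrable_iff_bounded)
qed

text \<open>
  Solutions already extended by zero to negative times. The potential is bounded by \<open>V |x|\<close>, and the
  domain is open, which leaves the boundary regularity to the final theorem.
\<close>

locale backward_solution =
  fixes u pu :: "'a::euclidean_space \<times> real \<Rightarrow> real" and Gu :: "'a \<times> real \<Rightarrow> 'a"
    and Hu :: "'a \<Rightarrow> 'a \<times> real \<Rightarrow> real" and M V R T :: real
  assumes M: "M > 0" and V: "V \<ge> 0" and R: "R > 0"
    and u: "C21 {z. R < norm (fst z) \<and> snd z < T} u Gu Hu pu"
    and pde: "\<And>z. R < norm (fst z) \<Longrightarrow> snd z < T \<Longrightarrow>
      \<bar>pu z + lap Hu z\<bar> \<le> M * norm (Gu z) + V * norm (fst z) * \<bar>u z\<bar>"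
    and growth: "\<And>z. R < norm (fst z) \<Longrightarrow> snd z < T \<Longrightarrow> \<bar>u z\<bar> \<le> M * exp (M * (norm (fst z))\<^sup>2)"
    and initial: "\<And>z. R < norm (fst z) \<Longrightarrow> snd z < T \<Longrightarrow> snd z \<le> 0 \<Longrightarrow> u z = 0"
begin

definition U :: "('a \<times> real) set" where
  "U = {z. R < norm (fst z) \<and> snd z < T}"

definition vanishes_until :: "real \<Rightarrow> bool" where
  "vanishes_until s \<longleftrightarrow> (\<forall>z\<in>U. snd z \<le> s \<longrightarrow> u z = 0)"

lemma open_U: "open U"
  unfolding U_def by (intro open_Collect_conj open_Collect_less continuous_intros)

lemma uU: "C21 U u Gu Hu pu"
  using u unfolding U_def .

end

definition slab :: "'a::euclidean_space \<Rightarrow> real \<Rightarrow> real \<Rightarrow> real \<Rightarrow> real \<Rightarrow> ('a \<times> real) set" where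
  "slab e R1 s T1 r = {z. R1 \<le> fst z \<bullet> e \<and> s \<le> snd z \<and> snd z \<le> T1 \<and> norm (fst z) \<le> r}"

lemma compact_slab: "compact (slab e R1 s T1 r)"
proof -
  have "slab e R1 s T1 r \<subseteq> cball 0 r \<times> {s..T1}"
    by (auto simp: slab_def)
  then have "bounded (slab e R1 s T1 r)"
    by (rule bounded_subset[rotated]) (intro bounded_Times bounded_cball bounded_closed_interval)
  moreover have "closed (slab e R1 s T1 r)"
    unfolding slab_def by (intro closed_Collect_conj closed_Collect_le continuous_intros)
  ultimately show ?thesis
    by (simp add: compact_eq_bounded_closed)
qed

lemma closed_halfspace_time: "closed {z::'a::euclidean_space \<times> real. R1 \<le> fst z \<bullet> e \<and> snd z \<le> T1}"
  by (intro closed_Collect_conj closed_Collect_le continuous_intros)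

lemma inner_unit_le: "norm e = 1 \<Longrightarrow> x \<bullet> e \<le> norm x"
  using Cauchy_Schwarz_ineq2[of x e] by simp

lemma quartic_le_exp: "(1 + r)^4 \<le> 16 * exp (r\<^sup>2)" if "r \<ge> 0" for r :: real
proof -
  have "(1 + r)\<^sup>2 \<le> 4 * (1 + r\<^sup>2 / 2)"
    using zero_le_power2[of "r - 1"] by (simp add: power2_eq_square algebra_simps)
  also have "\<dots> \<le> 4 * exp (r\<^sup>2 / 2)"
    by (intro mult_left_mono exp_ge_add_one_self) simp
  finally have "((1 + r)\<^sup>2)\<^sup>2 \<le> (4 * exp (r\<^sup>2 / 2))\<^sup>2"
    by (intro power_mono) auto
  also have "\<dots> = 16 * exp (r\<^sup>2)"
    by (simp add: power_mult_distrib exp_double[symmetric])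
  finally show ?thesis
    by (simp add: power_mult[symmetric])
qed

context backward_solution
begin

lemma halfspace_time_subset:
  assumes "norm e = 1" "R < R1" "T1 < T"
  shows "{z. R1 \<le> fst z \<bullet> e \<and> snd z \<le> T1} \<subseteq> U"
proof
  fix z assume "z \<in> {z. R1 \<le> fst z \<bullet> e \<and> snd z \<le> T1}"
  then show "z \<in> U"
    using assms inner_unit_le[OF assms(1), of "fst z"] by (auto simp: U_def)
qed

lemma slab_subset:
  assumes "norm e = 1" "R < R1" "T1 < T"
  shows "slab e R1 s T1 r \<subseteq> U"
  using halfspace_time_subset[OF assms] by (auto simp: slab_def)

text \<open>
  Multiply the equation for \<open>v = g u\<close> by \<open>v\<close>, where \<open>g\<close> is a cutoff times \<open>E = exp(- (M+1) |x|\<^sup>2)\<close>, and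
  integrate: \<open>\<integral> |\<nabla>v|\<^sup>2 = - \<integral> v (v\<^sub>t + \<Delta>v)\<close>. All terms on the right are controlled by \<open>A = |u| E \<beta>\<close>
  with a polynomial \<open>\<beta>\<close> in \<open>|x|\<close>, and \<open>A\<^sup>2\<close> is bounded by an integrable Gaussian because of the growth
  condition. The bound is therefore uniform in the radius of the cutoff.
\<close>

lemma caccioppoli:
  assumes e: "norm e = 1" and R1: "R < R1" and T1: "T1 < T" and s: "vanishes_until s"
  obtains D where "D \<ge> 0" and "\<And>r. r \<ge> 1 \<Longrightarrow>
    (\<integral>z. indicator (slab e R1 s T1 r) z * (exp (- 2 * (M + 1) * (norm (fst z))\<^sup>2) * ((u z)\<^sup>2 + (norm (Gu z))\<^sup>2)) \<partial>lborel) \<le> D"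
proof -
  define m where "m = M + 1"
  define n where "n = real DIM('a)"
  define R0 where "R0 = (R + R1) / 2"
  define T2 where "T2 = (T1 + T) / 2"
  have R0: "R < R0" "R0 < R1" and T2: "T1 < T2" "T2 < T"
    using R1 T1 by (auto simp: R0_def T2_def)
  obtain C where C: "C \<ge> 0" and cut: "\<And>r. r \<ge> 1 \<Longrightarrow> \<exists>\<omega> G H p. halfspace_cutoff e R0 R1 T1 T2 r C \<omega> G H p"
    using cutoff_exists[OF e R0(2) T2(1)] by blast
  define B where "B = 1 + C + 2 * m + 4 * m * C + 4 * m\<^sup>2 + 2 * m * n + V"
  define \<beta> where "\<beta> z = B * (1 + norm (fst z))\<^sup>2" for z :: "'a \<times> real"
  define E where "E z = exp (- m * (norm (fst z))\<^sup>2 + 0)" for z :: "'a \<times> real"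
  have m: "m > 0" and n: "n \<ge> 0"
    using M by (auto simp: m_def n_def)
  have B: "B \<ge> 1"
    using m n C V by (simp add: B_def)
  define c where "c = (M + 2)\<^sup>2 / 2 + M + 4"
  \<comment> \<open>On the time interval, \<open>exp(- |x|\<^sup>2) \<le> exp \<tau> * exp(- |z|\<^sup>2)\<close>, which is integrable in space-time.\<close>
  define \<tau> where "\<tau> = max (s\<^sup>2) (T2\<^sup>2)"
  define N where "N = 16 * M\<^sup>2 * B\<^sup>2 * exp \<tau>"
  define gs where "gs z = N * exp (- (norm z)\<^sup>2)" for z :: "'a \<times> real"
  have gs: "integrable lborel gs" and gs0: "gs z \<ge> 0" for z
    unfolding gs_def by (auto intro!: integrable_mult_right integrable_gaussian simp: N_def)
  have c0: "c \<ge> 0"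
    using M by (simp add: c_def)
  have E: "C21 UNIV E (\<lambda>z. E z *\<^sub>R (- m *\<^sub>R (2 *\<^sub>R fst z)))
      (\<lambda>b z. E z * (- m * 2) + E z * (- m *\<^sub>R (2 *\<^sub>R fst z) \<bullet> b)\<^sup>2) (\<lambda>z. E z * (- m * 0))"
    unfolding E_def
    by (rule C21_chain[OF C21_affine[OF C21_norm2] DERIV_exp DERIV_exp continuous_on_exp[OF continuous_on_id]])
  have A_bound: "(\<bar>u z\<bar> * E z * \<beta> z)\<^sup>2 \<le> gs z" if z: "z \<in> U" "s \<le> snd z" "snd z \<le> T2" for z
  proof -
    let ?r = "norm (fst z)"
    have "\<bar>u z\<bar> * E z * \<beta> z \<le> (M * exp (M * ?r\<^sup>2)) * E z * \<beta> z"
      using growth[of z] z B by (intro mult_right_mono) (auto simp: U_def E_def \<beta>_def)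
    then have "(\<bar>u z\<bar> * E z * \<beta> z)\<^sup>2 \<le> ((M * exp (M * ?r\<^sup>2)) * E z * \<beta> z)\<^sup>2"
      using B by (intro power_mono) (auto simp: E_def \<beta>_def)
    also have "\<dots> = M\<^sup>2 * B\<^sup>2 * (exp (M * ?r\<^sup>2) * exp (- m * ?r\<^sup>2))\<^sup>2 * (1 + ?r)^4"
      by (simp add: \<beta>_def E_def power_mult_distrib power_mult[symmetric])
    also have "(exp (M * ?r\<^sup>2) * exp (- m * ?r\<^sup>2))\<^sup>2 = exp (- 2 * ?r\<^sup>2)"
      by (simp add: exp_add[symmetric] exp_double[symmetric] m_def algebra_simps)
    also have "M\<^sup>2 * B\<^sup>2 * exp (- 2 * ?r\<^sup>2) * (1 + ?r)^4 \<le> M\<^sup>2 * B\<^sup>2 * exp (- 2 * ?r\<^sup>2) * (16 * exp (?r\<^sup>2))"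
      by (intro mult_left_mono quartic_le_exp) auto
    also have "\<dots> = 16 * M\<^sup>2 * B\<^sup>2 * (exp (- 2 * ?r\<^sup>2) * exp (?r\<^sup>2))"
      by simp
    also have "exp (- 2 * ?r\<^sup>2) * exp (?r\<^sup>2) = exp (- ?r\<^sup>2)"
      by (simp add: exp_add[symmetric])
    also have "16 * M\<^sup>2 * B\<^sup>2 * exp (- ?r\<^sup>2) \<le> 16 * M\<^sup>2 * B\<^sup>2 * (exp \<tau> * exp (- (norm z)\<^sup>2))"
    proof (intro mult_left_mono)
      have "(norm z)\<^sup>2 = ?r\<^sup>2 + (snd z)\<^sup>2"
        by (cases z) (simp add: norm_Pair)
      moreover have "(snd z)\<^sup>2 \<le> \<tau>"
      proof (cases "snd z \<ge> 0")
        case True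
        then have "(snd z)\<^sup>2 \<le> T2\<^sup>2" using z by (intro power_mono) auto
        then show ?thesis by (simp add: \<tau>_def)
      next
        case False
        then have "(- snd z)\<^sup>2 \<le> (- s)\<^sup>2" using z by (intro power_mono) auto
        then show ?thesis by (simp add: \<tau>_def)
      qed
      ultimately show "exp (- ?r\<^sup>2) \<le> exp \<tau> * exp (- (norm z)\<^sup>2)"
        by (simp add: exp_add[symmetric])
    qed simp
    also have "\<dots> = gs z"
      by (simp add: gs_def N_def)
    finally show ?thesis .
  qed
  show thesis
  proof (rule that[of "(4 * c + 3) * (\<integral>z. gs z \<partial>lborel)"])
    show "(4 * c + 3) * (\<integral>z. gs z \<partial>lborel) \<ge> 0"
      using c0 gs0 by (intro mult_nonneg_nonneg Bochner_Integration.integral_nonneg) auto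
    fix r :: real assume r: "r \<ge> 1"
    obtain \<omega> G H p where \<omega>: "cutoff \<omega> G H p C"
      and supp: "\<And>z. \<omega> z \<noteq> 0 \<Longrightarrow> R0 \<le> fst z \<bullet> e \<and> snd z \<le> T2 \<and> norm (fst z) \<le> 2 * r"
      and flat: "\<And>z. R1 \<le> fst z \<bullet> e \<Longrightarrow> snd z \<le> T1 \<Longrightarrow> norm (fst z) \<le> r \<Longrightarrow> \<omega> z = 1"
      using cut[OF r] unfolding halfspace_cutoff_def by blast
    have \<omega>21: "C21 UNIV \<omega> G H p"
      and \<omega>b: "0 \<le> \<omega> z" "\<omega> z \<le> 1" "norm (G z) \<le> C" "\<bar>p z + lap H z\<bar> \<le> C" for z
      using \<omega> unfolding cutoff_def by blast+
    define g where "g z = E z * \<omega> z" for z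
    define Gg where "Gg z = E z *\<^sub>R G z + \<omega> z *\<^sub>R (E z *\<^sub>R (- m *\<^sub>R (2 *\<^sub>R fst z)))" for z
    define Hg where "Hg b z = E z * H b z + 2 * (E z *\<^sub>R (- m *\<^sub>R (2 *\<^sub>R fst z)) \<bullet> b) * (G z \<bullet> b)
        + \<omega> z * (E z * (- m * 2) + E z * (- m *\<^sub>R (2 *\<^sub>R fst z) \<bullet> b)\<^sup>2)" for b z
    define pg where "pg z = E z * p z + \<omega> z * (E z * (- m * 0))" for z
    have g: "C21 UNIV g Gg Hg pg"
      unfolding g_def[abs_def] Gg_def[abs_def] Hg_def[abs_def] pg_def[abs_def]
      by (rule C21_mult[OF E \<omega>21])
    define S where "S = {z::'a \<times> real. R0 \<le> fst z \<bullet> e \<and> snd z \<le> T2}"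
    have S: "closed S" "S \<subseteq> U"
      unfolding S_def by (rule closed_halfspace_time, rule halfspace_time_subset[OF e R0(1) T2(2)])
    have gS: "g z = 0" if "z \<notin> S" for z
      using supp[of z] that by (auto simp: g_def S_def)
    define v where "v z = g z * u z" for z
    define Gv where "Gv z = g z *\<^sub>R Gu z + u z *\<^sub>R Gg z" for z
    define Hv where "Hv b z = g z * Hu b z + 2 * (Gg z \<bullet> b) * (Gu z \<bullet> b) + u z * Hg b z" for b z
    define pv where "pv z = g z * pu z + u z * pg z" for z
    have v: "C21 UNIV v Gv Hv pv"
      unfolding v_def[abs_def] Gv_def[abs_def] Hv_def[abs_def] pv_def[abs_def]
      by (rule C21_localize[OF g uU open_U S gS])
    define K where "K = slab e R0 s T2 (2 * r)"
    have K: "compact K" "K \<subseteq> U"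
      unfolding K_def using compact_slab S by (auto simp: slab_def S_def)
    have vK: "v z = 0" if "z \<notin> K" for z
    proof (cases "\<omega> z = 0")
      case False
      then have "z \<in> S" "snd z \<le> s"
        using supp[of z] that by (auto simp: S_def K_def slab_def)
      then have "u z = 0"
        using s S by (auto simp: vanishes_until_def)
      then show ?thesis by (simp add: v_def)
    qed (simp add: v_def g_def)
    have "Cc v"
    proof -
      obtain \<rho> where "\<And>z. z \<in> K \<Longrightarrow> norm z \<le> \<rho>"
        using compact_imp_bounded[OF K(1)] unfolding bounded_iff by blast
      then show ?thesis
        unfolding Cc_def using vK C21D(1)[OF v] by (meson not_le)
    qed
    define Lv where "Lv z = (lap Hv z)" for z
    define F where "F z = v z * (pv z + Lv z) + (norm (Gv z))\<^sup>2" for z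
    have "zero_mean (\<lambda>z. (1 * v z * Lv z + 1 * (norm (Gv z))\<^sup>2) + v z * pv z)"
    proof (rule zero_mean_add)
      show "zero_mean (\<lambda>z. 1 * v z * Lv z + 1 * (norm (Gv z))\<^sup>2)"
        unfolding Lv_def using zero_mean_laplacian[OF v \<open>Cc v\<close>, of "\<lambda>_. 1"] by (simp add: continuous_on_const)
      have "zero_mean (\<lambda>z. v z * pv z + pv z * v z)"
        by (rule zero_mean_dir_deriv[of "\<lambda>z. v z * v z"])
          (rule Cc_mult_left[OF \<open>Cc v\<close> C21D(1)[OF v]], rule dir_deriv_mult[OF C21D(5)[OF v UNIV_I] C21D(5)[OF v UNIV_I]],
            intro continuous_intros C21D[OF v])
      from zero_mean_cmult[OF this, of "1/2"]
      show "zero_mean (\<lambda>z. v z * pv z)"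
        by (simp add: mult.commute)
    qed
    then have F: "zero_mean F"
      by (simp add: F_def[abs_def] algebra_simps)
    have out: "Gv z = 0" if "z \<notin> K" for z
      using C21_outside(1)[OF v, of "- K" z] vK that compact_imp_closed[OF K(1)] by (simp add: open_Compl)
    have key: "(norm (Gv z))\<^sup>2 / 2 \<le> F z + c * gs z \<and> \<bar>g z\<bar> * norm (Gu z) \<le> norm (Gv z) + \<bar>u z\<bar> * E z * \<beta> z
        \<and> 1 \<le> \<beta> z" if True: "z \<in> K" for z
    proof -
      let ?x = "norm (fst z)"
      define A where "A = \<bar>u z\<bar> * E z * \<beta> z"
      have Ep: "E z > 0"
        by (simp add: E_def)
      have zU: "z \<in> U" and zt: "s \<le> snd z" "snd z \<le> T2"
        using True K by (auto simp: K_def slab_def)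
      have b1: "1 \<le> \<beta> z" and b2: "V * ?x \<le> \<beta> z" and b3: "C + 2 * m * ?x \<le> \<beta> z"
        and b4: "C + 4 * m * ?x * C + (2 * m * n + 4 * m\<^sup>2 * ?x\<^sup>2) \<le> \<beta> z"
      proof -
        have p: "0 \<le> ?x" "0 \<le> ?x\<^sup>2" "0 \<le> C" "0 \<le> m" "0 \<le> m\<^sup>2" "0 \<le> m * n" "0 \<le> V" "0 \<le> m * C"
          using C m n V by auto
        have "\<beta> z = B + 2 * (B * ?x) + B * ?x\<^sup>2"
          by (simp add: \<beta>_def power2_eq_square algebra_simps)
        moreover have "B * ?x \<ge> V * ?x" "B * ?x \<ge> 2 * m * ?x" "B * ?x \<ge> 4 * m * C * ?x" "B * ?x\<^sup>2 \<ge> 4 * m\<^sup>2 * ?x\<^sup>2"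
          "B \<ge> 1" "B \<ge> C" "B \<ge> C + 2 * m * n" "B * ?x \<ge> 0" "B * ?x\<^sup>2 \<ge> 0"
          using p by (auto simp: B_def intro!: mult_right_mono mult_nonneg_nonneg add_nonneg_nonneg)
        ultimately show "1 \<le> \<beta> z" "V * ?x \<le> \<beta> z" "C + 2 * m * ?x \<le> \<beta> z"
          "C + 4 * m * ?x * C + (2 * m * n + 4 * m\<^sup>2 * ?x\<^sup>2) \<le> \<beta> z"
          by (simp_all add: mult.commute mult.left_commute; linarith)+
      qed
      have gE: "\<bar>g z\<bar> \<le> E z"
        using \<omega>b[of z] Ep by (simp add: g_def abs_mult)
      have GgE: "norm (Gg z) \<le> E z * \<beta> z"
      proof -
        have "norm (Gg z) \<le> E z * norm (G z) + \<omega> z * (E z * (m * (2 * ?x)))"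
          unfolding Gg_def using \<omega>b[of z] Ep m
          by (intro order_trans[OF norm_triangle_ineq]) (simp add: abs_mult)
        also have "\<dots> \<le> E z * C + 1 * (E z * (m * (2 * ?x)))"
          using \<omega>b[of z] Ep m by (intro add_mono mult_left_mono mult_right_mono) auto
        also have "\<dots> = E z * (C + 2 * m * ?x)"
          by (simp add: algebra_simps)
        also have "\<dots> \<le> E z * \<beta> z"
          using Ep b3 by (intro mult_left_mono) auto
        finally show ?thesis .
      qed
      have LgE: "\<bar>pg z + lap Hg z\<bar> \<le> E z * \<beta> z"
      proof -
        have "(lap Hg z) = E z * (lap H z)
            + (- 4 * m * E z) * (\<Sum>b\<in>Basis. (fst z \<bullet> b) * (G z \<bullet> b))
            + (\<Sum>b\<in>(Basis::'a set). - 2 * m * \<omega> z * E z) + (4 * m\<^sup>2 * \<omega> z * E z) * (\<Sum>b\<in>Basis. (fst z \<bullet> b)\<^sup>2)"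
          unfolding Hg_def sum_distrib_left sum.distrib[symmetric]
          by (intro sum.cong) (simp_all add: algebra_simps power2_eq_square)
        then have "pg z + lap Hg z = E z * ((p z + lap H z) - 4 * m * (fst z \<bullet> G z)
            + \<omega> z * (4 * m\<^sup>2 * ?x\<^sup>2 - 2 * m * n))"
          unfolding norm2_Basis[symmetric] euclidean_inner[symmetric] by (simp add: pg_def n_def algebra_simps)
        also have "\<bar>\<dots>\<bar> = E z * \<bar>(p z + lap H z) - 4 * m * (fst z \<bullet> G z)
            + \<omega> z * (4 * m\<^sup>2 * ?x\<^sup>2 - 2 * m * n)\<bar>"
          using Ep by (simp add: abs_mult)
        also have "\<dots> \<le> E z * \<beta> z"
        proof (intro mult_left_mono)
          have "\<bar>fst z \<bullet> G z\<bar> \<le> ?x * C"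
            by (rule order_trans[OF Cauchy_Schwarz_ineq2]) (use \<omega>b[of z] in \<open>auto intro: mult_left_mono\<close>)
          then have "\<bar>4 * m * (fst z \<bullet> G z)\<bar> \<le> 4 * m * (?x * C)"
            using m by (simp add: abs_mult)
          moreover have "\<bar>\<omega> z * (4 * m\<^sup>2 * ?x\<^sup>2 - 2 * m * n)\<bar> \<le> 1 * (2 * m * n + 4 * m\<^sup>2 * ?x\<^sup>2)"
          proof -
            have "0 \<le> 2 * m * n" "0 \<le> 4 * m\<^sup>2 * ?x\<^sup>2" using m n by auto
            then have "\<bar>4 * m\<^sup>2 * ?x\<^sup>2 - 2 * m * n\<bar> \<le> 2 * m * n + 4 * m\<^sup>2 * ?x\<^sup>2"
              by linarith
            then show ?thesis
              unfolding abs_mult[of "\<omega> z"] using \<omega>b[of z] by (intro mult_mono) auto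
          qed
          ultimately show "\<bar>(p z + lap H z) - 4 * m * (fst z \<bullet> G z)
            + \<omega> z * (4 * m\<^sup>2 * ?x\<^sup>2 - 2 * m * n)\<bar> \<le> \<beta> z"
            using b4 \<omega>b(4)[of z] by (simp add: mult.assoc)
        qed (use Ep in simp)
        finally show ?thesis .
      qed
      have A0: "0 \<le> A"
        using b1 Ep by (simp add: A_def)
      have vA: "\<bar>v z\<bar> \<le> A"
      proof -
        have "\<bar>v z\<bar> \<le> E z * \<bar>u z\<bar> * 1"
          using gE by (simp add: v_def abs_mult mult_right_mono)
        also have "\<dots> \<le> E z * \<bar>u z\<bar> * \<beta> z"
          using b1 Ep by (intro mult_left_mono) auto
        finally show ?thesis by (simp add: A_def mult.commute)
      qed
      have VA: "V * ?x * \<bar>v z\<bar> \<le> A"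
      proof -
        have "V * ?x * \<bar>v z\<bar> \<le> \<beta> z * (E z * \<bar>u z\<bar>)"
          using gE b2 b1 Ep V by (intro mult_mono) (auto simp: v_def abs_mult mult_right_mono)
        then show ?thesis by (simp add: A_def mult.commute mult.left_commute)
      qed
      have uG: "\<bar>u z\<bar> * norm (Gg z) \<le> A"
        using mult_left_mono[OF GgE, of "\<bar>u z\<bar>"] by (simp add: A_def mult.assoc)
      have uL: "\<bar>u z\<bar> * \<bar>pg z + lap Hg z\<bar> \<le> A"
        using mult_left_mono[OF LgE, of "\<bar>u z\<bar>"] by (simp add: A_def mult.assoc)
      have gGu: "g z *\<^sub>R Gu z = Gv z - u z *\<^sub>R Gg z"
        by (simp add: Gv_def)
      have ngGu: "\<bar>g z\<bar> * norm (Gu z) \<le> norm (Gv z) + A"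
        using norm_triangle_ineq4[of "Gv z" "u z *\<^sub>R Gg z"] uG unfolding gGu[symmetric] by simp
      have "pv z + Lv z = g z * (pu z + lap Hu z) + u z * (pg z + lap Hg z)
        + 2 * (Gg z \<bullet> Gu z)"
        unfolding Lv_def pv_def Hv_def euclidean_inner[of "Gg z" "Gu z"]
        by (simp add: sum.distrib sum_distrib_left distrib_left mult.assoc)
      then have "v z * (pv z + Lv z) = v z * (g z * (pu z + lap Hu z))
          + v z * (u z * (pg z + lap Hg z)) + 2 * (u z * (Gg z \<bullet> (g z *\<^sub>R Gu z)))"
        by (simp add: v_def algebra_simps)
      moreover have "\<bar>v z * (g z * (pu z + lap Hu z))\<bar> \<le> A * (M * (norm (Gv z) + A) + A)"
        unfolding abs_mult[of "v z"]
      proof (rule mult_mono[OF vA])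
        have "\<bar>g z * (pu z + lap Hu z)\<bar> \<le> \<bar>g z\<bar> * (M * norm (Gu z) + V * ?x * \<bar>u z\<bar>)"
          using pde[of z] zU by (auto simp: abs_mult U_def intro: mult_left_mono)
        also have "\<dots> = M * (\<bar>g z\<bar> * norm (Gu z)) + V * ?x * \<bar>v z\<bar>"
          by (simp add: v_def abs_mult algebra_simps)
        also have "\<dots> \<le> M * (norm (Gv z) + A) + A"
          using ngGu VA M by (intro add_mono mult_left_mono) auto
        finally show "\<bar>g z * (pu z + lap Hu z)\<bar> \<le> M * (norm (Gv z) + A) + A" .
      qed (use A0 in auto)
      moreover have "\<bar>v z * (u z * (pg z + lap Hg z))\<bar> \<le> A * A"
        unfolding abs_mult[of "v z"] using A0 uL by (intro mult_mono[OF vA]) (auto simp: abs_mult)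
      moreover have "\<bar>u z * (Gg z \<bullet> (g z *\<^sub>R Gu z))\<bar> \<le> A * (norm (Gv z) + A)"
      proof -
        have "\<bar>u z * (Gg z \<bullet> (g z *\<^sub>R Gu z))\<bar> \<le> \<bar>u z\<bar> * (norm (Gg z) * norm (g z *\<^sub>R Gu z))"
          unfolding abs_mult by (intro mult_left_mono Cauchy_Schwarz_ineq2) auto
        also have "\<dots> = (\<bar>u z\<bar> * norm (Gg z)) * (\<bar>g z\<bar> * norm (Gu z))"
          by simp
        also have "\<dots> \<le> A * (norm (Gv z) + A)"
          using uG ngGu A0 by (intro mult_mono) auto
        finally show ?thesis .
      qed
      ultimately have "\<bar>v z * (pv z + Lv z)\<bar> \<le> A * (M * (norm (Gv z) + A) + A) + A * A + 2 * (A * (norm (Gv z) + A))"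
        by linarith
      also have "\<dots> = (M + 2) * A * norm (Gv z) + (M + 4) * A\<^sup>2"
        by (simp add: power2_eq_square algebra_simps)
      also have "\<dots> = (norm (Gv z))\<^sup>2 / 2 + c * A\<^sup>2 - (norm (Gv z) - (M + 2) * A)\<^sup>2 / 2"
        by (simp add: c_def power2_eq_square field_simps)
      also have "\<dots> \<le> (norm (Gv z))\<^sup>2 / 2 + c * A\<^sup>2"
        by simp
      also have "\<dots> \<le> (norm (Gv z))\<^sup>2 / 2 + c * gs z"
        using A_bound[OF zU zt] c0 by (auto simp: A_def intro: mult_left_mono)
      finally have "(norm (Gv z))\<^sup>2 / 2 \<le> F z + c * gs z"
        unfolding F_def by linarith
      then show ?thesis
        using ngGu b1 unfolding A_def by blast
    qed
    have key_outside: "F z = 0" if "z \<notin> K" for z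
      using vK[OF that] out[OF that] by (simp add: F_def)
    let ?I = "\<lambda>z. indicator (slab e R1 s T1 r) z * (exp (- 2 * (M + 1) * (norm (fst z))\<^sup>2) * ((u z)\<^sup>2 + (norm (Gu z))\<^sup>2))"
    have pw: "?I z \<le> 4 * F z + (4 * c + 3) * gs z" for z
    proof (cases "z \<in> slab e R1 s T1 r")
      case False
      have "0 \<le> F z + c * gs z"
      proof (cases "z \<in> K")
        case True
        then have "(norm (Gv z))\<^sup>2 / 2 \<le> F z + c * gs z"
          using key by blast
        then show ?thesis
          using zero_le_power2[of "norm (Gv z)"] by linarith
      next
        case False
        then show ?thesis
          using key_outside gs0[of z] c0 by simp
      qed
      then show ?thesis
        using gs0[of z] False by (simp add: algebra_simps)
    next
      case True
      then have z: "R1 \<le> fst z \<bullet> e" "s \<le> snd z" "snd z \<le> T1" "norm (fst z) \<le> r"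
        by (auto simp: slab_def)
      have zK: "z \<in> K"
        using z R0 T2 r by (auto simp: K_def slab_def)
      have g1: "g z = E z"
        using flat z by (auto simp: g_def)
      have zt: "z \<in> U" "snd z \<le> T2"
        using z T2 zK K by auto
      define A where "A = \<bar>u z\<bar> * E z * \<beta> z"
      have AA: "A\<^sup>2 \<le> gs z"
        unfolding A_def by (rule A_bound[OF zt(1) z(2) zt(2)])
      have Ep: "E z > 0"
        by (simp add: E_def)
      note kz = key[OF zK, folded A_def]
      have "E z * \<bar>u z\<bar> \<le> A"
        using kz Ep mult_left_mono[of 1 "\<beta> z" "\<bar>u z\<bar> * E z"] by (simp add: A_def mult.commute)
      then have "(E z * \<bar>u z\<bar>)\<^sup>2 \<le> A\<^sup>2"
        using Ep by (intro power_mono) auto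
      then have 1: "(E z)\<^sup>2 * (u z)\<^sup>2 \<le> A\<^sup>2"
        by (simp add: power_mult_distrib)
      have "(E z * norm (Gu z))\<^sup>2 \<le> (norm (Gv z) + A)\<^sup>2"
        using kz Ep by (intro power_mono) (auto simp: g1)
      also have "\<dots> \<le> 2 * (norm (Gv z))\<^sup>2 + 2 * A\<^sup>2"
        using zero_le_power2[of "norm (Gv z) - A"] by (simp add: power2_eq_square algebra_simps)
      finally have 2: "(E z)\<^sup>2 * (norm (Gu z))\<^sup>2 \<le> 2 * (norm (Gv z))\<^sup>2 + 2 * A\<^sup>2"
        by (simp add: power_mult_distrib)
      have E2: "(E z)\<^sup>2 = exp (- 2 * (M + 1) * (norm (fst z))\<^sup>2)"
        by (simp add: E_def m_def exp_double[symmetric] algebra_simps)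
      have "(E z)\<^sup>2 * ((u z)\<^sup>2 + (norm (Gu z))\<^sup>2) \<le> 2 * (norm (Gv z))\<^sup>2 + 3 * A\<^sup>2"
        using 1 2 by (simp add: distrib_left)
      also have "\<dots> \<le> 4 * F z + (4 * c + 3) * gs z"
        using kz AA by (simp add: distrib_right)
      finally show ?thesis
        using True by (simp add: E2)
    qed
    have "(\<integral>z. ?I z \<partial>lborel) \<le> (\<integral>z. 4 * F z + (4 * c + 3) * gs z \<partial>lborel)"
    proof (rule integral_mono)
      have "slab e R1 s T1 r \<subseteq> U"
        by (rule slab_subset[OF e R1 T1])
      then have "continuous_on (slab e R1 s T1 r) (\<lambda>z. exp (- 2 * (M + 1) * (norm (fst z))\<^sup>2) * ((u z)\<^sup>2 + (norm (Gu z))\<^sup>2))"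
        by (intro continuous_intros continuous_on_subset[OF C21D(1)[OF uU]] continuous_on_subset[OF C21D(2)[OF uU]])
      from borel_integrable_compact[OF compact_slab this]
      show "integrable lborel ?I"
        by simp
      show "integrable lborel (\<lambda>z. 4 * F z + (4 * c + 3) * gs z)"
        using F gs by (auto simp: zero_mean_def Cc_integrable)
    qed (rule pw)
    then show "(\<integral>z. ?I z \<partial>lborel) \<le> (4 * c + 3) * (\<integral>z. gs z \<partial>lborel)"
      using F gs by (simp add: zero_mean_def Cc_integrable)
  qed
qed

end

section \<open>Vanishing from a family of Carleman weights\<close>

lemma quadratic_weight_cubic:
  "quadratic_weight (\<lambda>t. \<alpha> * max 0 (T' - t) ^ 3) (\<lambda>t. - 3 * \<alpha> * (max 0 (T' - t))\<^sup>2) (\<lambda>t. 6 * \<alpha> * max 0 (T' - t))"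
proof
  have d: "((\<lambda>t. T' - t) has_real_derivative -1) (at t)" for t :: real
    by (auto intro!: derivative_eq_intros)
  show "((\<lambda>t. \<alpha> * max 0 (T' - t) ^ 3) has_real_derivative - 3 * \<alpha> * (max 0 (T' - t))\<^sup>2) (at t)" for t
    using DERIV_cmult[OF DERIV_chain2[OF DERIV_pos_part_cube d]] by (rule DERIV_cong) simp
  show "((\<lambda>t. - 3 * \<alpha> * (max 0 (T' - t))\<^sup>2) has_real_derivative 6 * \<alpha> * max 0 (T' - t)) (at t)" for t
    using DERIV_cmult[OF DERIV_chain2[OF DERIV_pos_part_square d]] by (rule DERIV_cong) simp
  show "continuous_on UNIV (\<lambda>t. 6 * \<alpha> * max 0 (T' - t))"
    by (intro continuous_intros)
qed

context backward_solution
begin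

text \<open>
  Suppose that \<open>u\<close> is not zero at \<open>z0\<close>. By continuity \<open>|u| \<ge> c\<close> on a ball around \<open>z0\<close>, where
  \<open>a(t) (x \<bullet> e - b0) \<ge> (3/2) \<alpha> \<psi> q\<close> with \<open>\<psi> = (T' - s)\<^sup>3\<close> and \<open>q = R2 - b0\<close>. Where the cutoff is not
  constant, one of three things happens: \<open>x \<bullet> e \<le> R2\<close>, and then \<open>a(t) (x \<bullet> e - b0) \<le> \<alpha> \<psi> q\<close>; or
  \<open>t \<ge> T'\<close>, and then \<open>a(t) = 0\<close>; or \<open>|x| \<ge> r\<close>, and then the spare Gaussian factor \<open>exp(2\<gamma>|x|\<^sup>2)\<close> in the
  assumption on \<open>D\<close> dominates, provided that \<open>r\<close> is large compared with \<open>\<alpha>\<close>. The Carleman inequality compares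
  \<open>exp(3 \<alpha> \<psi> q)\<close> with \<open>exp(2 \<alpha> \<psi> q)\<close>, which is absurd for large \<open>\<alpha>\<close>.
\<close>

lemma carleman_vanishing:
  fixes k0 k1 l b0 \<gamma> D s T' T1 R1 R2 :: real and e :: 'a
  defines "a \<equiv> \<lambda>\<alpha> t. \<alpha> * max 0 (T' - t) ^ 3"
    and "a1 \<equiv> \<lambda>\<alpha> t. - 3 * \<alpha> * (max 0 (T' - t))\<^sup>2"
    and "a2 \<equiv> \<lambda>\<alpha> t. 6 * \<alpha> * max 0 (T' - t)"
  assumes e: "norm e = 1" and R1: "R < R1" "R1 < R2" and b0: "0 \<le> b0" "b0 \<le> R1"
    and T: "s < T'" "T' < T1" "T1 < T" and s: "vanishes_until s" and l: "0 \<le> l" and \<gamma>: "0 < \<gamma>"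
    and grad: "\<And>z. R1 \<le> fst z \<bullet> e \<Longrightarrow> s \<le> snd z \<Longrightarrow> snd z \<le> T1 \<Longrightarrow>
      3 * M\<^sup>2 \<le> 8 * quadratic_weight.\<kappa> k0 k1 (snd z) + l"
    and pot: "\<And>\<alpha> z. 1 \<le> \<alpha> \<Longrightarrow> R1 \<le> fst z \<bullet> e \<Longrightarrow> s \<le> snd z \<Longrightarrow> snd z \<le> T1 \<Longrightarrow>
      3 * (M * norm (quadratic_weight.W k0 k1 e (a \<alpha>) z) + V * norm (fst z))\<^sup>2 + 1 \<le>
        quadratic_weight.Q k0 k1 l b0 e (a \<alpha>) (a1 \<alpha>) (a2 \<alpha>) z"
    and D: "\<And>r. r \<ge> 1 \<Longrightarrow> (\<integral>z. indicator (slab e R1 s T1 r) z *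
      (exp ((2 * quadratic_weight.\<kappa> k0 k1 (snd z) + 2 * \<gamma>) * (norm (fst z))\<^sup>2) * ((u z)\<^sup>2 + (norm (Gu z))\<^sup>2)) \<partial>lborel) \<le> D"
    and z0: "z0 \<in> U" "snd z0 < s + (T' - s) / 12" "2 * (R2 - b0) < fst z0 \<bullet> e - b0"
  shows "u z0 = 0"
proof (rule ccontr)
  assume nz: "u z0 \<noteq> 0"
  have qw: "quadratic_weight (a \<alpha>) (a1 \<alpha>) (a2 \<alpha>)" for \<alpha>
    unfolding a_def a1_def a2_def by (rule quadratic_weight_cubic)
  define kap where "kap t = k0 + k1 * t" for t
  have kap: "quadratic_weight.\<kappa> k0 k1 = kap"
    using quadratic_weight.\<kappa>_def[OF qw] by (auto simp: kap_def)
  define q where "q = R2 - b0"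
  define \<psi> where "\<psi> = (T' - s) ^ 3"
  have q: "q > 0" and \<psi>: "\<psi> > 0"
    using R1 b0 T by (auto simp: q_def \<psi>_def)
  define O1 where "O1 = {z. z \<in> U \<and> s < snd z \<and> snd z < s + (T' - s) / 12 \<and> 2 * q < fst z \<bullet> e - b0}"
  have "open O1"
    unfolding O1_def by (intro open_Collect_conj open_Collect_less continuous_intros) (simp add: open_U)
  moreover have "z0 \<in> O1"
    using z0 nz s by (auto simp: O1_def q_def vanishes_until_def not_le[symmetric])
  ultimately obtain d1 where d1: "d1 > 0" "ball z0 d1 \<subseteq> O1"
    by (meson open_contains_ball)
  have "isCont u z0"
    using C21D(1)[OF uU] z0(1) open_U by (simp add: continuous_on_eq_continuous_at)
  then obtain d2 where d2: "d2 > 0" "\<And>z. dist z z0 < d2 \<Longrightarrow> dist (u z) (u z0) < \<bar>u z0\<bar> / 2"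
    using nz unfolding continuous_at_eps_delta by (metis half_gt_zero zero_less_abs_iff)
  define d where "d = min d1 d2"
  define c where "c = \<bar>u z0\<bar> / 2"
  have c: "c > 0" and d: "d > 0"
    using nz d1 d2 by (auto simp: c_def d_def)
  have inO: "z \<in> O1" and uc: "c \<le> \<bar>u z\<bar>" if "z \<in> ball z0 d" for z
  proof -
    show "z \<in> O1"
      using that d1(2) by (auto simp: d_def)
    have "dist (u z) (u z0) < \<bar>u z0\<bar> / 2"
      using that by (intro d2(2)) (auto simp: d_def dist_commute)
    then show "c \<le> \<bar>u z\<bar>"
      unfolding c_def dist_real_def by linarith
  qed
  obtain B where B: "\<And>z::'a \<times> real. norm z \<le> norm z0 + d \<Longrightarrow> \<bar>kap (snd z) * (norm (fst z))\<^sup>2 + l / 2 * snd z\<bar> \<le> B"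
  proof -
    have "continuous_on UNIV (\<lambda>z::'a \<times> real. kap (snd z) * (norm (fst z))\<^sup>2 + l / 2 * snd z)"
      unfolding kap_def by (intro continuous_intros)
    then show thesis
      using continuous_bounded_cball that by blast
  qed
  have nb: "norm z \<le> norm z0 + d" if "z \<in> ball z0 d" for z
    using that norm_triangle_ineq2[of z z0] by (simp add: dist_norm norm_minus_commute)
  obtain C where C: "C \<ge> 0" and cut: "\<And>r. r \<ge> 1 \<Longrightarrow> \<exists>\<omega> G H p. halfspace_cutoff e R1 R2 T' T1 r C \<omega> G H p"
    using cutoff_exists[OF e R1(2) T(2)] by blast
  define N where "N = 6 * exp (l * T1) * (C * (2 + M))\<^sup>2"
  have N: "N \<ge> 0"
    by (simp add: N_def)
  define c1 where "c1 = measure lborel (ball z0 d) * (exp (- 2 * B) * c\<^sup>2)"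
  have c1: "c1 > 0"
    using d c content_ball_pos[of d z0] by (simp add: c1_def)
  have main: "c1 * exp (\<alpha> * \<psi> * q) \<le> 3 * N * D" if \<alpha>: "\<alpha> \<ge> 1" for \<alpha>
  proof -
    interpret quadratic_weight k0 k1 l b0 e "a \<alpha>" "a1 \<alpha>" "a2 \<alpha>"
      by (rule qw)
    define r where "r = max 1 (max (norm z0 + d) (\<alpha> * \<psi> / \<gamma>))"
    have r: "r \<ge> 1" "norm z0 + d \<le> r" "\<alpha> * \<psi> \<le> \<gamma> * r"
    proof -
      show "r \<ge> 1" "norm z0 + d \<le> r"
        by (auto simp: r_def)
      have "\<alpha> * \<psi> / \<gamma> \<le> r"
        by (auto simp: r_def)
      then show "\<alpha> * \<psi> \<le> \<gamma> * r"
        using \<gamma> by (simp add: divide_le_eq mult.commute)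
    qed
    obtain \<omega> G H p where \<omega>: "cutoff \<omega> G H p C"
      and supp: "\<And>z. \<omega> z \<noteq> 0 \<Longrightarrow> R1 \<le> fst z \<bullet> e \<and> snd z \<le> T1 \<and> norm (fst z) \<le> 2 * r"
      and flat: "\<And>z. R2 \<le> fst z \<bullet> e \<Longrightarrow> snd z \<le> T' \<Longrightarrow> norm (fst z) \<le> r \<Longrightarrow>
        \<omega> z = 1 \<and> G z = 0 \<and> p z + lap H z = 0"
      using cut[OF r(1)] unfolding halfspace_cutoff_def by blast
    have \<omega>21: "C21 UNIV \<omega> G H p"
      and \<omega>b: "0 \<le> \<omega> z" "\<omega> z \<le> 1" "norm (G z) \<le> C" "\<bar>p z + lap H z\<bar> \<le> C" for z
      using \<omega> unfolding cutoff_def by blast+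
    define S where "S = {z::'a \<times> real. R1 \<le> fst z \<bullet> e \<and> snd z \<le> T1}"
    have S: "closed S" "S \<subseteq> U"
      unfolding S_def by (rule closed_halfspace_time, rule halfspace_time_subset[OF e R1(1) T(3)])
    define K where "K = slab e R1 s T1 (2 * r)"
    have KS: "z \<in> S" if "z \<in> K" for z
      using that by (auto simp: K_def S_def slab_def)
    have Kc: "compact K"
      unfolding K_def by (rule compact_slab)
    define g where "g z = exp ((2 * kap (snd z) + 2 * \<gamma>) * (norm (fst z))\<^sup>2) * ((u z)\<^sup>2 + (norm (Gu z))\<^sup>2)" for z
    define Z where "Z = N * (exp (2 * \<alpha> * \<psi> * q) + 2)"
    define F where "F z = Z * (indicator K z * g z)" for z
    have g0: "g z \<ge> 0" for z
      by (simp add: g_def)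
    have Z0: "Z \<ge> 0"
      using N by (simp add: Z_def add_nonneg_nonneg)
    have "continuous_on K g"
      unfolding g_def kap_def using S KS
      by (intro continuous_intros continuous_on_subset[OF C21D(1)[OF uU]] continuous_on_subset[OF C21D(2)[OF uU]]) auto
    from borel_integrable_compact[OF Kc this]
    have F_int: "integrable lborel F"
      unfolding F_def by (intro integrable_mult_right) simp
    have IF: "(\<integral>z. F z \<partial>lborel) \<le> Z * D"
      unfolding F_def integral_mult_right_zero
      using D[of "2 * r"] r Z0 unfolding K_def g_def kap by (intro mult_left_mono) auto
    have a_range: "0 \<le> a \<alpha> (snd z)" "a \<alpha> (snd z) \<le> \<alpha> * \<psi>" if "s \<le> snd z" for z :: "'a \<times> real"
    proof -
      show "0 \<le> a \<alpha> (snd z)"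
        using \<alpha> by (simp add: a_def)
      have "max 0 (T' - snd z) ^ 3 \<le> \<psi>"
        unfolding \<psi>_def using that T by (intro power_mono) auto
      then show "a \<alpha> (snd z) \<le> \<alpha> * \<psi>"
        using \<alpha> by (simp add: a_def)
    qed
    have weight2: "(weight z)\<^sup>2 = exp (2 * kap (snd z) * (norm (fst z))\<^sup>2) * exp (2 * (a \<alpha> (snd z) * (fst z \<bullet> e - b0)))
        * exp (l * snd z)" for z
      unfolding weight_def kap by (simp add: exp_double[symmetric] exp_add[symmetric] algebra_simps)
    let ?err = "\<lambda>z. \<bar>u z\<bar> * (\<bar>p z + lap H z\<bar> + M * norm (G z)) + 2 * norm (G z) * norm (Gu z)"
    have err: "3 * (weight z)\<^sup>2 * (?err z)\<^sup>2 \<le> F z" if zK: "z \<in> K" for z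
    proof (cases "R2 \<le> fst z \<bullet> e \<and> snd z \<le> T' \<and> norm (fst z) \<le> r")
      case True
      then show ?thesis
        using flat[of z] Z0 g0[of z] by (simp add: F_def)
    next
      case False
      have z: "R1 \<le> fst z \<bullet> e" "s \<le> snd z" "snd z \<le> T1"
        using zK by (auto simp: K_def slab_def)
      have xb: "0 \<le> fst z \<bullet> e - b0" "fst z \<bullet> e - b0 \<le> norm (fst z)"
        using z b0 inner_unit_le[OF e, of "fst z"] by auto
      let ?w = "exp (2 * kap (snd z) * (norm (fst z))\<^sup>2)
          * ((exp (2 * \<alpha> * \<psi> * q) + 2) * exp (2 * \<gamma> * (norm (fst z))\<^sup>2)) * exp (l * T1)"
      have "?err z \<le> \<bar>u z\<bar> * (C + M * C) + 2 * C * norm (Gu z)"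
        using \<omega>b[of z] M by (intro add_mono mult_left_mono mult_right_mono) auto
      also have "\<dots> \<le> C * (2 + M) * (\<bar>u z\<bar> + norm (Gu z))"
      proof -
        have "0 \<le> C * \<bar>u z\<bar>" "0 \<le> C * M * norm (Gu z)"
          using C M by auto
        then show ?thesis by (simp add: algebra_simps)
      qed
      finally have "(?err z)\<^sup>2
          \<le> (C * (2 + M) * (\<bar>u z\<bar> + norm (Gu z)))\<^sup>2"
        using M by (intro power_mono) auto
      also have "\<dots> = (C * (2 + M))\<^sup>2 * (\<bar>u z\<bar> + norm (Gu z))\<^sup>2"
        by (rule power_mult_distrib)
      also have "\<dots> \<le> (C * (2 + M))\<^sup>2 * (2 * ((u z)\<^sup>2 + (norm (Gu z))\<^sup>2))"
      proof (intro mult_left_mono)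
        show "(\<bar>u z\<bar> + norm (Gu z))\<^sup>2 \<le> 2 * ((u z)\<^sup>2 + (norm (Gu z))\<^sup>2)"
          using zero_le_power2[of "\<bar>u z\<bar> - norm (Gu z)"] by (simp add: power2_sum power2_diff)
      qed simp
      finally have e1: "(?err z)\<^sup>2
          \<le> (C * (2 + M))\<^sup>2 * (2 * ((u z)\<^sup>2 + (norm (Gu z))\<^sup>2))" .
      have "2 * (a \<alpha> (snd z) * (fst z \<bullet> e - b0)) \<le> 2 * \<alpha> * \<psi> * q + 2 * \<gamma> * (norm (fst z))\<^sup>2"
      proof -
        have nn: "0 \<le> 2 * \<alpha> * \<psi> * q" "0 \<le> 2 * \<gamma> * (norm (fst z))\<^sup>2"
          using \<alpha> \<psi> q \<gamma> by auto
        consider "fst z \<bullet> e < R2" | "T' < snd z" | "r < norm (fst z)"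
          using False by linarith
        then show ?thesis
        proof cases
          case 1
          have "a \<alpha> (snd z) * (fst z \<bullet> e - b0) \<le> (\<alpha> * \<psi>) * q"
            using 1 xb a_range[OF z(2)] \<alpha> \<psi> by (intro mult_mono) (auto simp: q_def)
          then show ?thesis using nn by linarith
        next
          case 2
          then have "a \<alpha> (snd z) = 0" by (simp add: a_def)
          then show ?thesis using nn by simp
        next
          case 3
          have "a \<alpha> (snd z) * (fst z \<bullet> e - b0) \<le> (\<alpha> * \<psi>) * norm (fst z)"
            using xb a_range[OF z(2)] \<alpha> \<psi> by (intro mult_mono) auto
          also have "\<dots> \<le> (\<gamma> * norm (fst z)) * norm (fst z)"
          proof (intro mult_right_mono)
            have "\<gamma> * r \<le> \<gamma> * norm (fst z)"
              using 3 \<gamma> by (intro mult_left_mono) auto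
            then show "\<alpha> * \<psi> \<le> \<gamma> * norm (fst z)"
              using r(3) by linarith
          qed simp
          finally have "a \<alpha> (snd z) * (fst z \<bullet> e - b0) \<le> \<gamma> * (norm (fst z))\<^sup>2"
            by (simp add: power2_eq_square mult.assoc)
          then show ?thesis using nn by linarith
        qed
      qed
      then have "exp (2 * (a \<alpha> (snd z) * (fst z \<bullet> e - b0))) \<le> exp (2 * \<alpha> * \<psi> * q) * exp (2 * \<gamma> * (norm (fst z))\<^sup>2)"
        by (simp add: exp_add[symmetric])
      also have "\<dots> \<le> (exp (2 * \<alpha> * \<psi> * q) + 2) * exp (2 * \<gamma> * (norm (fst z))\<^sup>2)"
        by (intro mult_right_mono) auto
      finally have "(weight z)\<^sup>2 \<le> ?w"
        unfolding weight2 using z l by (intro mult_mono mult_left_mono) (auto intro: mult_left_mono)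
      then have "3 * (weight z)\<^sup>2 \<le> 3 * ?w"
        by simp
      then have "3 * (weight z)\<^sup>2 * (?err z)\<^sup>2 \<le> 3 * ?w
          * ((C * (2 + M))\<^sup>2 * (2 * ((u z)\<^sup>2 + (norm (Gu z))\<^sup>2)))"
        using e1 by (intro mult_mono) (auto intro!: mult_nonneg_nonneg add_nonneg_nonneg)
      also have "\<dots> = Z * ((exp (2 * kap (snd z) * (norm (fst z))\<^sup>2) * exp (2 * \<gamma> * (norm (fst z))\<^sup>2))
          * ((u z)\<^sup>2 + (norm (Gu z))\<^sup>2))"
        unfolding Z_def N_def by (simp add: mult_ac)
      also have "\<dots> = F z"
        using zK unfolding F_def g_def by (simp add: exp_add[symmetric] distrib_right)
      finally show ?thesis .
    qed
    have supp_w: "\<omega> z * u z = 0" if "z \<notin> K" for z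
    proof (cases "\<omega> z = 0")
      case False
      then have "z \<in> S" "snd z \<le> s"
        using supp[of z] that by (auto simp: S_def K_def slab_def)
      then have "u z = 0"
        using s S by (auto simp: vanishes_until_def)
      then show ?thesis by simp
    qed simp
    have zero\<omega>: "\<omega> z = 0" if "z \<notin> S" for z
      using supp[of z] that by (auto simp: S_def)
    have absorbed: "Cc (\<lambda>z. \<omega> z * u z)"
      "(\<integral>z. (weight z * (\<omega> z * u z))\<^sup>2 \<partial>lborel) \<le> (\<integral>z. F z \<partial>lborel)"
    proof (atomize (full), rule conjI)
      have p1: "\<bar>pu z + lap Hu z\<bar> \<le> M * norm (Gu z) + V * norm (fst z) * \<bar>u z\<bar>" if "z \<in> K" for z
        using pde[of z] S KS[OF that] by (auto simp: U_def)
      have p2: "3 * M\<^sup>2 \<le> 8 * quadratic_weight.\<kappa> k0 k1 (snd z) + l" if "z \<in> K" for z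
        using that by (intro grad) (auto simp: K_def slab_def)
      have p3: "3 * (M * norm (W z) + V * norm (fst z))\<^sup>2 + 1 \<le> Q z" if "z \<in> K" for z
        using that by (intro pot \<alpha>) (auto simp: K_def slab_def)
      have p4: "0 \<le> F z" if "z \<notin> K" for z
        using that by (simp add: F_def)
      have p5: "0 \<le> M" "\<And>z. z \<in> K \<Longrightarrow> 0 \<le> V * norm (fst z)"
        using M V by auto
      show "Cc (\<lambda>z. \<omega> z * u z)"
        by (rule carleman_absorbed(1)[OF \<omega>21 uU open_U S, where K = K and M = M and V = "\<lambda>z. V * norm (fst z)" and F = F])
          (fact zero\<omega> \<omega>b(1) Kc supp_w p1 p5 p2 p3 F_int p4 err)+
      show "(\<integral>z. (weight z * (\<omega> z * u z))\<^sup>2 \<partial>lborel) \<le> (\<integral>z. F z \<partial>lborel)"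
        by (rule carleman_absorbed(2)[OF \<omega>21 uU open_U S, where K = K and M = M and V = "\<lambda>z. V * norm (fst z)" and F = F])
          (fact zero\<omega> \<omega>b(1) Kc supp_w p1 p5 p2 p3 F_int p4 err)+
    qed
    have lower: "indicator (ball z0 d) z * (exp (- 2 * B) * c\<^sup>2 * exp (3 * \<alpha> * \<psi> * q)) \<le> (weight z * (\<omega> z * u z))\<^sup>2" for z
    proof (cases "z \<in> ball z0 d")
      case True
      have z: "s < snd z" "snd z < s + (T' - s) / 12" "2 * q < fst z \<bullet> e - b0"
        using inO[OF True] by (auto simp: O1_def)
      have "norm (fst z) \<le> r"
        using nb[OF True] r(2) norm_fst_le[of "fst z" "snd z"] by simp
      moreover have "snd z \<le> T'"
        using z(2) T(1) by (simp add: field_simps)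
      moreover have "R2 \<le> fst z \<bullet> e"
        using z(3) q by (simp add: q_def)
      ultimately have w1: "\<omega> z = 1"
        using flat[of z] by blast
      \<comment> \<open>This is where the fraction \<open>1 / 12\<close> of the time interval comes from.\<close>
      have "3 / 4 * \<psi> \<le> (11 / 12 * (T' - s)) ^ 3"
      proof -
        have "(11 / 12 :: real) ^ 3 = 1331 / 1728"
          by (simp add: power3_eq_cube)
        then show ?thesis
          unfolding power_mult_distrib \<psi>_def[symmetric] using \<psi> by simp
      qed
      also have "\<dots> \<le> max 0 (T' - snd z) ^ 3"
      proof (intro power_mono)
        have "11 / 12 * (T' - s) \<le> T' - snd z"
          using z(2) by (simp add: field_simps)
        then show "11 / 12 * (T' - s) \<le> max 0 (T' - snd z)"
          by (rule order_trans) simp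
        show "0 \<le> 11 / 12 * (T' - s)"
          using T by simp
      qed
      finally have "\<alpha> * (3 / 4 * \<psi>) \<le> a \<alpha> (snd z)"
        using \<alpha> unfolding a_def by (intro mult_left_mono) auto
      then have "\<alpha> * (3 / 4 * \<psi>) * (2 * q) \<le> a \<alpha> (snd z) * (fst z \<bullet> e - b0)"
        using z \<alpha> \<psi> q a_range(1)[of z] by (intro mult_mono) auto
      moreover have "- B \<le> kap (snd z) * (norm (fst z))\<^sup>2 + l / 2 * snd z"
        using B[OF nb[OF True]] by linarith
      ultimately have "- B + \<alpha> * (3 / 4 * \<psi>) * (2 * q) \<le>
          kap (snd z) * (norm (fst z))\<^sup>2 + a \<alpha> (snd z) * (fst z \<bullet> e - b0) + l / 2 * snd z"
        by linarith
      then have "exp (- B + \<alpha> * (3 / 4 * \<psi>) * (2 * q)) \<le> weight z"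
        unfolding weight_def kap by simp
      then have "exp (- B + \<alpha> * (3 / 4 * \<psi>) * (2 * q)) * c \<le> weight z * \<bar>u z\<bar>"
        using uc[OF True] c by (intro mult_mono) (auto simp: weight_def)
      then have "(exp (- B + \<alpha> * (3 / 4 * \<psi>) * (2 * q)) * c)\<^sup>2 \<le> (weight z * \<bar>u z\<bar>)\<^sup>2"
        using c by (intro power_mono) auto
      moreover have "(exp (- B + \<alpha> * (3 / 4 * \<psi>) * (2 * q)))\<^sup>2 = exp (- 2 * B) * exp (3 * \<alpha> * \<psi> * q)"
        by (simp add: exp_double[symmetric] exp_add[symmetric] algebra_simps)
      ultimately show ?thesis
        using True w1 by (simp add: power_mult_distrib mult_ac)
    qed simp
    have "c1 * exp (3 * \<alpha> * \<psi> * q) = (\<integral>z. indicator (ball z0 d) z * (exp (- 2 * B) * c\<^sup>2 * exp (3 * \<alpha> * \<psi> * q)) \<partial>lborel)"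
      by (simp add: c1_def)
    also have "\<dots> \<le> (\<integral>z. (weight z * (\<omega> z * u z))\<^sup>2 \<partial>lborel)"
    proof (rule integral_mono)
      show "integrable lborel (\<lambda>z. indicator (ball z0 d) z * (exp (- 2 * B) * c\<^sup>2 * exp (3 * \<alpha> * \<psi> * q)))"
        using emeasure_lborel_ball_finite[of z0 d] by (intro integrable_mult_left) auto
      show "integrable lborel (\<lambda>z. (weight z * (\<omega> z * u z))\<^sup>2)"
        by (intro Cc_integrable Cc_power2 Cc_mult_left absorbed(1) C21D(1)[OF C21_weight])
    qed (rule lower)
    also have "\<dots> \<le> Z * D"
      using absorbed(2) IF by linarith
    finally have fin: "c1 * exp (3 * \<alpha> * \<psi> * q) \<le> N * D * (exp (2 * \<alpha> * \<psi> * q) + 2)"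
      by (simp add: Z_def mult_ac)
    have D0: "0 \<le> D"
    proof -
      have "0 \<le> (\<integral>z. indicator (slab e R1 s T1 1) z *
      (exp ((2 * quadratic_weight.\<kappa> k0 k1 (snd z) + 2 * \<gamma>) * (norm (fst z))\<^sup>2) * ((u z)\<^sup>2 + (norm (Gu z))\<^sup>2)) \<partial>lborel)"
        by (intro Bochner_Integration.integral_nonneg) auto
      then show ?thesis using D[of 1] by linarith
    qed
    have "1 \<le> exp (2 * \<alpha> * \<psi> * q)"
      using \<alpha> \<psi> q by simp
    then have "N * D * (exp (2 * \<alpha> * \<psi> * q) + 2) \<le> N * D * (3 * exp (2 * \<alpha> * \<psi> * q))"
      using N D0 by (intro mult_left_mono) auto
    with fin have "c1 * exp (3 * \<alpha> * \<psi> * q) \<le> 3 * N * D * exp (2 * \<alpha> * \<psi> * q)"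
      by simp
    moreover have "exp (3 * \<alpha> * \<psi> * q) = exp (\<alpha> * \<psi> * q) * exp (2 * \<alpha> * \<psi> * q)"
      by (simp add: exp_add[symmetric])
    ultimately show ?thesis
      by (simp add: mult.assoc[symmetric])
  qed
  define y where "y = 3 * N * D / c1"
  define \<alpha> where "\<alpha> = max 1 (y / (\<psi> * q))"
  have "y \<le> \<alpha> * (\<psi> * q)"
  proof -
    have "y / (\<psi> * q) \<le> \<alpha>" by (simp add: \<alpha>_def)
    then show ?thesis using \<psi> q by (simp add: divide_le_eq)
  qed
  also have "\<dots> < exp (\<alpha> * \<psi> * q)"
    using exp_ge_add_one_self[of "\<alpha> * (\<psi> * q)"] unfolding mult.assoc by linarith
  finally have "3 * N * D < c1 * exp (\<alpha> * \<psi> * q)"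
    using c1 by (simp add: y_def divide_less_eq mult.commute)
  then show False
    using main[of \<alpha>] by (simp add: \<alpha>_def)
qed

end

section \<open>The two weights and the propagation in time\<close>

lemma unit_direction:
  fixes x :: "'a::real_inner"
  assumes "x \<noteq> 0"
  shows "norm (x /\<^sub>R norm x) = 1" "x \<bullet> (x /\<^sub>R norm x) = norm x"
  using assms by (simp_all add: dot_square_norm power2_eq_square)

context quadratic_weight
begin

lemma norm_W2: "norm e = 1 \<Longrightarrow> (norm (W z))\<^sup>2 =
    4 * (\<kappa> (snd z))\<^sup>2 * (norm (fst z))\<^sup>2 + 4 * \<kappa> (snd z) * a (snd z) * (fst z \<bullet> e) + (a (snd z))\<^sup>2"
proof -
  assume "norm e = 1"
  then have "e \<bullet> e = 1"
    by (simp add: dot_square_norm)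
  then show ?thesis
    unfolding W_def power2_norm_eq_inner
    by (simp add: inner_add_left inner_add_right inner_commute[of e "fst z"])
      (simp add: algebra_simps power2_eq_square)
qed

text \<open>\<open>Q\<close> as a polynomial in \<open>|x|\<^sup>2\<close> and \<open>x \<bullet> e\<close>, whose coefficients are estimated separately below.\<close>

lemma Q_expand:
  assumes e: "norm e = 1"
  shows "Q z = (8 * \<kappa> (snd z) - l) * (4 * (\<kappa> (snd z))\<^sup>2 * (norm (fst z))\<^sup>2
      + 4 * \<kappa> (snd z) * a (snd z) * (fst z \<bullet> e) + (a (snd z))\<^sup>2)
    - 8 * k1 * (2 * \<kappa> (snd z) * (norm (fst z))\<^sup>2 + a (snd z) * (fst z \<bullet> e))
    - 4 * a1 (snd z) * (2 * \<kappa> (snd z) * (fst z \<bullet> e) + a (snd z))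
    + (a2 (snd z) + l * a1 (snd z)) * (fst z \<bullet> e - b0) + l * k1 * (norm (fst z))\<^sup>2"
proof -
  have ee: "e \<bullet> e = 1"
    using e by (simp add: dot_square_norm)
  have xW: "fst z \<bullet> W z = 2 * \<kappa> (snd z) * (norm (fst z))\<^sup>2 + a (snd z) * (fst z \<bullet> e)"
    unfolding W_def power2_norm_eq_inner by (simp add: inner_add_right)
  have eW: "e \<bullet> W z = 2 * \<kappa> (snd z) * (fst z \<bullet> e) + a (snd z)"
    unfolding W_def using ee by (simp add: inner_add_right inner_commute[of e "fst z"])
  have "XG z \<bullet> W z = 4 * \<kappa> (snd z) * (norm (W z))\<^sup>2 - 2 * k1 * (fst z \<bullet> W z) - a1 (snd z) * (e \<bullet> W z)"
    unfolding XG_def by (simp add: inner_diff_left dot_square_norm)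
  moreover have "Xt z = 4 * k1 * (fst z \<bullet> W z) + 2 * a1 (snd z) * (e \<bullet> W z) - a2 (snd z) * (fst z \<bullet> e - b0)"
    unfolding Xt_def by (simp add: inner_add_right inner_commute[of "W z"])
  ultimately have "Q z = (8 * \<kappa> (snd z) - l) * (norm (W z))\<^sup>2 - 8 * k1 * (fst z \<bullet> W z) - 4 * a1 (snd z) * (e \<bullet> W z)
      + (a2 (snd z) + l * a1 (snd z)) * (fst z \<bullet> e - b0) + l * k1 * (norm (fst z))\<^sup>2"
    unfolding Q_def X_def by (simp add: algebra_simps)
  then show ?thesis
    unfolding xW eW norm_W2[OF e] .
qed

text \<open>The quantity to be absorbed, in the same form; \<open>|x| \<ge> R\<close> turns the constant 1 into a multiple of \<open>|x|\<^sup>2\<close>.\<close>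

lemma norm_W_le:
  assumes e: "norm e = 1" and M: "0 \<le> M" "0 \<le> V" and k: "\<bar>\<kappa> (snd z)\<bar> \<le> k" and R: "0 < R" "R \<le> norm (fst z)"
    and a: "0 \<le> a (snd z)"
  shows "3 * (M * norm (W z) + V * norm (fst z))\<^sup>2 + 1 \<le>
    (36 * M\<^sup>2 * k\<^sup>2 + 9 * V\<^sup>2 + 1 / R\<^sup>2) * (norm (fst z))\<^sup>2 + 9 * M\<^sup>2 * (a (snd z))\<^sup>2"
proof -
  let ?r = "norm (fst z)" and ?a = "a (snd z)"
  have "norm (W z) \<le> 2 * \<bar>\<kappa> (snd z)\<bar> * ?r + ?a"
    unfolding W_def using e a by (intro order_trans[OF norm_triangle_ineq]) (simp add: abs_mult)
  also have "\<dots> \<le> 2 * k * ?r + ?a"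
    using k by (intro add_mono mult_right_mono) auto
  finally have "M * norm (W z) + V * ?r \<le> M * (2 * k * ?r + ?a) + V * ?r"
    using M by (intro add_mono mult_left_mono) auto
  then have "(M * norm (W z) + V * ?r)\<^sup>2 \<le> (2 * M * k * ?r + M * ?a + V * ?r)\<^sup>2"
    using M by (intro power_mono) (auto simp: algebra_simps)
  also have "\<dots> \<le> 3 * ((2 * M * k * ?r)\<^sup>2 + (M * ?a)\<^sup>2 + (V * ?r)\<^sup>2)"
    by (rule square_sum3_le)
  finally have "3 * (M * norm (W z) + V * ?r)\<^sup>2 \<le> 36 * M\<^sup>2 * k\<^sup>2 * ?r\<^sup>2 + 9 * V\<^sup>2 * ?r\<^sup>2 + 9 * M\<^sup>2 * ?a\<^sup>2"
    by (simp add: power_mult_distrib)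
  moreover have "1 \<le> 1 / R\<^sup>2 * ?r\<^sup>2"
  proof -
    have "R\<^sup>2 \<le> ?r\<^sup>2" using R by (intro power_mono) auto
    then show ?thesis using R by (simp add: field_simps)
  qed
  ultimately show ?thesis
    by (simp add: distrib_right)
qed

end

context backward_solution
begin

lemma integrable_slab:
  assumes "norm e = 1" "R < R1" "T1 < T" "continuous_on UNIV f"
  shows "integrable lborel (\<lambda>z. indicator (slab e R1 s T1 r) z * (exp (f z) * ((u z)\<^sup>2 + (norm (Gu z))\<^sup>2)))"
proof -
  have "continuous_on (slab e R1 s T1 r) (\<lambda>z. exp (f z) * ((u z)\<^sup>2 + (norm (Gu z))\<^sup>2))"
    using slab_subset[OF assms(1-3)]
    by (intro continuous_intros continuous_on_subset[OF C21D(1)[OF uU]] continuous_on_subset[OF C21D(2)[OF uU]]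
        continuous_on_subset[OF assms(4)]) auto
  from borel_integrable_compact[OF compact_slab this] show ?thesis
    by simp
qed

text \<open>
  The first weight has \<open>\<kappa>(t) = - h\<close> with \<open>h = k - 16 k\<^sup>2 (t - s)\<close>, and \<open>l = 16 k\<close>. On a time interval of length
  at most \<open>1 / (32 k)\<close> one has \<open>k / 2 \<le> h \<le> k\<close>, so the weight beats the growth \<open>exp(M |x|\<^sup>2)\<close> once \<open>k\<close> is
  large compared with \<open>M\<close>. In \<open>Q\<close> the coefficient of \<open>|x|\<^sup>2\<close> is at least \<open>256 k\<^sup>3\<close>. The coefficient of
  \<open>x \<bullet> e\<close> is nonnegative since \<open>a''\<close> dominates \<open>a'\<close> and \<open>a\<close> near the zero \<open>T'\<close> of \<open>a\<close>; a shift
  \<open>b > 0\<close> would add \<open>- b (a'' + l a')\<close>, which near \<open>T'\<close> is negative and of first order in \<open>\<alpha>\<close>, whence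
  \<open>b = 0\<close>. The terms quadratic in \<open>a\<close>
  absorb \<open>M\<^sup>2 a\<^sup>2\<close>.
\<close>

lemma vanishes_far_out:
  assumes s: "vanishes_until s" "s < T"
  obtains s1 where "s < s1" "s1 < T" "\<And>z. z \<in> U \<Longrightarrow> snd z < s1 \<Longrightarrow> 4 * R < norm (fst z) \<Longrightarrow> u z = 0"
proof -
  define k where "k = 1 + M\<^sup>2 + V\<^sup>2 + 1 / R\<^sup>2 + 2 * M + 4"
  have k: "1 \<le> k" "M\<^sup>2 \<le> k" "V\<^sup>2 + 1 / R\<^sup>2 \<le> k" "2 * M + 4 \<le> k"
    using M by (auto simp: k_def add_nonneg_nonneg)
  define \<tau> where "\<tau> = min (1 / (32 * k)) ((T - s) / 2)"
  have \<tau>: "0 < \<tau>" "32 * k * \<tau> \<le> 1" "\<tau> < T - s"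
  proof -
    show "0 < \<tau>"
      using k s by (simp add: \<tau>_def)
    have "\<tau> \<le> (T - s) / 2"
      unfolding \<tau>_def by (rule min.cobounded2)
    then show "\<tau> < T - s"
      using s(2) by (simp add: field_simps)
    have "\<tau> \<le> 1 / (32 * k)"
      by (simp add: \<tau>_def)
    then show "32 * k * \<tau> \<le> 1"
      using k by (simp add: le_divide_eq mult.commute)
  qed
  define T1 where "T1 = s + \<tau>"
  define T' where "T' = s + \<tau> / 2"
  have T: "s < T'" "T' < T1" "T1 < T"
    using \<tau> by (auto simp: T1_def T'_def)
  define l where "l = 16 * k"
  define k1 where "k1 = 16 * k\<^sup>2"
  define k0 where "k0 = - k - k1 * s"
  show thesis
  proof (rule that)
    show "s < s + (T' - s) / 12" "s + (T' - s) / 12 < T"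
      using T by (auto simp: field_simps)
    fix z0 assume z0: "z0 \<in> U" "snd z0 < s + (T' - s) / 12" "4 * R < norm (fst z0)"
    define e where "e = fst z0 /\<^sub>R norm (fst z0)"
    have "fst z0 \<noteq> 0"
      using z0 R by auto
    then have e: "norm e = 1" "fst z0 \<bullet> e = norm (fst z0)"
      unfolding e_def by (rule unit_direction)+
    define R1 where "R1 = 3 / 2 * R"
    have R1: "R < R1" "R1 < 2 * R" "0 \<le> R1"
      using R by (auto simp: R1_def)
    define a where "a \<alpha> t = \<alpha> * max 0 (T' - t) ^ 3" for \<alpha> t :: real
    define a1 where "a1 \<alpha> t = - 3 * \<alpha> * (max 0 (T' - t))\<^sup>2" for \<alpha> t :: real
    define a2 where "a2 \<alpha> t = 6 * \<alpha> * max 0 (T' - t)" for \<alpha> t :: real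
    have qw: "quadratic_weight (a \<alpha>) (a1 \<alpha>) (a2 \<alpha>)" for \<alpha>
      unfolding a_def a1_def a2_def by (rule quadratic_weight_cubic)
    have kap: "quadratic_weight.\<kappa> k0 k1 t = - k + 16 * k\<^sup>2 * (t - s)" for t
      using quadratic_weight.\<kappa>_def[OF qw, of k0 k1] by (simp add: k0_def k1_def algebra_simps)
    have h: "k / 2 \<le> - (quadratic_weight.\<kappa> k0 k1 t)" "- (quadratic_weight.\<kappa> k0 k1 t) \<le> k"
      if "s \<le> t" "t \<le> T1" for t
    proof -
      have "(32 * k) * (t - s) \<le> (32 * k) * \<tau>"
        using that k by (intro mult_left_mono) (auto simp: T1_def)
      then have "32 * k * (t - s) \<le> 1"
        using \<tau>(2) by linarith
      then have "(k / 2) * (32 * k * (t - s)) \<le> (k / 2) * 1"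
        using k by (intro mult_left_mono) auto
      then show "k / 2 \<le> - (quadratic_weight.\<kappa> k0 k1 t)"
        unfolding kap by (simp add: power2_eq_square algebra_simps)
      have "0 \<le> 16 * k\<^sup>2 * (t - s)"
        using that by simp
      then show "- (quadratic_weight.\<kappa> k0 k1 t) \<le> k"
        unfolding kap by linarith
    qed
    obtain D where D: "\<And>r. r \<ge> 1 \<Longrightarrow> (\<integral>z. indicator (slab e R1 s T1 r) z *
        (exp (- 2 * (M + 1) * (norm (fst z))\<^sup>2) * ((u z)\<^sup>2 + (norm (Gu z))\<^sup>2)) \<partial>lborel) \<le> D"
      using caccioppoli[OF e(1) R1(1) T(3) s(1)] by blast
    show "u z0 = 0"
    proof (rule carleman_vanishing[where e = e and ?R1.0 = R1 and ?R2.0 = "2 * R" and ?b0.0 = 0 and s = s and T' = T'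
          and ?T1.0 = T1 and l = l and \<gamma> = 1 and D = D and ?k0.0 = k0 and ?k1.0 = k1, folded a_def a1_def a2_def])
      show "0 \<le> l" "(0::real) < 1" "(0::real) \<le> 0"
        using k by (auto simp: l_def)
      show "2 * (2 * R - 0) < fst z0 \<bullet> e - 0"
        using z0 e by simp
      show "3 * M\<^sup>2 \<le> 8 * quadratic_weight.\<kappa> k0 k1 (snd z) + l" if "s \<le> snd z" "snd z \<le> T1" for z :: "'a \<times> real"
        using h[OF that] k unfolding l_def by linarith
      show "(\<integral>z. indicator (slab e R1 s T1 r) z * (exp ((2 * quadratic_weight.\<kappa> k0 k1 (snd z) + 2 * 1) * (norm (fst z))\<^sup>2)
          * ((u z)\<^sup>2 + (norm (Gu z))\<^sup>2)) \<partial>lborel) \<le> D" if "r \<ge> 1" for r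
      proof (rule order_trans[OF integral_mono D[OF that]])
        fix z :: "'a \<times> real"
        show "indicator (slab e R1 s T1 r) z * (exp ((2 * quadratic_weight.\<kappa> k0 k1 (snd z) + 2 * 1) * (norm (fst z))\<^sup>2)
          * ((u z)\<^sup>2 + (norm (Gu z))\<^sup>2)) \<le> indicator (slab e R1 s T1 r) z *
          (exp (- 2 * (M + 1) * (norm (fst z))\<^sup>2) * ((u z)\<^sup>2 + (norm (Gu z))\<^sup>2))"
        proof (cases "z \<in> slab e R1 s T1 r")
          case True
          then have "k / 2 \<le> - (quadratic_weight.\<kappa> k0 k1 (snd z))"
            by (intro h) (auto simp: slab_def)
          then have "(2 * quadratic_weight.\<kappa> k0 k1 (snd z) + 2 * 1) * (norm (fst z))\<^sup>2 \<le> (- 2 * (M + 1)) * (norm (fst z))\<^sup>2"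
            using k(4) by (intro mult_right_mono) auto
          then show ?thesis
            using True by (auto intro!: mult_right_mono)
        qed simp
      qed (intro integrable_slab[OF e(1) R1(1) T(3)] continuous_intros; unfold kap; intro continuous_intros)+
      fix \<alpha> :: real and z :: "'a \<times> real"
      assume \<alpha>: "1 \<le> \<alpha>" and z: "R1 \<le> fst z \<bullet> e" "s \<le> snd z" "snd z \<le> T1"
      interpret quadratic_weight k0 k1 l 0 e "a \<alpha>" "a1 \<alpha>" "a2 \<alpha>"
        by (rule qw)
      define h where "h = - \<kappa> (snd z)"
      have hk: "k / 2 \<le> h" "h \<le> k"
        unfolding h_def using h[OF z(2,3)] by auto
      define p where "p = max 0 (T' - snd z)"
      have p: "0 \<le> p" "64 * k * p \<le> 1"
      proof -
        show "0 \<le> p" by (simp add: p_def)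
        have "p \<le> \<tau> / 2"
          unfolding p_def by (rule max.boundedI) (use z \<tau> in \<open>simp_all add: T'_def\<close>)
        then have "64 * k * p \<le> 64 * k * (\<tau> / 2)"
          using k by (intro mult_left_mono) auto
        also have "\<dots> = 32 * k * \<tau>"
          by simp
        finally show "64 * k * p \<le> 1"
          using \<tau>(2) by (rule order_trans)
      qed
      define x2 xe where "x2 = (norm (fst z))\<^sup>2" and "xe = fst z \<bullet> e"
      have x: "0 \<le> x2" "0 \<le> xe"
        using z R1 by (auto simp: x2_def xe_def)
      have av: "a \<alpha> (snd z) = \<alpha> * p ^ 3" "a1 \<alpha> (snd z) = - 3 * \<alpha> * p\<^sup>2" "a2 \<alpha> (snd z) = 6 * \<alpha> * p"
        by (simp_all add: a_def a1_def a2_def p_def)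
      have x2_coeff: "256 * k ^ 3 \<le> - (8 * h + l) * (4 * h\<^sup>2) + 16 * k1 * h + l * k1"
      proof -
        have "h\<^sup>2 \<le> k\<^sup>2"
          using hk k by (intro power_mono) auto
        then have "h * h\<^sup>2 \<le> h * k\<^sup>2" "k * h * h \<le> k * h * k"
          using hk k by (intro mult_left_mono; simp)+
        moreover have "0 \<le> h * k\<^sup>2"
          using hk k by simp
        ultimately show ?thesis
          unfolding l_def k1_def by (simp add: power2_eq_square power3_eq_cube algebra_simps)
      qed
      have xe_coeff: "0 \<le> (8 * h + l) * 4 * h * (\<alpha> * p ^ 3) - 8 * k1 * (\<alpha> * p ^ 3)
          + (8 * h + l) * (- 3 * \<alpha> * p\<^sup>2) + 6 * \<alpha> * p"
      proof -
        have kp: "0 \<le> k * p" "k * p \<le> 1 / 64"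
          using k p by auto
        have "(8 * h + l) * p \<le> (24 * k) * p"
          using hk p by (intro mult_right_mono) (auto simp: l_def)
        moreover have "(k * p) * (k * p) \<le> 1 / 64 * (1 / 64)"
          using kp by (intro mult_mono) auto
        moreover have "0 \<le> (8 * h + l) * 4 * h * p\<^sup>2"
          using hk k by (auto simp: l_def)
        ultimately have "0 \<le> (8 * h + l) * 4 * h * p\<^sup>2 - 128 * ((k * p) * (k * p)) - 3 * ((8 * h + l) * p) + 6"
          using kp by linarith
        then have "0 \<le> (\<alpha> * p) * ((8 * h + l) * 4 * h * p\<^sup>2 - 128 * ((k * p) * (k * p)) - 3 * ((8 * h + l) * p) + 6)"
          using \<alpha> p by (intro mult_nonneg_nonneg) auto
        also have "\<dots> = (8 * h + l) * 4 * h * (\<alpha> * p ^ 3) - 8 * k1 * (\<alpha> * p ^ 3)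
          + (8 * h + l) * (- 3 * \<alpha> * p\<^sup>2) + 6 * \<alpha> * p"
          unfolding k1_def by (simp add: power2_eq_square power3_eq_cube algebra_simps)
        finally show ?thesis .
      qed
      have const: "9 * M\<^sup>2 * (\<alpha> * p ^ 3)\<^sup>2 \<le> - (8 * h + l) * (\<alpha> * p ^ 3)\<^sup>2 + 12 * \<alpha> * p\<^sup>2 * (\<alpha> * p ^ 3)"
      proof -
        have "(9 * M\<^sup>2 + (8 * h + l)) * p \<le> (9 * k + 24 * k) * p"
          using hk p k by (intro mult_right_mono) (auto simp: l_def)
        also have "\<dots> = 33 / 64 * (64 * k * p)"
          by simp
        also have "\<dots> \<le> 33 / 64 * 1"
          using p(2) by (intro mult_left_mono) auto
        finally have "(9 * M\<^sup>2 + (8 * h + l)) * p \<le> 12"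
          by (rule order_trans) simp
        then have "(\<alpha>\<^sup>2 * p ^ 5) * ((9 * M\<^sup>2 + (8 * h + l)) * p) \<le> (\<alpha>\<^sup>2 * p ^ 5) * 12"
          using p by (intro mult_left_mono) auto
        then show ?thesis
          by (simp add: algebra_simps power2_eq_square power3_eq_cube eval_nat_numeral)
      qed
      have "3 * (M * norm (W z) + V * norm (fst z))\<^sup>2 + 1 \<le>
          (36 * M\<^sup>2 * k\<^sup>2 + 9 * V\<^sup>2 + 1 / R\<^sup>2) * x2 + 9 * M\<^sup>2 * (\<alpha> * p ^ 3)\<^sup>2"
        unfolding x2_def av(1)[symmetric]
      proof (rule norm_W_le[OF e(1)])
        show "\<bar>\<kappa> (snd z)\<bar> \<le> k"
          using hk k unfolding h_def by linarith
        show "R \<le> norm (fst z)"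
          using z R1 inner_unit_le[OF e(1), of "fst z"] by linarith
      qed (use M V R \<alpha> in \<open>auto simp: a_def\<close>)
      also have "(36 * M\<^sup>2 * k\<^sup>2 + 9 * V\<^sup>2 + 1 / R\<^sup>2) * x2 \<le> (256 * k ^ 3) * x2"
      proof (intro mult_right_mono x)
        have "M\<^sup>2 * k\<^sup>2 \<le> k * k\<^sup>2"
          using k by (intro mult_right_mono) auto
        moreover have "k \<le> k ^ 3"
          using k power_increasing[of 1 3 k] by simp
        moreover have "9 * V\<^sup>2 + 1 / R\<^sup>2 \<le> 9 * k"
        proof -
          have "0 \<le> 1 / R\<^sup>2"
            by simp
          then have "9 * V\<^sup>2 + 1 / R\<^sup>2 \<le> 9 * (V\<^sup>2 + 1 / R\<^sup>2)"
            unfolding distrib_left by linarith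
          also have "\<dots> \<le> 9 * k"
            using k(3) by (intro mult_left_mono) auto
          finally show ?thesis .
        qed
        moreover have "k * k\<^sup>2 = k ^ 3"
          by (simp add: power3_eq_cube power2_eq_square)
        ultimately have "36 * (M\<^sup>2 * k\<^sup>2) + (9 * V\<^sup>2 + 1 / R\<^sup>2) \<le> 36 * k ^ 3 + 9 * k ^ 3"
          by (intro add_mono) auto
        also have "\<dots> \<le> 256 * k ^ 3"
          using k by simp
        finally show "36 * M\<^sup>2 * k\<^sup>2 + 9 * V\<^sup>2 + 1 / R\<^sup>2 \<le> 256 * k ^ 3"
          by simp
      qed
      also have "\<dots> \<le> (- (8 * h + l) * (4 * h\<^sup>2) + 16 * k1 * h + l * k1) * x2"
        by (intro mult_right_mono x x2_coeff)
      also have "(- (8 * h + l) * (4 * h\<^sup>2) + 16 * k1 * h + l * k1) * x2 + 9 * M\<^sup>2 * (\<alpha> * p ^ 3)\<^sup>2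
          \<le> (- (8 * h + l) * (4 * h\<^sup>2) + 16 * k1 * h + l * k1) * x2
          + (- (8 * h + l) * (\<alpha> * p ^ 3)\<^sup>2 + 12 * \<alpha> * p\<^sup>2 * (\<alpha> * p ^ 3))
          + ((8 * h + l) * 4 * h * (\<alpha> * p ^ 3) - 8 * k1 * (\<alpha> * p ^ 3) + (8 * h + l) * (- 3 * \<alpha> * p\<^sup>2) + 6 * \<alpha> * p) * xe"
        using const mult_nonneg_nonneg[OF xe_coeff x(2)] by linarith
      also have "\<dots> = Q z"
        unfolding Q_expand[OF e(1)] av x2_def[symmetric] xe_def[symmetric]
        unfolding h_def by (simp add: algebra_simps power2_eq_square)
      finally show "3 * (M * norm (W z) + V * norm (fst z))\<^sup>2 + 1 \<le> Q z"
        by simp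
    qed (fact e(1) R1(1,2,3) T s(1) z0(1,2))+
  qed
qed

text \<open>
  The second weight has constant \<open>\<kappa> = k > 0\<close> and \<open>l = 0\<close>. Every term of \<open>Q\<close> is then nonnegative, because
  \<open>a, a'' \<ge> 0 \<ge> a'\<close> and \<open>x \<bullet> e \<ge> b\<close>. The time \<open>s2\<close> is fixed before the point \<open>z0\<close> and the distance \<open>d\<close>, so
  that points arbitrarily close to the ball are treated with the same \<open>s2\<close>.
\<close>

lemma vanishes_a_little_longer:
  assumes s: "vanishes_until s" "s < T"
  obtains s' where "s < s'" "s' < T" "vanishes_until s'"
proof -
  obtain s1 where s1: "s < s1" "s1 < T" and far: "\<And>z. z \<in> U \<Longrightarrow> snd z < s1 \<Longrightarrow> 4 * R < norm (fst z) \<Longrightarrow> u z = 0"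
    using vanishes_far_out[OF s] by blast
  define T1 where "T1 = s + (s1 - s) * (3 / 4)"
  define T' where "T' = s + (s1 - s) / 2"
  have T: "s < T'" "T' < T1" "T1 < s1" "T1 < T"
    using s1 by (auto simp: T1_def T'_def field_simps)
  define k where "k = 1 + 2 * M\<^sup>2 + V\<^sup>2 + 1 / R\<^sup>2"
  have k: "1 \<le> k" "2 * M\<^sup>2 \<le> k" "V\<^sup>2 + 1 / R\<^sup>2 \<le> k"
    by (auto simp: k_def add_nonneg_nonneg)
  define s2 where "s2 = s + (T' - s) / 12"
  have s2: "s < s2" "s2 < T"
    using T by (auto simp: s2_def field_simps)
  have "u z0 = 0" if z0: "z0 \<in> U" "snd z0 < s2" for z0
  proof -
    define e where "e = fst z0 /\<^sub>R norm (fst z0)"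
    have x0: "R < norm (fst z0)"
      using z0 by (simp add: U_def)
    have "fst z0 \<noteq> 0"
      using x0 R by auto
    then have e: "norm e = 1" "fst z0 \<bullet> e = norm (fst z0)"
      unfolding e_def by (rule unit_direction)+
    \<comment> \<open>With \<open>R1 = b = R + d\<close> and \<open>R2 = R + 2 d\<close> the point \<open>z0\<close> has distance \<open>3 d > 2 (R2 - b)\<close> from the face.\<close>
    define d where "d = (norm (fst z0) - R) / 4"
    have d: "0 < d" "norm (fst z0) = R + 4 * d"
      using x0 by (auto simp: d_def field_simps)
    define R1 where "R1 = R + d"
    have R1: "R < R1" "R1 < R + 2 * d" "0 \<le> R1"
      using R d by (auto simp: R1_def)
    define a where "a \<alpha> t = \<alpha> * max 0 (T' - t) ^ 3" for \<alpha> t :: real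
    define a1 where "a1 \<alpha> t = - 3 * \<alpha> * (max 0 (T' - t))\<^sup>2" for \<alpha> t :: real
    define a2 where "a2 \<alpha> t = 6 * \<alpha> * max 0 (T' - t)" for \<alpha> t :: real
    have qw: "quadratic_weight (a \<alpha>) (a1 \<alpha>) (a2 \<alpha>)" for \<alpha>
      unfolding a_def a1_def a2_def by (rule quadratic_weight_cubic)
    have kap: "quadratic_weight.\<kappa> k 0 t = k" for t
      using quadratic_weight.\<kappa>_def[OF qw, of k 0] by simp
    let ?I = "\<lambda>r z. indicator (slab e R1 s T1 r) z * (exp ((2 * k + 2) * (norm (fst z))\<^sup>2) * ((u z)\<^sup>2 + (norm (Gu z))\<^sup>2))"
    have Gfar: "u z = 0" "Gu z = 0" if "z \<in> U" "snd z < s1" "4 * R < norm (fst z)" for z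
    proof -
      let ?O = "{z. z \<in> U \<and> snd z < s1 \<and> 4 * R < norm (fst z)}"
      have "open ?O"
        by (intro open_Collect_conj open_Collect_less continuous_intros) (simp add: open_U)
      then show "Gu z = 0"
        by (rule C21_outside(1)[OF uU]) (use far that in auto)
      show "u z = 0"
        by (rule far) fact+
    qed
    show ?thesis
    proof (rule carleman_vanishing[where e = e and ?R1.0 = R1 and ?R2.0 = "R + 2 * d" and ?b0.0 = R1 and s = s and T' = T'
          and ?T1.0 = T1 and l = 0 and \<gamma> = 1 and D = "\<integral>z. ?I (4 * R) z \<partial>lborel" and ?k0.0 = k and ?k1.0 = 0,
          folded a_def a1_def a2_def])
      show "2 * (R + 2 * d - R1) < fst z0 \<bullet> e - R1"
        unfolding e(2) using d by (simp add: R1_def)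
      show "3 * M\<^sup>2 \<le> 8 * quadratic_weight.\<kappa> k 0 (snd z) + 0" for z :: "'a \<times> real"
        unfolding kap using k zero_le_power2[of M] by linarith
      show "(\<integral>z. indicator (slab e R1 s T1 r) z * (exp ((2 * quadratic_weight.\<kappa> k 0 (snd z) + 2 * 1) * (norm (fst z))\<^sup>2)
          * ((u z)\<^sup>2 + (norm (Gu z))\<^sup>2)) \<partial>lborel) \<le> (\<integral>z. ?I (4 * R) z \<partial>lborel)" if "r \<ge> 1" for r
        unfolding kap
      proof (rule integral_mono)
        fix z :: "'a \<times> real"
        show "indicator (slab e R1 s T1 r) z * (exp ((2 * k + 2 * 1) * (norm (fst z))\<^sup>2)
          * ((u z)\<^sup>2 + (norm (Gu z))\<^sup>2)) \<le> ?I (4 * R) z"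
        proof (cases "z \<in> slab e R1 s T1 r")
          case True
          show ?thesis
          proof (cases "norm (fst z) \<le> 4 * R")
            case True': True
            then show ?thesis
              using True by (auto simp: slab_def)
          next
            case False
            have "z \<in> U" "snd z < s1"
              using True slab_subset[OF e(1) R1(1) T(4)] T by (auto simp: slab_def)
            then show ?thesis
              using Gfar[of z] False by simp
          qed
        qed simp
      qed (intro integrable_slab[OF e(1) R1(1) T(4)] continuous_intros)+
      show "snd z0 < s + (T' - s) / 12"
        using z0 by (simp add: s2_def)
      fix \<alpha> :: real and z :: "'a \<times> real"
      assume \<alpha>: "1 \<le> \<alpha>" and z: "R1 \<le> fst z \<bullet> e" "s \<le> snd z" "snd z \<le> T1"
      interpret quadratic_weight k 0 0 R1 e "a \<alpha>" "a1 \<alpha>" "a2 \<alpha>"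
        by (rule qw)
      define x2 xe where "x2 = (norm (fst z))\<^sup>2" and "xe = fst z \<bullet> e"
      have x: "0 \<le> x2" "0 \<le> xe" "R1 \<le> xe"
        using z R1 by (auto simp: x2_def xe_def)
      define A A1 A2 where "A = a \<alpha> (snd z)" and "A1 = a1 \<alpha> (snd z)" and "A2 = a2 \<alpha> (snd z)"
      have A: "0 \<le> A" "A1 \<le> 0" "0 \<le> A2"
        using \<alpha> by (auto simp: A_def A1_def A2_def a_def a1_def a2_def)
      have "3 * (M * norm (W z) + V * norm (fst z))\<^sup>2 + 1 \<le>
          (36 * M\<^sup>2 * k\<^sup>2 + 9 * V\<^sup>2 + 1 / R\<^sup>2) * x2 + 9 * M\<^sup>2 * A\<^sup>2"
        unfolding x2_def A_def
      proof (rule norm_W_le[OF e(1)])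
        show "\<bar>\<kappa> (snd z)\<bar> \<le> k"
          using k unfolding kap by linarith
        show "R \<le> norm (fst z)"
          using z R1 inner_unit_le[OF e(1), of "fst z"] by linarith
      qed (use M V R A in \<open>auto simp: A_def\<close>)
      also have "\<dots> \<le> (32 * k ^ 3) * x2 + 8 * k * A\<^sup>2"
      proof (intro add_mono mult_right_mono x)
        have "(2 * M\<^sup>2) * k\<^sup>2 \<le> k * k\<^sup>2"
          using k by (intro mult_right_mono) auto
        moreover have "k \<le> k ^ 3"
          using k power_increasing[of 1 3 k] by simp
        moreover have "9 * V\<^sup>2 + 1 / R\<^sup>2 \<le> 9 * k"
        proof -
          have "0 \<le> 1 / R\<^sup>2"
            by simp
          then have "9 * V\<^sup>2 + 1 / R\<^sup>2 \<le> 9 * (V\<^sup>2 + 1 / R\<^sup>2)"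
            unfolding distrib_left by linarith
          also have "\<dots> \<le> 9 * k"
            using k(3) by (intro mult_left_mono) auto
          finally show ?thesis .
        qed
        moreover have "k * k\<^sup>2 = k ^ 3"
          by (simp add: power3_eq_cube power2_eq_square)
        ultimately have "18 * ((2 * M\<^sup>2) * k\<^sup>2) + (9 * V\<^sup>2 + 1 / R\<^sup>2) \<le> 18 * k ^ 3 + 9 * k ^ 3"
          by (intro add_mono) auto
        also have "\<dots> \<le> 32 * k ^ 3"
          using k by simp
        finally show "36 * M\<^sup>2 * k\<^sup>2 + 9 * V\<^sup>2 + 1 / R\<^sup>2 \<le> 32 * k ^ 3"
          by simp
        show "9 * M\<^sup>2 \<le> 8 * k"
          using k by linarith
      qed simp
      also have "\<dots> \<le> (32 * k ^ 3) * x2 + 8 * k * A\<^sup>2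
          + (32 * k\<^sup>2 * A * xe + (- A1) * (8 * k * xe) + 4 * (- A1) * A + A2 * (xe - R1))"
      proof -
        have "0 \<le> 32 * k\<^sup>2 * A * xe" "0 \<le> (- A1) * (8 * k * xe)" "0 \<le> 4 * (- A1) * A" "0 \<le> A2 * (xe - R1)"
          by (intro mult_nonneg_nonneg; use A x k in simp)+
        then show ?thesis
          by linarith
      qed
      also have "\<dots> = Q z"
        unfolding Q_expand[OF e(1)] kap A_def[symmetric] A1_def[symmetric] A2_def[symmetric] x2_def[symmetric] xe_def[symmetric]
        by (simp add: algebra_simps power2_eq_square power3_eq_cube)
      finally show "3 * (M * norm (W z) + V * norm (fst z))\<^sup>2 + 1 \<le> Q z" .
    qed (use R1 T e(1) s(1) z0(1) in auto)
  qed
  then have "vanishes_until ((s + s2) / 2)"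
    using s2 by (auto simp: vanishes_until_def)
  then show thesis
    using s2 by (intro that[of "(s + s2) / 2"]) auto
qed

lemma continuous_in_time:
  assumes "(x, t) \<in> U"
  shows "(\<lambda>n. u (x, t - inverse (real (Suc n)))) \<longlonglongrightarrow> u (x, t)"
proof -
  have "isCont u (x, t)"
    using C21D(1)[OF uU] assms open_U by (simp add: continuous_on_eq_continuous_at)
  moreover have "(\<lambda>n. (x, t - inverse (real (Suc n)))) \<longlonglongrightarrow> (x, t - 0)"
    by (intro tendsto_intros LIMSEQ_inverse_real_of_nat)
  ultimately show ?thesis
    by (auto intro: isCont_tendsto_compose)
qed

theorem vanishes:
  assumes z0: "z0 \<in> U"
  shows "u z0 = 0"
proof (rule ccontr)
  assume nz: "u z0 \<noteq> 0"
  define A where "A = {s. vanishes_until s}"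
  have below: "s < snd z0" if "s \<in> A" for s
    using that nz z0 unfolding A_def vanishes_until_def by force
  have "0 \<in> A"
    using initial by (auto simp: A_def vanishes_until_def U_def)
  have bdd: "bdd_above A"
    using below by (auto intro!: bdd_aboveI[of _ "snd z0"] less_imp_le)
  define s where "s = Sup A"
  have sT: "s < T"
  proof -
    have "s \<le> snd z0"
      unfolding s_def using \<open>0 \<in> A\<close> below by (intro cSup_least) (auto intro: less_imp_le)
    then show ?thesis
      using z0 by (auto simp: U_def)
  qed
  have before: "u z = 0" if z: "z \<in> U" "snd z < s" for z
  proof -
    obtain s' where "s' \<in> A" "snd z < s'"
      using z(2) less_cSup_iff[of A "snd z"] \<open>0 \<in> A\<close> bdd unfolding s_def by blast
    then show ?thesis
      using z(1) by (auto simp: A_def vanishes_until_def)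
  qed
  have "vanishes_until s"
    unfolding vanishes_until_def
  proof (intro ballI impI)
    fix z assume z: "z \<in> U" "snd z \<le> s"
    have "u (fst z, snd z - inverse (real (Suc n))) = 0" for n
    proof (rule before)
      have "snd z - inverse (real (Suc n)) < snd z"
        using inverse_Suc_bounds(1)[of n] by linarith
      then have "snd z - inverse (real (Suc n)) < T" "snd z - inverse (real (Suc n)) < s"
        using z sT unfolding U_def by linarith+
      then show "(fst z, snd z - inverse (real (Suc n))) \<in> U" "snd (fst z, snd z - inverse (real (Suc n))) < s"
        using z unfolding U_def by (simp_all del: of_nat_Suc)
    qed
    moreover have "(\<lambda>n. u (fst z, snd z - inverse (real (Suc n)))) \<longlonglongrightarrow> u (fst z, snd z)"
      by (rule continuous_in_time) (use z in simp)
    ultimately show "u z = 0"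
      by (simp add: LIMSEQ_const_iff)
  qed
  then obtain s' where "s < s'" "vanishes_until s'"
    using vanishes_a_little_longer sT by blast
  then have "s' \<le> s"
    unfolding s_def using bdd by (intro cSup_upper) (auto simp: A_def)
  then show False
    using \<open>s < s'\<close> by simp
qed

end

section \<open>Backward uniqueness in the exterior domain\<close>

theorem theoremA1:
  fixes u :: "real ^ 'n \<Rightarrow> real \<Rightarrow> real"
    and M N T R \<delta> :: real
  assumes "M > 0" "N > 0" "T > 0" "R > 0"
    and "0 < \<delta>" "\<delta> < 1 / 2"
    and "C21_on (exterior R) {0..T} u"
    and "\<And>x t. x \<in> exterior R \<Longrightarrow> t \<in> {0..T} \<Longrightarrow>
           \<bar>laplacian_within (exterior R) (\<lambda>y. u y t) x + vector_derivative (u x) (at t within {0..T})\<bar>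
             \<le> M * norm (grad_within (exterior R) (\<lambda>y. u y t) x)
               + (N * norm x powr \<delta> + M) * \<bar>u x t\<bar>"
    and "\<And>x t. x \<in> exterior R \<Longrightarrow> t \<in> {0..T} \<Longrightarrow> \<bar>u x t\<bar> \<le> M * exp (M * (norm x)\<^sup>2)"
    and "\<And>x. x \<in> exterior R \<Longrightarrow> u x 0 = 0"
  shows "\<forall>x\<in>exterior R. \<forall>t\<in>{0..T}. u x t = 0"
proof -
  let ?E = "exterior R :: (real ^ 'n) set" and ?I = "{0..T}"
  note M = \<open>M > 0\<close> and N = \<open>N > 0\<close> and T = \<open>T > 0\<close> and R = \<open>R > 0\<close> and \<delta> = \<open>0 < \<delta>\<close> \<open>\<delta> < 1 / 2\<close>
    and C = \<open>C21_on (exterior R) {0..T} u\<close>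
  note pde = assms(8) and growth = assms(9) and init = assms(10)
  define U where "U = {z :: (real ^ 'n) \<times> real. R < norm (fst z) \<and> snd z < T}"
  \<comment> \<open>Since \<open>u\<close> vanishes at time 0, evaluation at \<open>max 0 t\<close> extends it and its derivatives by zero.\<close>
  define v where "v z = u (fst z) (max 0 (snd z))" for z
  define G where "G z = grad_within ?E (\<lambda>y. u y (max 0 (snd z))) (fst z)" for z
  define H where "H b z = partial_within ?E b (partial_within ?E b (\<lambda>y. u y (max 0 (snd z)))) (fst z)" for b z
  define p where "p z = vector_derivative (u (fst z)) (at (max 0 (snd z)) within ?I)" for z
  have ext: "x \<in> ?E \<longleftrightarrow> R \<le> norm x" for x
    by (auto simp: exterior_def)
  have inI: "max 0 (snd z) \<in> ?I" if "z \<in> U" for z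
    using that T by (auto simp: U_def)
  have inE: "fst z \<in> ?E" if "z \<in> U" for z
    using that by (auto simp: U_def ext)
  have Gb: "G z \<bullet> b = partial_within ?E b (\<lambda>y. u y (max 0 (snd z))) (fst z)" if "b \<in> Basis" for z b
    unfolding G_def grad_within_def using that by (simp add: inner_sum_left inner_Basis if_distrib sum.delta cong: if_cong)
  have at: "at x within ?E = at x" if "R < norm x" for x
  proof (rule at_within_open_subset)
    show "x \<in> {x. R < norm x}" "open {x :: real ^ 'n. R < norm x}" "{x. R < norm x} \<subseteq> ?E"
      using that by (auto simp: ext intro!: open_Collect_less continuous_intros)
  qed
  have dir: "has_dir_deriv (b, 0) (\<lambda>z. f (fst z) (snd z)) (partial_within ?E b (\<lambda>y. f y (snd z)) (fst z)) z"
    if z: "R < norm (fst z)" and d: "(\<lambda>y. f y (snd z)) differentiable (at (fst z) within ?E)"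
    for f :: "real ^ 'n \<Rightarrow> real \<Rightarrow> real" and z b
  proof -
    define f' where "f' = frechet_derivative (\<lambda>y. f y (snd z)) (at (fst z))"
    have f': "((\<lambda>y. f y (snd z)) has_derivative f') (at (fst z))"
      unfolding f'_def using d at[OF z] frechet_derivative_works by metis
    have "((\<lambda>h. fst z + h *\<^sub>R b) has_derivative (\<lambda>h. h *\<^sub>R b)) (at 0)"
      by (auto intro!: derivative_eq_intros)
    then have "((\<lambda>h. f (fst z + h *\<^sub>R b) (snd z)) has_derivative (\<lambda>h. f' (h *\<^sub>R b))) (at 0)"
      using has_derivative_compose[of "\<lambda>h. fst z + h *\<^sub>R b" _ 0 UNIV "\<lambda>y. f y (snd z)" f'] f' by simp
    moreover have "f' (h *\<^sub>R b) = f' b * h" for h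
      using has_derivative_linear[OF f'] by (simp add: linear_cmul)
    ultimately have "((\<lambda>h. f (fst z + h *\<^sub>R b) (snd z)) has_real_derivative f' b) (at 0)"
      by (simp add: has_field_derivative_def)
    then show ?thesis
      unfolding has_dir_deriv_def partial_within_def at[OF z] f'_def by simp
  qed
  have zero: "v z = 0" "G z = 0" "b \<in> Basis \<Longrightarrow> H b z = 0" if z: "z \<in> U" "snd z \<le> 0" for z b
  proof -
    have t: "max 0 (snd z) = 0"
      using z by simp
    have part0: "partial_within ?E b f x = 0" if "R < norm x" "\<And>y. R < norm y \<Longrightarrow> f y = 0" for b f x
    proof -
      have "((\<lambda>_. 0) has_derivative (\<lambda>_. 0)) (at x)"
        by simp
      then have "(f has_derivative (\<lambda>_. 0)) (at x)"
        by (rule has_derivative_transform_within_open[where s = "{x. R < norm x}"])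
          (use that in \<open>auto intro!: open_Collect_less continuous_intros\<close>)
      then show ?thesis
        unfolding partial_within_def at[OF that(1)] by (metis frechet_derivative_at)
    qed
    have x: "R < norm (fst z)"
      using z by (simp add: U_def)
    have u0: "R < norm y \<Longrightarrow> u y 0 = 0" for y
      using init by (auto simp: ext)
    have p0: "R < norm y \<Longrightarrow> partial_within ?E b (\<lambda>y. u y 0) y = 0" for y b
      by (rule part0) (use u0 in auto)
    show "v z = 0"
      using u0 x t by (simp add: v_def)
    show "G z = 0"
      unfolding G_def grad_within_def t using p0[OF x] by simp
    show "H b z = 0"
      unfolding H_def t by (rule part0[OF x p0])
  qed
  have pde': "\<bar>p z + lap H z\<bar> \<le> M * norm (G z) + (N * norm (fst z) powr \<delta> + M) * \<bar>v z\<bar>"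
    if "z \<in> U" for z
    using pde[OF inE[OF that] inI[OF that]] unfolding p_def H_def G_def v_def laplacian_within_def
    by (simp add: add.commute)
  have p0: "p z = 0" if "z \<in> U" "snd z \<le> 0" for z
    using pde'[OF that(1)] zero[OF that] by simp
  have cont: "continuous_on U (\<lambda>z. f (fst z) (max 0 (snd z)))"
    if "continuous_on (?E \<times> ?I) (\<lambda>(x, t). f x t)" for f :: "real ^ 'n \<Rightarrow> real \<Rightarrow> real"
  proof -
    have "continuous_on U (\<lambda>z. (\<lambda>(x, t). f x t) (fst z, max 0 (snd z)))"
      by (rule continuous_on_compose2[OF that]) (use inE inI in \<open>auto intro!: continuous_intros\<close>)
    then show ?thesis
      by simp
  qed
  have diff: "(\<lambda>y. u y t) differentiable (at x within ?E)"
    "b \<in> Basis \<Longrightarrow> partial_within ?E b (\<lambda>y. u y t) differentiable (at x within ?E)"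
    "u x differentiable (at t within ?I)" if "x \<in> ?E" "t \<in> ?I" for x t b
    using C that unfolding C21_on_def by blast+
  have C21: "C21 U v G H p"
    unfolding C21_def
  proof (intro conjI ballI)
    show "continuous_on U v" "continuous_on U p"
      unfolding v_def p_def using C unfolding C21_on_def by (auto intro!: cont)
    show "continuous_on U (H b)" if "b \<in> Basis" for b
      unfolding H_def using C that unfolding C21_on_def by (auto intro!: cont)
    show "continuous_on U G"
      unfolding G_def grad_within_def using C unfolding C21_on_def
      by (auto intro!: cont continuous_intros)
  next
    fix z assume z: "z \<in> U"
    show "has_dir_deriv (0, 1) v (p z) z"
    proof -
      let ?x = "fst z" and ?t = "snd z"
      have g: "(u ?x has_real_derivative p z) (at (max 0 ?t) within ?I)"
        unfolding p_def has_real_derivative_iff_has_vector_derivative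
        using diff(3)[OF inE[OF z] inI[OF z]] by (rule vector_derivative_works[THEN iffD1])
      have "((\<lambda>t. u ?x (max 0 t)) has_real_derivative p z) (at ?t)"
      proof (cases ?t "0::real" rule: linorder_cases)
        case less
        have "((\<lambda>t. u ?x 0) has_real_derivative p z) (at ?t)"
          using p0[OF z] less by simp
        then show ?thesis
          by (rule has_field_derivative_transform_within_open[where S = "{..<0}"]) (use less in auto)
      next
        case greater
        then have "at (max 0 ?t) within ?I = at ?t"
          using z by (subst at_within_interior) (auto simp: U_def)
        then have "(u ?x has_real_derivative p z) (at ?t)"
          using g by simp
        then show ?thesis
          by (rule has_field_derivative_transform_within_open[where S = "{0<..}"]) (use greater in auto)
      next
        case equal
        have u0: "u ?x 0 = 0"
          using zero(1)[OF z] equal by (simp add: v_def)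
        have "((\<lambda>y. (u ?x y - u ?x 0) / (y - 0)) \<longlongrightarrow> 0) (at 0 within ?I)"
          using g p0[OF z] equal unfolding has_field_derivative_iff by simp
        then have lim: "\<exists>d>0. \<forall>y\<in>?I. y \<noteq> 0 \<and> dist y 0 < d \<longrightarrow> dist (u ?x y / y) 0 < \<epsilon>" if "\<epsilon> > 0" for \<epsilon>
          using that u0 unfolding tendsto_iff eventually_at by simp
        have "((\<lambda>h. (u ?x (max 0 (0 + h)) - u ?x (max 0 0)) / h) \<longlongrightarrow> 0) (at 0)"
          unfolding LIM_def
        proof (intro allI impI)
          fix \<epsilon> :: real assume \<epsilon>: "\<epsilon> > 0"
          then obtain d where d: "d > 0" "\<And>y. y \<in> ?I \<Longrightarrow> y \<noteq> 0 \<Longrightarrow> dist y 0 < d \<Longrightarrow> dist (u ?x y / y) 0 < \<epsilon>"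
            using lim by blast
          show "\<exists>s>0. \<forall>h. h \<noteq> 0 \<and> dist h 0 < s \<longrightarrow> dist ((u ?x (max 0 (0 + h)) - u ?x (max 0 0)) / h) 0 < \<epsilon>"
          proof (intro exI[of _ "min d T"] conjI allI impI)
            fix h :: real assume h: "h \<noteq> 0 \<and> dist h 0 < min d T"
            show "dist ((u ?x (max 0 (0 + h)) - u ?x (max 0 0)) / h) 0 < \<epsilon>"
            proof (cases "h < 0")
              case True
              then show ?thesis using \<epsilon> by simp
            next
              case False
              then have "h \<in> ?I" "h \<noteq> 0" "dist h 0 < d"
                using h by auto
              from d(2)[OF this] show ?thesis
                using False u0 by (simp add: max_def)
            qed
          qed (use d T in auto)
        qed
        then show ?thesis
          using p0[OF z] equal by (simp add: DERIV_def)
      qed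
      then show ?thesis
        unfolding v_def has_dir_deriv_def using DERIV_shift[of "\<lambda>t. u ?x (max 0 t)" "p z" 0 ?t]
        by (simp add: add.commute)
    qed
  next
    fix z assume z: "z \<in> U"
    fix b :: "real ^ 'n" assume b: "b \<in> Basis"
    have x: "R < norm (fst z)"
      using z by (simp add: U_def)
    show "has_dir_deriv (b, 0) v (G z \<bullet> b) z"
      unfolding Gb[OF b] v_def
      using dir[of z "\<lambda>x t. u x (max 0 t)" b, OF x diff(1)[OF inE[OF z] inI[OF z]]] .
    show "has_dir_deriv (b, 0) (\<lambda>z. G z \<bullet> b) (H b z) z"
      unfolding Gb[OF b] H_def
      using dir[of z "\<lambda>x t. partial_within ?E b (\<lambda>y. u y (max 0 t)) x" b, OF x]
        diff(2)[OF inE[OF z] inI[OF z] b] by simp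
  qed
  define V where "V = N / R + N + M / R"
  interpret backward_solution v p G H M V R T
  proof
    show "M > 0" "R > 0" "V \<ge> 0"
      using M N R by (auto simp: V_def)
    show "C21 {z. R < norm (fst z) \<and> snd z < T} v G H p"
      using C21 unfolding U_def .
    fix z :: "(real ^ 'n) \<times> real" assume x: "R < norm (fst z)" and "snd z < T"
    then have z: "z \<in> U" by (simp add: U_def)
    let ?r = "norm (fst z)"
    have "?r powr \<delta> \<le> 1 + ?r"
    proof (cases "?r \<le> 1")
      case True
      then have "?r powr \<delta> \<le> 1"
        using \<delta> by (intro powr_le1) auto
      then show ?thesis
        using norm_ge_zero[of "fst z"] by linarith
    next
      case False
      then have "?r powr \<delta> \<le> ?r powr 1"
        using \<delta> by (intro powr_mono) auto
      then show ?thesis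
        using False by simp
    qed
    then have "N * ?r powr \<delta> + M \<le> N * (1 + ?r) + M * 1"
      using N by simp
    also have "\<dots> \<le> N * (?r / R + ?r) + M * (?r / R)"
      using x R M N by (intro add_mono mult_left_mono) auto
    also have "\<dots> = V * ?r"
      by (simp add: V_def algebra_simps)
    finally have "(N * ?r powr \<delta> + M) * \<bar>v z\<bar> \<le> V * ?r * \<bar>v z\<bar>"
      by (rule mult_right_mono) simp
    then show "\<bar>p z + lap H z\<bar> \<le> M * norm (G z) + V * ?r * \<bar>v z\<bar>"
      using pde'[OF z] by linarith
    show "\<bar>v z\<bar> \<le> M * exp (M * ?r\<^sup>2)"
      unfolding v_def by (rule growth[OF inE[OF z] inI[OF z]])
    show "v z = 0" if "snd z \<le> 0"
      by (rule zero(1)[OF z that])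
  qed
  show ?thesis
  proof (intro ballI)
    fix x t assume x: "x \<in> ?E" and t: "t \<in> ?I"
    \<comment> \<open>The boundary of the domain and the final time are reached by continuity.\<close>
    define X where "X n = (1 + inverse (real (Suc n))) *\<^sub>R x" for n
    define S where "S n = (1 - inverse (real (Suc n))) * t" for n
    have h: "0 < inverse (real (Suc n))" "inverse (real (Suc n)) \<le> 1" for n
      by (rule inverse_Suc_bounds)+
    have XE: "R < norm (X n)" for n
    proof -
      have "R * 1 < norm x * (1 + inverse (real (Suc n)))"
        using x R h[of n] by (intro mult_le_less_imp_less) (auto simp: ext)
      then show ?thesis
        using h[of n] by (simp add: X_def mult.commute del: of_nat_Suc)
    qed
    have S: "0 \<le> S n" "S n < T" "S n \<le> T" for n
    proof -
      show "0 \<le> S n"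
        unfolding S_def using h[of n] t by (intro mult_nonneg_nonneg) auto
      have "S n \<le> (1 - inverse (real (Suc n))) * T"
        unfolding S_def using h[of n] t by (intro mult_left_mono) auto
      also have "\<dots> < 1 * T"
        using h[of n] T by (intro mult_strict_right_mono) auto
      finally show "S n < T" "S n \<le> T" by auto
    qed
    have "u (X n) (S n) = 0" for n
      using vanishes[of "(X n, S n)"] XE[of n] S[of n] by (simp add: local.U_def v_def)
    moreover have "(\<lambda>n. (\<lambda>(x, t). u x t) (X n, S n)) \<longlonglongrightarrow> (\<lambda>(x, t). u x t) (x, t)"
    proof (rule continuous_on_tendsto_compose[where s = "?E \<times> ?I"])
      show "continuous_on (?E \<times> ?I) (\<lambda>(x, t). u x t)"
        using C unfolding C21_on_def by blast
      have "(\<lambda>n. (X n, S n)) \<longlonglongrightarrow> ((1 + 0) *\<^sub>R x, (1 - 0) * t)"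
        unfolding X_def S_def by (intro tendsto_intros LIMSEQ_inverse_real_of_nat)
      then show "(\<lambda>n. (X n, S n)) \<longlonglongrightarrow> (x, t)"
        by simp
      show "(x, t) \<in> ?E \<times> ?I"
        using x t by simp
      show "\<forall>\<^sub>F n in sequentially. (X n, S n) \<in> ?E \<times> ?I"
        using XE S by (intro always_eventually) (auto simp: ext less_imp_le)
    qed
    ultimately show "u x t = 0"
      by (simp add: LIMSEQ_const_iff)
  qed
qed

end
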